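(* Let $M$ be a connected compact oriented triangulated three-dimensional manifold with $m\ge 0$ boundary components, with real vertex coordinates in general position and with fixed minimal rigid constructions in $M$ and in each boundary component. Then the generating function for the invariants $I_{\mathcal C,\mathcal D}(M)$, where $\mathcal C,\mathcal D$ range over ordered sets of edges from $\bigcup_{k=1}^m\mathcal E^{(k)}_{\mathrm{boundary}}$, is $$\mathbf I_M(a_{\mathrm{boundary}},a^*_{\mathrm{boundary}})=\frac{\operatorname{minor} f_1\,\operatorname{minor} f_5}{\operatorname{minor} f_2\,\operatorname{minor} f_4}\;\frac{\prod_{\text{over all tetrahedra}}(-6V)}{\prod_{\text{over inner edges}}l^2}\;\Phi(a_{\mathrm{boundary}},a^*_{\mathrm{boundary}}),$$ where $$\Phi(a_{\mathrm{boundary}},a^*_{\mathrm{boundary}})=\int \exp f(a,a^* )\prod_{i\in\mathcal E_{\mathrm{inner}}}da_i^*\,da_i,\qquad f(a,a^* )=\sum_{i,j\in\mathcal E}(\tilde f_3)_{ij}\,a_i a_j^* .$$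
   Context: Inner vertices/edges are those not lying in $\partial M$; boundary ones lie in $\partial M$. Unperturbed coordinates. Each vertex $A$ is assigned a point $(x_A,y_A,z_A)\in\mathbb R^3$, in general position. Each tetrahedron becomes a Euclidean tetrahedron with edge lengths $l$ and nonzero oriented volume $V$ (positive iff the orientation from $M$ agrees with that of $\mathbb R^3$). The triangulation is assumed to have at least three inner vertices. Angles. Dihedral angles of a tetrahedron are functions of its six edge lengths near the unperturbed ones, taken with the sign of its oriented volume. For an inner edge $i$, the deficit angle $\omega_i$ is $2\pi$ minus the sum (modulo $2\pi$) of signed dihedral angles at $i$; for a boundary edge $i$, $\alpha_i$ is minus the sum of signed dihedral angles at $i$. The matrix of partial derivatives $\partial(\omega\text{ or }\alpha)_i/\partial l_j$ over all edges, at the unperturbed lengths, is symmetric. Complex. For sets $\mathcal C,\mathcal D$ of boundary edges of equal cardinality consider the complex $$0\to \mathfrak e(3) \xrightarrow{f_1} (dx_{\mathrm{inner}})\oplus m\,\mathfrak e(3) \xrightarrow{f_2} (dl) \xrightarrow{f_3} (d\omega,d\alpha) \xrightarrow{f_4} (dx_{\mathrm{inner}}^* )\oplus m\,\mathfrak e(3)^* \xrightarrow{f_5} \mathfrak e(3)^*\to 0 .$$ Here $\mathfrak e(3)$ is the Lie algebra of infinitesimal isometries of $\mathbb R^3$ with the basis of three translations and three rotations; $(dx_{\mathrm{inner}})$ consists of coordinate differentials of inner vertices; $m\,\mathfrak e(3)$ consists of sways, i.e. one infinitesimal Euclidean motion of each boundary component as a whole; $(dl)$ consists of length differentials of inner edges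 and edges in $\mathcal C$; $(d\omega,d\alpha)$ consists of $d\omega_i$ for inner edges and $d\alpha_k$ for $k\in\mathcal D$. $f_1$ sends $a$ to the displacements of inner vertices under $a$ and to $m$ identical sways $a$; $f_2$ gives the changes of lengths caused by inner vertex displacements and sways ($dl_i=0$ for boundary edges); $f_3$ is the matrix of partial derivatives of the angles with respect to the lengths (boundary lengths outside $\mathcal C$ fixed); $f_4=-(f_2^{\mathcal D})^{\mathrm T}$, where $f_2^{\mathcal D}$ is $f_2$ with $\mathcal C$ replaced by $\mathcal D$; $f_5=f_1^{\mathrm T}$. Minimal rigid constructions. A minimal rigid construction in $M$ is a minimal set of inner edges such that, if their lengths are fixed and every boundary component is required to be rigid (to move only as a whole), all vertices of $M$ can move (infinitesimally) in $\mathbb R^3$ only as a whole. A minimal rigid construction in a connected triangulated surface is a set of the minimal number of its edges such that, if their lengths are fixed, all vertices of the surface can move (infinitesimally) in $\mathbb R^3$ only as a whole. One such construction is fixed in $M$ and one in each boundary component. Edge sets. $\mathcal E_{\mathrm{inner}}$ is the set of inner edges not in the minimal rigid construction of $M$; $\mathcal E^{(k)}_{\mathrm{boundary}}$ is the set of edges of the $k$-th boundary component not in its minimal rigid construction; $\mathcal E=\mathcal E_{\mathrm{inner}}\cup\bigcup_{k=1}^m\mathcal E^{(k)}_{\mathrm{boundary}}$. $\tilde f_3$ is the (symmetric) matrix $\bigl(\partial(\omega\text{ or }\alpha)_i/\partial l_j\bigr)_{i,j\in\mathcal E}$. Minors and invariants. Choose inner vertices $A,B,C$. $\operatorname{minor}f_1$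 uses the rows of $f_1$ corresponding to $dx_A,dy_A,dz_A,dy_B,dz_B,dz_C$, and $\operatorname{minor}f_5$ the corresponding columns of $f_5$. $\operatorname{minor}f_2$ uses the rows corresponding to the edges of the minimal rigid construction of $M$ and all columns except those six; $\operatorname{minor}f_4$ is chosen symmetrically (columns for the edges of the minimal rigid construction, all rows except those six). $\operatorname{minor}f_3$ is the minor formed by the edges in $\mathcal E_{\mathrm{inner}}$ (taken in the same order in rows and columns) followed by $\mathcal C$ for the $l$-index and by $\mathcal D$ for the angle index, $\mathcal C$ and $\mathcal D$ being ordered; by symmetry of $\tilde f_3$ the roles of rows and columns may be interchanged. The torsion is $$\tau=\frac{\operatorname{minor}f_1\,\operatorname{minor}f_3\,\operatorname{minor}f_5}{\operatorname{minor}f_2\,\operatorname{minor}f_4}$$ (zero if the complex is not acyclic), and $$I_{\mathcal C,\mathcal D}(M)=\frac{\tau\prod_{\text{over all tetrahedra}}(-6V)}{\prod_{\text{over inner edges}}l^2}.$$ Grassmann variables. To each edge $i\in\mathcal E$ two Grassmann (mutually anti-commuting, square-zero) generators $a_i,a_i^*$ are assigned; $a,a^*$ denote all of them, $a_{\mathrm{boundary}},a^*_{\mathrm{boundary}}$ those for $i\in\bigcup_k\mathcal E^{(k)}_{\mathrm{boundary}}$. The Berezin integral is defined by $\int da_i=0$, $\int a_i\,da_i=1$, $\int gh\,da_i=g\int h\,da_i$ if $g$ does not depend on $a_i$; multiple integrals are iterated, the leftmost differential being integrated first. The generating function of quantities attributed to pairs of ordered sets $\mathcal C=(i_1,\dots,i_n)$,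 $\mathcal D=(j_1,\dots,j_n)$ is the polynomial in the Grassmann generators whose coefficient at $\prod_{k=1}^n a_{i_k}a_{j_k}^*$ is the quantity attributed to $(\mathcal C,\mathcal D)$, while the coefficients at monomials with different numbers of unstarred and starred generators vanish. *)

theory Defs
  imports "HOL-Analysis.Analysis" "Jordan_Normal_Form.Determinant"
begin

no_notation Matrix.vec_index (infixl \<open>$\<close> 100)
no_notation Matrix.scalar_prod (infix \<open>\<bullet>\<close> 70)


section \<open>Grassmann algebras and the Berezin integral\<close>

text \<open>
  A Grassmann polynomial in generators of type \<^typ>\<open>'x\<close> is represented by its coefficients: the value
  at a word \<open>[x\<^sub>1, \<dots>, x\<^sub>n]\<close> of distinct generators is the coefficient at the monomial
  \<open>x\<^sub>1 \<cdots> x\<^sub>n\<close> written in that order.  Coefficients change sign when two neighbouring generators are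
  exchanged, so they vanish on words with repetitions, and no order on the generators has to be
  chosen.
\<close>

definition alternating :: "('x list \<Rightarrow> real) \<Rightarrow> bool" where
  "alternating c \<longleftrightarrow> (\<forall>us x y vs. c (us @ x # y # vs) = - c (us @ y # x # vs))"

definition finitely_supported :: "('x list \<Rightarrow> real) \<Rightarrow> bool" where
  "finitely_supported c \<longleftrightarrow> (\<exists>X. finite X \<and> (\<forall>us. c us \<noteq> 0 \<longrightarrow> set us \<subseteq> X))"

typedef 'x grassmann = "{c :: 'x list \<Rightarrow> real. alternating c \<and> finitely_supported c}"
  morphisms coefficient Abs_grassmann
  by (rule exI[of _ "\<lambda>_. 0"]) (auto simp: alternating_def finitely_supported_def)

setup_lifting type_definition_grassmann

text \<open>
  The product is determined by the graded Leibniz rule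
  \<open>\<partial>\<^sub>x (c d) = (\<partial>\<^sub>x c) d + c' (\<partial>\<^sub>x d)\<close> for the left derivative
  \<open>(\<partial>\<^sub>x c) us = c (x # us)\<close>, where \<open>c'\<close> is \<open>c\<close> with its odd part negated.
\<close>

fun gmult :: "('x list \<Rightarrow> real) \<Rightarrow> ('x list \<Rightarrow> real) \<Rightarrow> 'x list \<Rightarrow> real" where
  "gmult c d [] = c [] * d []"
| "gmult c d (x # us) =
     gmult (\<lambda>vs. c (x # vs)) d us + gmult (\<lambda>vs. (- 1) ^ length vs * c vs) (\<lambda>vs. d (x # vs)) us"

lemma gmult_add_left: "gmult (\<lambda>vs. c vs + c' vs) d us = gmult c d us + gmult c' d us"
  by (induction us arbitrary: c c' d) (simp_all add: distrib_left distrib_right)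

lemma gmult_add_right: "gmult c (\<lambda>vs. d vs + d' vs) us = gmult c d us + gmult c d' us"
  by (induction us arbitrary: c d d') (simp_all add: distrib_left)

lemma gmult_scale_left: "gmult (\<lambda>vs. r * c vs) d us = r * gmult c d us"
proof (induction c d us rule: gmult.induct)
  case (2 c d x us)
  have "(\<lambda>vs. (- 1) ^ length vs * (r * c vs)) = (\<lambda>vs. r * ((- 1) ^ length vs * c vs))"
    by (simp add: mult.left_commute)
  with 2 show ?case by (simp add: distrib_left)
qed simp

lemma gmult_scale_right: "gmult c (\<lambda>vs. r * d vs) us = r * gmult c d us"
  by (induction us arbitrary: c d) (simp_all add: distrib_left)

lemma gmult_zero_left [simp]: "gmult (\<lambda>vs. 0) d us = 0"
  using gmult_scale_left[of 0 "\<lambda>_. 0" d us] by simp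

lemma gmult_zero_right [simp]: "gmult c (\<lambda>vs. 0) us = 0"
  using gmult_scale_right[of c 0 "\<lambda>_. 0" us] by simp

lemma gmult_uminus_left: "gmult (\<lambda>vs. - c vs) d us = - gmult c d us"
  using gmult_scale_left[of "- 1" c d us] by simp

lemma gmult_uminus_right: "gmult c (\<lambda>vs. - d vs) us = - gmult c d us"
  using gmult_scale_right[of c "- 1" d us] by simp

lemma gmult_parity:
  "(- 1) ^ length us * gmult c d us =
     gmult (\<lambda>vs. (- 1) ^ length vs * c vs) (\<lambda>vs. (- 1) ^ length vs * d vs) us"
proof (induction us arbitrary: c d)
  case (Cons x us)
  show ?case
    by (simp add: gmult_uminus_left gmult_uminus_right distrib_left Cons.IH)
qed simp

lemma gmult_assoc: "gmult (\<lambda>vs. gmult c d vs) e us = gmult c (\<lambda>vs. gmult d e vs) us"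
proof (induction us arbitrary: c d e)
  case (Cons x us)
  show ?case
    by (simp add: Cons.IH gmult_add_left gmult_add_right gmult_parity)
qed simp

lemma gmult_one_left: "gmult (\<lambda>vs. if vs = [] then 1 else 0) d us = d us"
proof (induction us arbitrary: d)
  case (Cons x us)
  have "(\<lambda>vs. (- 1) ^ length vs * (if vs = [] then 1 else 0)) =
        (\<lambda>vs::'a list. if vs = [] then 1 else (0::real))" by auto
  then show ?case using Cons.IH by simp
qed simp

lemma gmult_one_right: "gmult c (\<lambda>vs. if vs = [] then 1 else 0) us = c us"
  by (induction us arbitrary: c) simp_all

lemma alternatingD: "alternating c \<Longrightarrow> c (us @ x # y # vs) = - c (us @ y # x # vs)"
  unfolding alternating_def by blast

lemma alternating_Cons: "alternating c \<Longrightarrow> alternating (\<lambda>vs. c (x # vs))"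
  unfolding alternating_def by (metis append_Cons)

lemma alternating_parity: "alternating c \<Longrightarrow> alternating (\<lambda>vs. (- 1) ^ length vs * c vs)"
  unfolding alternating_def by (metis (no_types, lifting) length_append length_Cons mult_minus_right)

lemma alternating_gmult:
  assumes "alternating c" "alternating d"
  shows "alternating (gmult c d)"
proof -
  have "gmult c d (us @ x # y # vs) = - gmult c d (us @ y # x # vs)"
    if "alternating c" "alternating d" for c d :: "'a list \<Rightarrow> real" and us x y vs
    using that
  proof (induction us arbitrary: c d)
    case Nil
    have c: "(\<lambda>ws. c (x # y # ws)) = (\<lambda>ws. - c (y # x # ws))"
      and d: "(\<lambda>ws. d (x # y # ws)) = (\<lambda>ws. - d (y # x # ws))"
      using Nil unfolding alternating_def by (metis append_Nil)+
    show ?case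
      unfolding append_Nil gmult.simps c d list.size
      by (simp only: power_Suc power_add power_one_right mult_minus_left mult_minus_right mult_1_left
          minus_minus gmult_uminus_left gmult_uminus_right power2_eq_square) simp
  next
    case (Cons z us)
    show ?case
      using Cons.IH[OF alternating_Cons[OF Cons.prems(1), of z] Cons.prems(2)]
        Cons.IH[OF alternating_parity[OF Cons.prems(1)] alternating_Cons[OF Cons.prems(2), of z]]
      by simp
  qed
  then show ?thesis using assms unfolding alternating_def by blast
qed

lemma gmult_support:
  assumes "\<And>us. c us \<noteq> 0 \<Longrightarrow> set us \<subseteq> X" "\<And>us. d us \<noteq> 0 \<Longrightarrow> set us \<subseteq> X" "gmult c d us \<noteq> 0"
  shows "set us \<subseteq> X"
  using assms
proof (induction us arbitrary: c d)
  case (Cons x us)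
  consider "gmult (\<lambda>vs. c (x # vs)) d us \<noteq> 0"
    | "gmult (\<lambda>vs. (- 1) ^ length vs * c vs) (\<lambda>vs. d (x # vs)) us \<noteq> 0"
    using Cons.prems(3) by fastforce
  then show ?case
  proof cases
    case 1
    have "set us \<subseteq> X"
    proof (rule Cons.IH[OF _ _ 1])
      show "set vs \<subseteq> X" if "c (x # vs) \<noteq> 0" for vs using Cons.prems(1)[OF that] by simp
    qed (rule Cons.prems(2))
    moreover have "x \<in> X"
    proof (rule ccontr)
      assume "x \<notin> X"
      then have "(\<lambda>vs. c (x # vs)) = (\<lambda>_. 0)" using Cons.prems(1) by fastforce
      then show False using 1 by simp
    qed
    ultimately show ?thesis by simp
  next
    case 2
    have "set us \<subseteq> X"
    proof (rule Cons.IH[OF _ _ 2])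
      show "set vs \<subseteq> X" if "(- 1) ^ length vs * c vs \<noteq> 0" for vs
        using Cons.prems(1) that by simp
      show "set vs \<subseteq> X" if "d (x # vs) \<noteq> 0" for vs using Cons.prems(2)[OF that] by simp
    qed
    moreover have "x \<in> X"
    proof (rule ccontr)
      assume "x \<notin> X"
      then have "(\<lambda>vs. d (x # vs)) = (\<lambda>_. 0)" using Cons.prems(2) by fastforce
      then show False using 2 by simp
    qed
    ultimately show ?thesis by simp
  qed
qed simp

lemma finitely_supported_gmult:
  assumes "finitely_supported c" "finitely_supported d"
  shows "finitely_supported (gmult c d)"
proof -
  obtain X Y where "finite X" "\<And>us. c us \<noteq> 0 \<Longrightarrow> set us \<subseteq> X"
    and "finite Y" "\<And>us. d us \<noteq> 0 \<Longrightarrow> set us \<subseteq> Y"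
    using assms unfolding finitely_supported_def by blast
  then have "finite (X \<union> Y)" "\<And>us. gmult c d us \<noteq> 0 \<Longrightarrow> set us \<subseteq> X \<union> Y"
    using gmult_support[of c "X \<union> Y" d] by blast+
  then show ?thesis unfolding finitely_supported_def by (intro exI[of _ "X \<union> Y"]) simp
qed

lemma finitely_supported_add:
  assumes "finitely_supported c" "finitely_supported d"
  shows "finitely_supported (\<lambda>us. c us + d us)"
proof -
  obtain X Y where "finite X" "\<And>us. c us \<noteq> 0 \<Longrightarrow> set us \<subseteq> X"
    and "finite Y" "\<And>us. d us \<noteq> 0 \<Longrightarrow> set us \<subseteq> Y"
    using assms unfolding finitely_supported_def by blast
  note XY = this
  have "set us \<subseteq> X \<union> Y" if "c us + d us \<noteq> 0" for us
  proof (cases "c us = 0")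
    case True
    then show ?thesis using that XY(4)[of us] by auto
  next
    case False
    then show ?thesis using XY(2)[of us] by auto
  qed
  then show ?thesis
    unfolding finitely_supported_def using XY(1,3) by (intro exI[of _ "X \<union> Y"]) simp
qed

lemma finitely_supported_scale: "finitely_supported c \<Longrightarrow> finitely_supported (\<lambda>us. r * c us)"
  unfolding finitely_supported_def by auto

lemma alternating_add: "alternating c \<Longrightarrow> alternating d \<Longrightarrow> alternating (\<lambda>us. c us + d us)"
  unfolding alternating_def by (metis minus_add_distrib)

lemma alternating_scale: "alternating c \<Longrightarrow> alternating (\<lambda>us. r * c us)"
  unfolding alternating_def by (metis mult_minus_right)

instantiation grassmann :: (type) real_algebra_1
begin

lift_definition zero_grassmann :: "'a grassmann" is "\<lambda>_. 0"
  by (auto simp: alternating_def finitely_supported_def)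

lift_definition one_grassmann :: "'a grassmann" is "\<lambda>us. if us = [] then 1 else 0"
  unfolding alternating_def finitely_supported_def by (intro conjI exI[of _ "{}"]) simp_all

lift_definition plus_grassmann :: "'a grassmann \<Rightarrow> 'a grassmann \<Rightarrow> 'a grassmann"
  is "\<lambda>c d us. c us + d us"
  by (simp add: alternating_add finitely_supported_add)

lift_definition uminus_grassmann :: "'a grassmann \<Rightarrow> 'a grassmann" is "\<lambda>c us. - 1 * c us"
  by (intro conjI alternating_scale finitely_supported_scale) simp_all

definition minus_grassmann :: "'a grassmann \<Rightarrow> 'a grassmann \<Rightarrow> 'a grassmann" where
  "minus_grassmann g h = g + - h"

lift_definition scaleR_grassmann :: "real \<Rightarrow> 'a grassmann \<Rightarrow> 'a grassmann"
  is "\<lambda>r c us. r * c us"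
  by (simp add: alternating_scale finitely_supported_scale)

lift_definition times_grassmann :: "'a grassmann \<Rightarrow> 'a grassmann \<Rightarrow> 'a grassmann" is gmult
  by (simp add: alternating_gmult finitely_supported_gmult)

instance
proof
  fix f g h :: "'a grassmann" and r s :: real
  show "f + g + h = f + (g + h)"
    by transfer (simp add: add.assoc)
  show "f + g = g + f"
    by transfer (simp add: add.commute)
  show "0 + f = f"
    by transfer simp
  show "- f + f = 0"
    by transfer simp
  show "f - g = f + - g"
    by (simp add: minus_grassmann_def)
  show "r *\<^sub>R (f + g) = r *\<^sub>R f + r *\<^sub>R g"
    by transfer (simp add: distrib_left)
  show "(r + s) *\<^sub>R f = r *\<^sub>R f + s *\<^sub>R f"
    by transfer (simp add: distrib_right)
  show "r *\<^sub>R s *\<^sub>R f = (r * s) *\<^sub>R f"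
    by transfer (simp add: mult.assoc)
  show "1 *\<^sub>R f = f"
    by transfer simp
  show "f * g * h = f * (g * h)"
    by transfer (simp add: gmult_assoc fun_eq_iff)
  show "(f + g) * h = f * h + g * h"
    by transfer (simp add: gmult_add_left fun_eq_iff)
  show "f * (g + h) = f * g + f * h"
    by transfer (simp add: gmult_add_right fun_eq_iff)
  show "1 * f = f"
    by transfer (simp add: gmult_one_left fun_eq_iff)
  show "f * 1 = f"
    by transfer (simp add: gmult_one_right fun_eq_iff)
  show "r *\<^sub>R f * g = r *\<^sub>R (f * g)"
    by transfer (simp add: gmult_scale_left fun_eq_iff)
  show "f * r *\<^sub>R g = r *\<^sub>R (f * g)"
    by transfer (simp add: gmult_scale_right fun_eq_iff)
  show "(0::'a grassmann) \<noteq> 1"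
    by transfer (simp add: fun_eq_iff)
qed

end

lift_definition gen :: "'x \<Rightarrow> 'x grassmann" is "\<lambda>x us. if us = [x] then 1 else 0"
proof -
  fix x :: 'x
  have "us @ y # z # vs \<noteq> [x]" for us vs y z by (cases us) auto
  then show "alternating (\<lambda>us. if us = [x] then 1 else 0) \<and>
      finitely_supported (\<lambda>us. if us = [x] then 1 else 0)"
    unfolding alternating_def finitely_supported_def by (intro conjI exI[of _ "{x}"]) simp_all
qed

text \<open>The integral strips the generator from the right end of each monomial.\<close>

lift_definition berezin :: "'x \<Rightarrow> 'x grassmann \<Rightarrow> 'x grassmann" is "\<lambda>x c us. c (us @ [x])"
proof (intro conjI)
  fix x :: 'x and c :: "'x list \<Rightarrow> real"
  assume c: "alternating c \<and> finitely_supported c"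
  show "alternating (\<lambda>us. c (us @ [x]))"
    unfolding alternating_def append_assoc append_Cons
    by (intro allI alternatingD conjunct1[OF c])
  show "finitely_supported (\<lambda>us. c (us @ [x]))"
  proof -
    obtain X where X: "finite X" "\<And>us. c us \<noteq> 0 \<Longrightarrow> set us \<subseteq> X"
      using c unfolding finitely_supported_def by blast
    then have "set us \<subseteq> X" if "c (us @ [x]) \<noteq> 0" for us
      using X(2)[OF that] by simp
    then show ?thesis
      unfolding finitely_supported_def using X(1) by blast
  qed
qed

text \<open>The leftmost differential of the list is integrated first.\<close>

definition berezin_list :: "'x list \<Rightarrow> 'x grassmann \<Rightarrow> 'x grassmann" where
  "berezin_list xs h = fold berezin xs h"

text \<open>The sum has finitely many terms when \<open>h\<close> is nilpotent, and all omitted terms are zero.\<close>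

definition gexp :: "'x grassmann \<Rightarrow> 'x grassmann" where
  "gexp h = (\<Sum>n | h ^ n \<noteq> 0. (1 / fact n) *\<^sub>R h ^ n)"

definition independent_of :: "'x \<Rightarrow> 'x grassmann \<Rightarrow> bool" where
  "independent_of x g \<longleftrightarrow> (\<forall>us. x \<in> set us \<longrightarrow> coefficient g us = 0)"

lemma gmult_gen:
  "gmult (\<lambda>us. if us = [x] then 1 else 0) d us =
     (\<Sum>i<length us. if us ! i = x then (- 1) ^ i * d (take i us @ drop (Suc i) us) else 0)"
proof (induction us arbitrary: d)
  case (Cons y us)
  have "(\<lambda>vs. (- 1) ^ length vs * (if vs = [x] then 1 else 0)) =
        (\<lambda>vs. - 1 * (if vs = [x] then 1 else (0::real)))" by auto
  moreover have "gmult (\<lambda>vs. if y # vs = [x] then 1 else 0) d us = (if y = x then d us else 0)"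
    using gmult_one_left[of d us] by (cases "y = x") simp_all
  ultimately have "gmult (\<lambda>us. if us = [x] then 1 else 0) d (y # us) = (if y = x then d us else 0) -
      (\<Sum>i<length us. if us ! i = x then (- 1) ^ i * d (y # take i us @ drop (Suc i) us) else 0)"
    by (simp add: gmult_uminus_left Cons.IH)
  also have "\<dots> = (if y = x then d us else 0) +
      (\<Sum>i<length us. if us ! i = x
         then (- 1) ^ Suc i * d (y # take i us @ drop (Suc i) us) else 0)"
    by (simp add: sum_negf[symmetric] del: sum_negf) (rule sum.cong, auto)
  finally show ?case
    unfolding length_Cons sum.lessThan_Suc_shift nth_Cons_Suc take_Suc_Cons drop_Suc_Cons append_Cons
    by simp
qed simp

lemma coefficient_monomial:
  "distinct xs \<Longrightarrow> coefficient (prod_list (map gen xs)) xs = 1"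
proof (induction xs)
  case Nil
  show ?case by (simp add: one_grassmann.rep_eq)
next
  case (Cons x xs)
  have "(if (x # xs) ! i = x
      then (- 1) ^ i * coefficient (prod_list (map gen xs)) (take i (x # xs) @ drop (Suc i) (x # xs))
      else 0) = (if i = 0 then 1 else 0)" if "i < length (x # xs)" for i
    using that Cons by (cases i) auto
  then show ?case
    by (simp add: times_grassmann.rep_eq gen.rep_eq gmult_gen del: sum.lessThan_Suc)
qed

lemma gen_anticommute: "gen x * gen y = - (gen y * gen x)"
proof (transfer, rule ext)
  fix x y :: 'a and us :: "'a list"
  have zero: "gmult (\<lambda>us. if us = [x] then 1 else 0) (\<lambda>us. if us = [y] then 1 else 0) us = 0"
    if "length us \<noteq> 2" for x y
  proof -
    have "take i us @ drop (Suc i) us \<noteq> [y]" if "i < length us" for i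
    proof
      assume "take i us @ drop (Suc i) us = [y]"
      then have "length (take i us @ drop (Suc i) us) = 1" by simp
      then show False using that \<open>length us \<noteq> 2\<close> by simp
    qed
    then show ?thesis unfolding gmult_gen by (intro sum.neutral) auto
  qed
  show "gmult (\<lambda>us. if us = [x] then 1 else 0) (\<lambda>us. if us = [y] then 1 else 0) us =
    - 1 * gmult (\<lambda>us. if us = [y] then 1 else 0) (\<lambda>us. if us = [x] then 1 else 0) us"
  proof (cases "length us = 2")
    case True
    then obtain a b where "us = [a, b]" by (auto simp: length_Suc_conv numeral_2_eq_2)
    then show ?thesis by (simp add: gmult_gen numeral_2_eq_2 lessThan_Suc)
  qed (simp add: zero)
qed

lemma gen_square: "gen x * gen x = 0"
proof -
  have "gen x * gen x + gen x * gen x = 0"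
    using gen_anticommute[of x x] by (metis add.left_inverse)
  then have "2 *\<^sub>R (gen x * gen x) = 0" by (simp add: scaleR_2)
  then show ?thesis by simp
qed

lemma berezin_one: "berezin x 1 = 0"
  unfolding coefficient_inject[symmetric] berezin.rep_eq one_grassmann.rep_eq zero_grassmann.rep_eq
  by simp

lemma berezin_gen: "berezin x (gen x) = 1"
  unfolding coefficient_inject[symmetric] berezin.rep_eq one_grassmann.rep_eq gen.rep_eq by simp

lemma berezin_mult:
  assumes "independent_of x g"
  shows "berezin x (g * h) = g * berezin x h"
proof -
  have strip: "gmult c d (us @ [x]) = gmult c (\<lambda>vs. d (vs @ [x])) us"
    if "\<And>us. x \<in> set us \<Longrightarrow> c us = 0" for c d :: "'a list \<Rightarrow> real" and us
    using that
  proof (induction us arbitrary: c d)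
    case Nil
    have "c [x] = 0" by (rule Nil) simp
    moreover have zero: "(\<lambda>vs. c (x # vs)) = (\<lambda>_. 0)"
      by (rule ext, rule Nil) simp
    ultimately show ?case
      by (simp only: append_Nil gmult.simps gmult_zero_left) simp
  next
    case (Cons y us)
    have "gmult (\<lambda>vs. c (y # vs)) d (us @ [x]) = gmult (\<lambda>vs. c (y # vs)) (\<lambda>vs. d (vs @ [x])) us"
      by (rule Cons.IH, rule Cons.prems) simp
    moreover have "gmult (\<lambda>vs. (- 1) ^ length vs * c vs) (\<lambda>vs. d (y # vs)) (us @ [x]) =
        gmult (\<lambda>vs. (- 1) ^ length vs * c vs) (\<lambda>vs. d (y # vs @ [x])) us"
      by (rule Cons.IH) (simp add: Cons.prems)
    ultimately show ?case unfolding append_Cons gmult.simps by (simp only:)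
  qed
  have "coefficient g us = 0" if "x \<in> set us" for us
    using assms that unfolding independent_of_def by blast
  then have "gmult (coefficient g) (coefficient h) (us @ [x]) =
      gmult (coefficient g) (\<lambda>vs. coefficient h (vs @ [x])) us" for us
    by (rule strip)
  then show ?thesis
    unfolding coefficient_inject[symmetric] berezin.rep_eq times_grassmann.rep_eq by (rule ext)
qed

text \<open>For an edge \<open>e\<close>, \<open>gen (A e)\<close> is \<open>a\<^sub>e\<close> and \<open>gen (Astar e)\<close> is \<open>a\<^sub>e\<^sup>*\<close>.\<close>

datatype 'e grassmann_var = A 'e | Astar 'e

definition pair_word :: "'e list \<Rightarrow> 'e list \<Rightarrow> 'e grassmann_var list" where
  "pair_word cs ds = concat (map2 (\<lambda>i j. [A i, Astar j]) cs ds)"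

definition is_generating_function ::
    "'e set \<Rightarrow> ('e list \<Rightarrow> 'e list \<Rightarrow> real) \<Rightarrow> 'e grassmann_var grassmann \<Rightarrow> bool" where
  "is_generating_function B q P \<longleftrightarrow>
     (\<forall>cs ds. distinct cs \<and> distinct ds \<and> set cs \<subseteq> B \<and> set ds \<subseteq> B \<and> length cs = length ds \<longrightarrow>
        coefficient P (pair_word cs ds) = q cs ds) \<and>
     (\<forall>us. \<not> set us \<subseteq> A ` B \<union> Astar ` B \<longrightarrow> coefficient P us = 0) \<and>
     (\<forall>us. length (filter (\<lambda>u. u \<in> range A) us) \<noteq> length (filter (\<lambda>u. u \<in> range Astar) us) \<longrightarrow>
        coefficient P us = 0)"


section \<open>Triangulated three-manifolds with boundary\<close>

definition half_space3 :: "(real^3) set" where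
  "half_space3 = {y. 0 \<le> y $ 3}"

definition manifold3 :: "'a::euclidean_space set \<Rightarrow> bool" where
  "manifold3 X \<longleftrightarrow> (\<forall>x\<in>X. \<exists>U W. openin (top_of_set X) U \<and> x \<in> U \<and>
     openin (top_of_set half_space3) W \<and> U homeomorphic W)"

definition manifold3_boundary :: "'a::euclidean_space set \<Rightarrow> 'a set" where
  "manifold3_boundary X = {x\<in>X. \<not> (\<exists>U W. openin (top_of_set X) U \<and> x \<in> U \<and>
     open (W :: (real^3) set) \<and> U homeomorphic W)}"

text \<open>
  The triangulated manifold is the polyhedron \<open>\<Union>K\<close> of a simplicial complex \<open>K\<close>.  Simplices are
  handled through their vertex sets.
\<close>

definition simplices :: "'a::euclidean_space set set \<Rightarrow> nat \<Rightarrow> 'a set set" where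
  "simplices K d = {s. \<not> affine_dependent s \<and> card s = Suc d \<and> convex hull s \<in> K}"

abbreviation "edges K \<equiv> simplices K 1"
abbreviation "tetrahedra K \<equiv> simplices K 3"

definition vertices :: "'a::euclidean_space set set \<Rightarrow> 'a set" where
  "vertices K = {v. {v} \<in> K}"

definition boundary :: "'a::euclidean_space set set \<Rightarrow> 'a set" where
  "boundary K = manifold3_boundary (\<Union>K)"

definition boundary_components :: "'a::euclidean_space set set \<Rightarrow> 'a set set" where
  "boundary_components K = components (boundary K)"

definition inner_vertices :: "'a::euclidean_space set set \<Rightarrow> 'a set" where
  "inner_vertices K = {v \<in> vertices K. v \<notin> boundary K}"

definition inner_edges :: "'a::euclidean_space set set \<Rightarrow> 'a set set" where
  "inner_edges K = {e \<in> edges K. \<not> convex hull e \<subseteq> boundary K}"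

definition component_edges :: "'a::euclidean_space set set \<Rightarrow> 'a set \<Rightarrow> 'a set set" where
  "component_edges K \<kappa> = {e \<in> edges K. convex hull e \<subseteq> \<kappa>}"

text \<open>
  \<open>pos a b c d\<close> means that \<open>(a, b, c, d)\<close> is a positive ordering of the vertices of a tetrahedron.
  Transpositions reverse the orientation, and two tetrahedra with a common face induce opposite
  orientations on it.
\<close>

definition orientation ::
    "'a::euclidean_space set set \<Rightarrow> ('a \<Rightarrow> 'a \<Rightarrow> 'a \<Rightarrow> 'a \<Rightarrow> bool) \<Rightarrow> bool" where
  "orientation K pos \<longleftrightarrow>
     (\<forall>a b c d. {a, b, c, d} \<in> tetrahedra K \<longrightarrow>
        pos b a c d = (\<not> pos a b c d) \<and> pos a c b d = (\<not> pos a b c d) \<and>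
        pos a b d c = (\<not> pos a b c d)) \<and>
     (\<forall>a a' b c d. {a, b, c, d} \<in> tetrahedra K \<and> {a', b, c, d} \<in> tetrahedra K \<and> a \<noteq> a' \<longrightarrow>
        pos a' b c d = (\<not> pos a b c d))"


section \<open>Coordinates, lengths, volumes and angles\<close>

text \<open>
  Positions that are special only with respect to the coordinate axes are allowed.  If they make the
  minor of \<open>f1\<close> vanish, the torsion is \<open>0\<close>.
\<close>

definition general_position :: "'a::euclidean_space set set \<Rightarrow> ('a \<Rightarrow> real^3) \<Rightarrow> bool" where
  "general_position K p \<longleftrightarrow> inj_on p (vertices K) \<and>
     (\<forall>S \<subseteq> p ` vertices K. card S \<le> 4 \<longrightarrow> \<not> affine_dependent S)"

definition edge_length :: "('a \<Rightarrow> real^3) \<Rightarrow> 'a set \<Rightarrow> real" where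
  "edge_length p e = diameter (p ` e)"

lemma edge_length_pair: "edge_length p {a, b} = dist (p a) (p b)"
proof (rule antisym)
  have b: "bounded (p ` {a, b})" by (simp add: finite_imp_bounded)
  show "dist (p a) (p b) \<le> edge_length p {a, b}"
    unfolding edge_length_def by (rule diameter_bounded_bound[OF b]) auto
  show "edge_length p {a, b} \<le> dist (p a) (p b)"
    unfolding edge_length_def
    by (rule diameter_le) (auto simp: dist_norm norm_minus_commute)
qed

definition oriented_volume ::
    "('a \<Rightarrow> 'a \<Rightarrow> 'a \<Rightarrow> 'a \<Rightarrow> bool) \<Rightarrow> ('a \<Rightarrow> real^3) \<Rightarrow> 'a set \<Rightarrow> real" where
  "oriented_volume pos p t = (THE V. \<exists>a b c d. t = {a, b, c, d} \<and> pos a b c d \<and>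
     V = (cross3 (p b - p a) (p c - p a) \<bullet> (p d - p a)) / 6)"

text \<open>
  The dihedral angle at the edge \<open>ab\<close> of a tetrahedron \<open>abcd\<close> as a function of its six edge lengths:
  the angle between the components of \<open>v = c - a\<close> and \<open>w = d - a\<close> orthogonal to \<open>u = b - a\<close>, with the
  scalar products expressed by the law of cosines.
\<close>

definition dihedral_angle :: "('a set \<Rightarrow> real) \<Rightarrow> 'a \<Rightarrow> 'a \<Rightarrow> 'a \<Rightarrow> 'a \<Rightarrow> real" where
  "dihedral_angle l a b c d =
     (let uu = (l {a, b})\<^sup>2; vv = (l {a, c})\<^sup>2; ww = (l {a, d})\<^sup>2;
          uv = (uu + vv - (l {b, c})\<^sup>2) / 2;
          uw = (uu + ww - (l {b, d})\<^sup>2) / 2;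
          vw = (vv + ww - (l {c, d})\<^sup>2) / 2
      in arccos ((uu * vw - uv * uw) / (sqrt (uu * vv - uv\<^sup>2) * sqrt (uu * ww - uw\<^sup>2))))"

lemma dihedral_angle_geometric:
  fixes p :: "'a \<Rightarrow> real^3" and a b c d :: 'a
  assumes "p a \<noteq> p b"
  defines "u \<equiv> p b - p a"
  defines "orth \<equiv> \<lambda>x. x - ((x \<bullet> u) / (u \<bullet> u)) *\<^sub>R u"
  defines "v \<equiv> orth (p c - p a)" and "w \<equiv> orth (p d - p a)"
  shows "dihedral_angle (edge_length p) a b c d = arccos ((v \<bullet> w) / (norm v * norm w))"
proof -
  have uu: "u \<bullet> u > 0" using assms by simp
  have cos_law: "((dist x y)\<^sup>2 + (dist x z)\<^sup>2 - (dist y z)\<^sup>2) / 2 = (y - x) \<bullet> (z - x)"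
    for x y z :: "real^3"
    by (simp add: dist_norm power2_norm_eq_inner algebra_simps inner_commute add_divide_distrib
        diff_divide_distrib)
  have sq: "(dist x y)\<^sup>2 = (y - x) \<bullet> (y - x)" for x y :: "real^3"
    by (simp add: dist_norm power2_norm_eq_inner algebra_simps inner_commute)
  have orth: "(u \<bullet> u) * (orth x \<bullet> orth y) = (u \<bullet> u) * (x \<bullet> y) - (u \<bullet> x) * (u \<bullet> y)" for x y
  proof -
    have "orth x \<bullet> orth y = x \<bullet> y - (x \<bullet> u) * (y \<bullet> u) / (u \<bullet> u)"
      using uu unfolding orth_def
      by (simp add: inner_diff_left inner_diff_right inner_commute field_simps)
    then show ?thesis using uu by (simp add: field_simps inner_commute)
  qed
  have n: "sqrt ((u \<bullet> u) * (x \<bullet> x) - (u \<bullet> x)\<^sup>2) = sqrt (u \<bullet> u) * norm (orth x)" for x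
    using orth[of x x] by (simp add: power2_eq_square norm_eq_sqrt_inner real_sqrt_mult[symmetric])
  have dv: "dihedral_angle (edge_length p) a b c d =
    arccos (((u \<bullet> u) * ((p c - p a) \<bullet> (p d - p a)) - (u \<bullet> (p c - p a)) * (u \<bullet> (p d - p a))) /
      (sqrt ((u \<bullet> u) * ((p c - p a) \<bullet> (p c - p a)) - (u \<bullet> (p c - p a))\<^sup>2) *
       sqrt ((u \<bullet> u) * ((p d - p a) \<bullet> (p d - p a)) - (u \<bullet> (p d - p a))\<^sup>2)))"
    unfolding dihedral_angle_def Let_def edge_length_pair cos_law u_def
    by (simp only: sq)
  define V W where "V = norm v" and "W = norm w"
  define q where "q = sqrt (u \<bullet> u)"
  have q: "q * q = u \<bullet> u" "q > 0" using uu unfolding q_def by simp_all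
  have "((u \<bullet> u) * (v \<bullet> w)) / ((q * V) * (q * W)) = ((q * q) * (v \<bullet> w)) / ((q * q) * (V * W))"
    unfolding q(1)[symmetric] by (simp only: ac_simps)
  also have "\<dots> = (v \<bullet> w) / (V * W)" using q(2) by simp
  finally show ?thesis
    unfolding dv n orth[symmetric] v_def[symmetric] w_def[symmetric] V_def[symmetric]
      W_def[symmetric] q_def[symmetric] by simp
qed

lemma dihedral_angle_swap:
  "dihedral_angle l b a c d = dihedral_angle l a b c d"
  "dihedral_angle l a b d c = dihedral_angle l a b c d"
proof -
  define U V W Q R S where
    "U = (l {a, b})\<^sup>2" "V = (l {a, c})\<^sup>2" "W = (l {a, d})\<^sup>2"
    "Q = (l {b, c})\<^sup>2" "R = (l {b, d})\<^sup>2" "S = (l {c, d})\<^sup>2"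
  note d = this
  have 1: "U * ((Q + R - S) / 2) - ((U + Q - V) / 2) * ((U + R - W) / 2) =
        U * ((V + W - S) / 2) - ((U + V - Q) / 2) * ((U + W - R) / 2)"
    "U * Q - ((U + Q - V) / 2)\<^sup>2 = U * V - ((U + V - Q) / 2)\<^sup>2"
    "U * R - ((U + R - W) / 2)\<^sup>2 = U * W - ((U + W - R) / 2)\<^sup>2"
    by (simp_all add: field_simps power2_eq_square)
  show "dihedral_angle l b a c d = dihedral_angle l a b c d"
    unfolding dihedral_angle_def Let_def
    by (simp only: insert_commute[of b a] d[symmetric] 1)
  show "dihedral_angle l a b d c = dihedral_angle l a b c d"
    unfolding dihedral_angle_def Let_def
    by (simp add: insert_commute[of d c] mult.commute add.commute)
qed

text \<open>\<open>signed_dihedral pos p t e l\<close>: the angle at the edge \<open>e\<close> of \<open>t\<close> for edge lengths \<open>l\<close> near those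
  given by \<open>p\<close>, with the sign of the volume of \<open>t\<close> at \<open>p\<close>.\<close>

definition signed_dihedral ::
    "('a \<Rightarrow> 'a \<Rightarrow> 'a \<Rightarrow> 'a \<Rightarrow> bool) \<Rightarrow> ('a \<Rightarrow> real^3) \<Rightarrow> 'a set \<Rightarrow> 'a set \<Rightarrow> ('a set \<Rightarrow> real) \<Rightarrow> real" where
  "signed_dihedral pos p t e l = sgn (oriented_volume pos p t) *
     (THE \<phi>. \<exists>a b c d. e = {a, b} \<and> t = {a, b, c, d} \<and> \<phi> = dihedral_angle l a b c d)"

text \<open>
  Deficit angles are defined modulo \<open>2\<pi>\<close>; the real-valued representative below differs from any other
  smooth one by a constant and so has the same partial derivatives.
\<close>

definition angle_at ::
    "'a::euclidean_space set set \<Rightarrow> ('a \<Rightarrow> 'a \<Rightarrow> 'a \<Rightarrow> 'a \<Rightarrow> bool) \<Rightarrow> ('a \<Rightarrow> real^3) \<Rightarrow> 'a set \<Rightarrow>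
     ('a set \<Rightarrow> real) \<Rightarrow> real" where
  "angle_at K pos p i l =
     (if i \<in> inner_edges K then 2 * pi else 0) -
     (\<Sum>t | t \<in> tetrahedra K \<and> i \<subseteq> t. signed_dihedral pos p t i l)"

definition angle_matrix ::
    "'a::euclidean_space set set \<Rightarrow> ('a \<Rightarrow> 'a \<Rightarrow> 'a \<Rightarrow> 'a \<Rightarrow> bool) \<Rightarrow> ('a \<Rightarrow> real^3) \<Rightarrow>
     'a set \<Rightarrow> 'a set \<Rightarrow> real" where
  "angle_matrix K pos p i j =
     deriv (\<lambda>s. angle_at K pos p i ((edge_length p)(j := s))) (edge_length p j)"


section \<open>Infinitesimal motions and minimal rigid constructions\<close>

definition length_rate :: "('a \<Rightarrow> real^3) \<Rightarrow> ('a \<Rightarrow> real^3) \<Rightarrow> 'a set \<Rightarrow> real" where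
  "length_rate p \<xi> e = deriv (\<lambda>s. edge_length (\<lambda>v. p v + s *\<^sub>R \<xi> v) e) 0"

definition moves_as_whole :: "('a \<Rightarrow> real^3) \<Rightarrow> 'a set \<Rightarrow> ('a \<Rightarrow> real^3) \<Rightarrow> bool" where
  "moves_as_whole p S \<xi> \<longleftrightarrow> (\<exists>b r. \<forall>v\<in>S. \<xi> v = b + cross3 r (p v))"

definition rigid_construction ::
    "'a::euclidean_space set set \<Rightarrow> ('a \<Rightarrow> real^3) \<Rightarrow> 'a set set \<Rightarrow> bool" where
  "rigid_construction K p R \<longleftrightarrow> R \<subseteq> inner_edges K \<and>
     (\<forall>\<xi>. (\<forall>\<kappa>\<in>boundary_components K. moves_as_whole p (\<kappa> \<inter> vertices K) \<xi>) \<and>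
        (\<forall>e\<in>R. length_rate p \<xi> e = 0) \<longrightarrow> moves_as_whole p (vertices K) \<xi>)"

definition minimal_rigid_construction ::
    "'a::euclidean_space set set \<Rightarrow> ('a \<Rightarrow> real^3) \<Rightarrow> 'a set set \<Rightarrow> bool" where
  "minimal_rigid_construction K p R \<longleftrightarrow>
     rigid_construction K p R \<and> (\<forall>R'. R' \<subset> R \<longrightarrow> \<not> rigid_construction K p R')"

definition surface_rigid_construction ::
    "'a::euclidean_space set set \<Rightarrow> ('a \<Rightarrow> real^3) \<Rightarrow> 'a set \<Rightarrow> 'a set set \<Rightarrow> bool" where
  "surface_rigid_construction K p \<kappa> R \<longleftrightarrow> R \<subseteq> component_edges K \<kappa> \<and>
     (\<forall>\<xi>. (\<forall>e\<in>R. length_rate p \<xi> e = 0) \<longrightarrow> moves_as_whole p (\<kappa> \<inter> vertices K) \<xi>)"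

definition minimal_surface_rigid_construction ::
    "'a::euclidean_space set set \<Rightarrow> ('a \<Rightarrow> real^3) \<Rightarrow> 'a set \<Rightarrow> 'a set set \<Rightarrow> bool" where
  "minimal_surface_rigid_construction K p \<kappa> R \<longleftrightarrow> surface_rigid_construction K p \<kappa> R \<and>
     (\<forall>R'. surface_rigid_construction K p \<kappa> R' \<longrightarrow> card R \<le> card R')"

definition E_boundary ::
    "'a::euclidean_space set set \<Rightarrow> ('a set \<Rightarrow> 'a set set) \<Rightarrow> 'a set set" where
  "E_boundary K S = (\<Union>\<kappa>\<in>boundary_components K. component_edges K \<kappa> - S \<kappa>)"


section \<open>The complex and its torsion\<close>

datatype e3 = Translation 3 | Rotation 3

datatype 'a config = Disp 'a 3 | Sway "'a set" e3

definition config_indices :: "'a::euclidean_space set set \<Rightarrow> 'a config set" where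
  "config_indices K = {Disp v k | v k. v \<in> inner_vertices K} \<union>
     {Sway \<kappa> s | \<kappa> s. \<kappa> \<in> boundary_components K}"

fun isometry_field :: "e3 \<Rightarrow> real^3 \<Rightarrow> real^3" where
  "isometry_field (Translation k) x = axis k 1"
| "isometry_field (Rotation k) x = cross3 (axis k 1) x"

fun velocity :: "('a \<Rightarrow> real^3) \<Rightarrow> 'a config \<Rightarrow> 'a \<Rightarrow> real^3" where
  "velocity p (Disp v k) w = (if w = v then axis k 1 else 0)"
| "velocity p (Sway \<kappa> s) w = (if w \<in> \<kappa> then isometry_field s (p w) else 0)"

text \<open>
  Matrices are given by their entries; rows are the first argument.  The entries of \<open>f2\<close>, \<open>f3\<close> and
  \<open>f4\<close> do not depend on \<open>\<C>\<close> and \<open>\<D>\<close>, which only select rows and columns; \<open>f3\<close> is \<^const>\<open>angle_matrix\<close>.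
\<close>

fun f1 :: "('a \<Rightarrow> real^3) \<Rightarrow> 'a config \<Rightarrow> e3 \<Rightarrow> real" where
  "f1 p (Disp v k) s = isometry_field s (p v) $ k"
| "f1 p (Sway \<kappa> s') s = (if s' = s then 1 else 0)"

definition f2 :: "('a \<Rightarrow> real^3) \<Rightarrow> 'a set \<Rightarrow> 'a config \<Rightarrow> real" where
  "f2 p e c = length_rate p (velocity p c) e"

definition f4 :: "('a \<Rightarrow> real^3) \<Rightarrow> 'a config \<Rightarrow> 'a set \<Rightarrow> real" where
  "f4 p c e = - f2 p e c"

definition f5 :: "('a \<Rightarrow> real^3) \<Rightarrow> e3 \<Rightarrow> 'a config \<Rightarrow> real" where
  "f5 p s c = f1 p c s"

definition coord_space :: "'i set \<Rightarrow> ('i \<Rightarrow> real) set" where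
  "coord_space I = {x. \<forall>i. i \<notin> I \<longrightarrow> x i = 0}"

definition lin_map :: "'i set \<Rightarrow> 'j set \<Rightarrow> ('i \<Rightarrow> 'j \<Rightarrow> real) \<Rightarrow> ('j \<Rightarrow> real) \<Rightarrow> 'i \<Rightarrow> real" where
  "lin_map I J f x = (\<lambda>i. if i \<in> I then \<Sum>j\<in>J. f i j * x j else 0)"

definition exact_at ::
    "'i set \<Rightarrow> 'j set \<Rightarrow> 'k set \<Rightarrow> ('j \<Rightarrow> 'i \<Rightarrow> real) \<Rightarrow> ('k \<Rightarrow> 'j \<Rightarrow> real) \<Rightarrow> bool" where
  "exact_at I J L f g \<longleftrightarrow>
     lin_map J I f ` coord_space I = {y \<in> coord_space J. lin_map L J g y = (\<lambda>_. 0)}"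

definition acyclic_complex ::
    "'a::euclidean_space set set \<Rightarrow> ('a \<Rightarrow> 'a \<Rightarrow> 'a \<Rightarrow> 'a \<Rightarrow> bool) \<Rightarrow> ('a \<Rightarrow> real^3) \<Rightarrow>
     'a set set \<Rightarrow> 'a set set \<Rightarrow> bool" where
  "acyclic_complex K pos p C D \<longleftrightarrow>
     (let X = config_indices K; L = inner_edges K \<union> C; \<Omega> = inner_edges K \<union> D in
        inj_on (lin_map X UNIV (f1 p)) (coord_space UNIV) \<and>
        exact_at UNIV X L (f1 p) (f2 p) \<and>
        exact_at X L \<Omega> (f2 p) (angle_matrix K pos p) \<and>
        exact_at L \<Omega> X (angle_matrix K pos p) (f4 p) \<and>
        exact_at \<Omega> X UNIV (f4 p) (f5 p) \<and>
        lin_map UNIV X (f5 p) ` coord_space X = coord_space UNIV)"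

definition minor :: "('i \<Rightarrow> 'j \<Rightarrow> real) \<Rightarrow> 'i list \<Rightarrow> 'j list \<Rightarrow> real" where
  "minor f us vs =
     Determinant.det (Matrix.mat (length us) (length vs) (\<lambda>(i, j). f (us ! i) (vs ! j)))"

definition e3_basis :: "e3 list" where
  "e3_basis = [Translation 1, Translation 2, Translation 3, Rotation 1, Rotation 2, Rotation 3]"

definition six_coordinates :: "'a \<Rightarrow> 'a \<Rightarrow> 'a \<Rightarrow> 'a config list" where
  "six_coordinates vA vB vC = [Disp vA 1, Disp vA 2, Disp vA 3, Disp vB 2, Disp vB 3, Disp vC 3]"

definition minor_f1 :: "('a \<Rightarrow> real^3) \<Rightarrow> 'a \<Rightarrow> 'a \<Rightarrow> 'a \<Rightarrow> real" where
  "minor_f1 p vA vB vC = minor (f1 p) (six_coordinates vA vB vC) e3_basis"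

definition minor_f5 :: "('a \<Rightarrow> real^3) \<Rightarrow> 'a \<Rightarrow> 'a \<Rightarrow> 'a \<Rightarrow> real" where
  "minor_f5 p vA vB vC = minor (f5 p) e3_basis (six_coordinates vA vB vC)"

text \<open>
  \<open>rs\<close> and \<open>xs\<close> enumerate the minimal rigid construction of the manifold and the coordinates other
  than the six chosen ones; using the same enumerations for both minors makes them symmetric.
\<close>

definition minor_f2 :: "('a \<Rightarrow> real^3) \<Rightarrow> 'a set list \<Rightarrow> 'a config list \<Rightarrow> real" where
  "minor_f2 p rs xs = minor (f2 p) rs xs"

definition minor_f4 :: "('a \<Rightarrow> real^3) \<Rightarrow> 'a set list \<Rightarrow> 'a config list \<Rightarrow> real" where
  "minor_f4 p rs xs = minor (f4 p) xs rs"

definition minor_f3 ::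
    "'a::euclidean_space set set \<Rightarrow> ('a \<Rightarrow> 'a \<Rightarrow> 'a \<Rightarrow> 'a \<Rightarrow> bool) \<Rightarrow> ('a \<Rightarrow> real^3) \<Rightarrow>
     'a set list \<Rightarrow> 'a set list \<Rightarrow> 'a set list \<Rightarrow> real" where
  "minor_f3 K pos p es cs ds = minor (angle_matrix K pos p) (es @ ds) (es @ cs)"

definition torsion ::
    "'a::euclidean_space set set \<Rightarrow> ('a \<Rightarrow> 'a \<Rightarrow> 'a \<Rightarrow> 'a \<Rightarrow> bool) \<Rightarrow> ('a \<Rightarrow> real^3) \<Rightarrow>
     'a \<Rightarrow> 'a \<Rightarrow> 'a \<Rightarrow> 'a set list \<Rightarrow> 'a config list \<Rightarrow> 'a set list \<Rightarrow>
     'a set list \<Rightarrow> 'a set list \<Rightarrow> real" where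
  "torsion K pos p vA vB vC rs xs es cs ds =
     (if acyclic_complex K pos p (set cs) (set ds)
      then minor_f1 p vA vB vC * minor_f3 K pos p es cs ds * minor_f5 p vA vB vC /
           (minor_f2 p rs xs * minor_f4 p rs xs)
      else 0)"

definition invariant ::
    "'a::euclidean_space set set \<Rightarrow> ('a \<Rightarrow> 'a \<Rightarrow> 'a \<Rightarrow> 'a \<Rightarrow> bool) \<Rightarrow> ('a \<Rightarrow> real^3) \<Rightarrow>
     'a \<Rightarrow> 'a \<Rightarrow> 'a \<Rightarrow> 'a set list \<Rightarrow> 'a config list \<Rightarrow> 'a set list \<Rightarrow>
     'a set list \<Rightarrow> 'a set list \<Rightarrow> real" where
  "invariant K pos p vA vB vC rs xs es cs ds =
     torsion K pos p vA vB vC rs xs es cs ds *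
     (\<Prod>t\<in>tetrahedra K. - 6 * oriented_volume pos p t) / (\<Prod>e\<in>inner_edges K. (edge_length p e)\<^sup>2)"


section \<open>The Gaussian Berezin integral\<close>

definition quadratic_form ::
    "'e set \<Rightarrow> ('e \<Rightarrow> 'e \<Rightarrow> real) \<Rightarrow> 'e grassmann_var grassmann" where
  "quadratic_form E F = (\<Sum>i\<in>E. \<Sum>j\<in>E. F i j *\<^sub>R (gen (A i) * gen (Astar j)))"

definition \<Phi> :: "'e list \<Rightarrow> 'e set \<Rightarrow> ('e \<Rightarrow> 'e \<Rightarrow> real) \<Rightarrow> 'e grassmann_var grassmann" where
  "\<Phi> es E F = berezin_list (concat (map (\<lambda>e. [Astar e, A e]) es)) (gexp (quadratic_form E F))"

end

theory Submission
  imports Defs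
begin

text \<open>
  The right-hand side is a constant times \<open>\<Phi>\<close>, and the left-hand side is the same constant times
  \<open>minor f\<^sub>3\<close> whenever the complex is acyclic.  So three things have to be known: the coefficients of
  \<open>\<Phi>\<close> are the minors of \<open>f\<^sub>3\<close>, the matrix of angle derivatives is symmetric, and the quotient of
  minors that defines the torsion vanishes when the complex is not acyclic.

  \<^emph>\<open>Coefficients.\<close>  The Gaussian satisfies \<open>\<partial> exp f / \<partial> a\<^sub>i = (\<Sum>\<^sub>j F\<^sub>i\<^sub>j a\<^sub>j\<^sup>*) exp f\<close>.  Read on coefficients,
  this is the Laplace expansion of a determinant along its first row, so the coefficient of \<open>exp f\<close> at
  \<open>\<Prod> a\<^sub>i a\<^sub>j\<^sup>*\<close> is the minor of \<open>F\<close> with rows \<open>i\<close> and columns \<open>j\<close> (lemma \<open>coefficient_gexp_pair_word\<close>).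
  Integrating over \<open>a\<^sub>e\<^sup>*, a\<^sub>e\<close> reads off the coefficient at the word extended by \<open>a\<^sub>e a\<^sub>e\<^sup>*\<close>, which adds the
  row and the column \<open>e\<close> to the minor.  The rows of this minor are indexed by \<open>\<C>\<close> and those of
  \<open>minor f\<^sub>3\<close> by \<open>\<D>\<close>; symmetry of \<open>F\<close> exchanges the two.

  \<^emph>\<open>Symmetry.\<close>  In one tetrahedron the derivatives of the angle at one edge by the length of another
  are computed explicitly.  For opposite edges they are \<open>l\<^sub>a\<^sub>b l\<^sub>c\<^sub>d / (6|V|)\<close>; for adjacent edges symmetry
  is a polynomial identity between squared lengths (lemma \<open>tetrahedron_rate_symmetric\<close>).

  \<^emph>\<open>Acyclicity.\<close>  It suffices that a complex all of whose chosen minors are nonzero is exact.  These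
  minors use complementary sets of basis vectors in each space, so this is linear algebra once the
  sequence is known to be a complex (lemma \<open>acyclic_if_minors_nonzero\<close>).  The last two compositions
  are, up to sign, transposes of the first two, the one of \<open>f\<^sub>4\<close> and \<open>f\<^sub>3\<close> by symmetry.  Here \<open>f\<^sub>2 f\<^sub>1 = 0\<close> because Euclidean motions preserve
  lengths, and \<open>f\<^sub>3 f\<^sub>2 = 0\<close> because the sum of the signed dihedral angles around an edge is unchanged when
  the vertices move in space and each boundary component moves rigidly.

  The latter is proved without describing the link of an edge.  The signed angle of \<open>abcd\<close> at \<open>ab\<close>
  changes at the difference of the rates at which \<open>d\<close> and \<open>c\<close> turn about the line \<open>ab\<close> (lemma
  \<open>tetrahedron_angle_rate\<close>).  In the sum over all tetrahedra at \<open>ab\<close> a triangle \<open>abx\<close> lying in two of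
  them contributes twice with opposite signs, because the two tetrahedra are coherently oriented.
  A triangle lying in only one of them is contained in the boundary, by invariance of domain (lemma
  \<open>free_triangle_in_boundary\<close>).  If \<open>ab\<close> is an inner edge, there is none; otherwise all of them belong
  to the boundary component of \<open>ab\<close> and turn about \<open>ab\<close> at the same rate, and their signs add up to zero.
\<close>


section \<open>The Gaussian integral and its minors\<close>

lemma alternating_swap:
  "coefficient g (us @ x # y # vs) = - coefficient g (us @ y # x # vs)"
  using coefficient[of g] alternatingD[of "coefficient g"] by blast

lemma coefficient_move_front:
  "coefficient g (us @ ws @ x # vs) = (- 1) ^ length ws * coefficient g (us @ x # ws @ vs)"
proof (induction ws arbitrary: us)
  case (Cons w ws)
  have "coefficient g (us @ (w # ws) @ x # vs) = coefficient g ((us @ [w]) @ ws @ x # vs)" by simp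
  also have "\<dots> = (- 1) ^ length ws * coefficient g ((us @ [w]) @ x # ws @ vs)"
    by (rule Cons.IH)
  also have "\<dots> = (- 1) ^ length (w # ws) * coefficient g (us @ x # (w # ws) @ vs)"
    using alternating_swap[of g us w x "ws @ vs"] by simp
  finally show ?case .
qed simp

lemma coefficient_repeated:
  assumes "\<not> distinct us"
  shows "coefficient g us = 0"
proof -
  obtain xs ys zs x where us: "us = xs @ [x] @ ys @ [x] @ zs"
    using not_distinct_decomp[OF assms] by blast
  have "coefficient g (xs @ x # x # ys @ zs) = 0"
    using alternating_swap[of g xs x x "ys @ zs"] by simp
  then show ?thesis
    using coefficient_move_front[of g "xs @ [x]" ys x zs] by (simp add: us)
qed

text \<open>
  A coefficient of a product is a signed sum over the splittings of the word into two subwords.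
  This consequence is all that is needed to bound the letters and the degree of a product.
\<close>

lemma gmult_nonzero_split:
  assumes "gmult c d us \<noteq> 0"
  shows "\<exists>vs ws. mset us = mset vs + mset ws \<and> c vs \<noteq> 0 \<and> d ws \<noteq> 0"
  using assms
proof (induction us arbitrary: c d)
  case Nil
  then show ?case by (intro exI[of _ "[]"]) simp
next
  case (Cons x us)
  consider "gmult (\<lambda>vs. c (x # vs)) d us \<noteq> 0"
    | "gmult (\<lambda>vs. (- 1) ^ length vs * c vs) (\<lambda>vs. d (x # vs)) us \<noteq> 0"
    using Cons.prems by fastforce
  then show ?case
  proof cases
    case 1
    from Cons.IH[OF 1] obtain vs ws
      where "mset us = mset vs + mset ws" "c (x # vs) \<noteq> 0" "d ws \<noteq> 0" by blast
    then show ?thesis by (intro exI[of _ "x # vs"] exI[of _ ws]) simp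
  next
    case 2
    from Cons.IH[OF 2] obtain vs ws
      where "mset us = mset vs + mset ws" "c vs \<noteq> 0" "d (x # ws) \<noteq> 0" by auto
    then show ?thesis by (intro exI[of _ vs] exI[of _ "x # ws"]) simp
  qed
qed

text \<open>
  The left derivative, for which the product was defined by a graded Leibniz rule
  (\<open>lderiv_mult\<close>, with the grading involution \<open>parity\<close>).
\<close>

lift_definition lderiv :: "'x \<Rightarrow> 'x grassmann \<Rightarrow> 'x grassmann" is "\<lambda>x c us. c (x # us)"
proof (intro conjI)
  fix x :: 'x and c :: "'x list \<Rightarrow> real"
  assume c: "alternating c \<and> finitely_supported c"
  then show "alternating (\<lambda>us. c (x # us))" by (simp add: alternating_Cons)
  obtain X where X: "finite X" "\<And>us. c us \<noteq> 0 \<Longrightarrow> set us \<subseteq> X"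
    using c unfolding finitely_supported_def by blast
  have "set us \<subseteq> X" if "c (x # us) \<noteq> 0" for us
    using X(2)[OF that] by simp
  then show "finitely_supported (\<lambda>us. c (x # us))"
    unfolding finitely_supported_def using X(1) by blast
qed

lift_definition parity :: "'x grassmann \<Rightarrow> 'x grassmann" is "\<lambda>c us. (- 1) ^ length us * c us"
proof -
  fix c :: "'x list \<Rightarrow> real"
  assume c: "alternating c \<and> finitely_supported c"
  have "finitely_supported (\<lambda>us. (- 1) ^ length us * c us)"
    using c unfolding finitely_supported_def by auto
  then show "alternating (\<lambda>us. (- 1) ^ length us * c us) \<and>
      finitely_supported (\<lambda>us. (- 1) ^ length us * c us)"
    using c alternating_parity by blast
qed

lemma lderiv_mult: "lderiv x (g * h) = lderiv x g * h + parity g * lderiv x h"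
  by transfer simp

lemma lderiv_add: "lderiv x (g + h) = lderiv x g + lderiv x h"
  by transfer simp

lemma lderiv_scaleR: "lderiv x (r *\<^sub>R g) = r *\<^sub>R lderiv x g"
  by transfer simp

lemma lderiv_zero: "lderiv x 0 = 0"
  by transfer simp

lemma lderiv_one: "lderiv x 1 = 0"
  by transfer simp

lemma lderiv_sum: "lderiv x (\<Sum>i\<in>I. g i) = (\<Sum>i\<in>I. lderiv x (g i))"
  by (induction I rule: infinite_finite_induct) (simp_all add: lderiv_zero lderiv_add)

lemma lderiv_gen: "lderiv x (gen y) = (if x = y then 1 else 0)"
  by transfer (auto simp: fun_eq_iff)

lemma parity_mult: "parity (g * h) = parity g * parity h"
  by transfer (simp add: gmult_parity fun_eq_iff)

lemma parity_add: "parity (g + h) = parity g + parity h"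
  by transfer (simp add: distrib_left fun_eq_iff)

lemma parity_scaleR: "parity (r *\<^sub>R g) = r *\<^sub>R parity g"
  by transfer (simp add: fun_eq_iff)

lemma parity_zero: "parity 0 = 0"
  by transfer simp

lemma parity_sum: "parity (\<Sum>i\<in>I. g i) = (\<Sum>i\<in>I. parity (g i))"
  by (induction I rule: infinite_finite_induct) (simp_all add: parity_zero parity_add)

lemma parity_gen: "parity (gen x) = - gen x"
  by transfer (auto simp: fun_eq_iff)

lemma coefficient_zero: "coefficient 0 us = 0"
  by (simp add: zero_grassmann.rep_eq)

lemma coefficient_add: "coefficient (g + h) us = coefficient g us + coefficient h us"
  by (simp add: plus_grassmann.rep_eq)

lemma coefficient_scaleR: "coefficient (r *\<^sub>R g) us = r * coefficient g us"
  by (simp add: scaleR_grassmann.rep_eq)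

lemma coefficient_sum: "coefficient (\<Sum>i\<in>I. g i) us = (\<Sum>i\<in>I. coefficient (g i) us)"
  by (induction I rule: infinite_finite_induct)
    (simp_all add: coefficient_zero coefficient_add)

lemma parity_quadratic_form: "parity (quadratic_form E F) = quadratic_form E F"
  unfolding quadratic_form_def
  by (simp add: parity_sum parity_scaleR parity_mult parity_gen)

text \<open>
  The left derivative of the quadratic form by \<open>a\<^sub>i\<close>.
\<close>

definition odd_row :: "'e set \<Rightarrow> ('e \<Rightarrow> 'e \<Rightarrow> real) \<Rightarrow> 'e \<Rightarrow> 'e grassmann_var grassmann" where
  "odd_row E F i = (\<Sum>j\<in>E. F i j *\<^sub>R gen (Astar j))"

lemma lderiv_quadratic_form:
  assumes "finite E" "i \<in> E"
  shows "lderiv (A i) (quadratic_form E F) = odd_row E F i"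
proof -
  have "lderiv (A i) (quadratic_form E F) =
      (\<Sum>i'\<in>E. \<Sum>j\<in>E. F i' j *\<^sub>R (if i = i' then gen (Astar j) else 0))"
    unfolding quadratic_form_def lderiv_sum
    by (intro sum.cong) (auto simp: lderiv_scaleR lderiv_mult lderiv_gen)
  also have "\<dots> = (\<Sum>i'\<in>E. if i = i' then odd_row E F i' else 0)"
    by (intro sum.cong) (auto simp: odd_row_def)
  finally show ?thesis using assms by simp
qed

text \<open>
  Moving a generator past a product of two generators changes the sign twice.
\<close>

lemma quadratic_form_commutes_gen:
  "gen x * quadratic_form E F = quadratic_form E F * gen x"
proof -
  have "gen x * (gen y * gen z) = gen y * gen z * gen x" for y z
    by (metis gen_anticommute minus_mult_left minus_mult_right minus_minus mult.assoc)
  then show ?thesis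
    unfolding quadratic_form_def by (simp add: sum_distrib_left sum_distrib_right)
qed

lemma odd_row_commutes:
  "odd_row E F i * quadratic_form E F = quadratic_form E F * odd_row E F i"
  unfolding odd_row_def
  by (simp add: sum_distrib_left sum_distrib_right quadratic_form_commutes_gen)

lemma lderiv_power_quadratic_form:
  assumes "finite E" "i \<in> E"
  shows "lderiv (A i) (quadratic_form E F ^ Suc n) =
    real (Suc n) *\<^sub>R (odd_row E F i * quadratic_form E F ^ n)"
proof (induction n)
  case 0
  then show ?case by (simp add: lderiv_quadratic_form assms)
next
  case (Suc n)
  let ?q = "quadratic_form E F" and ?r = "odd_row E F i"
  have "lderiv (A i) (?q ^ Suc (Suc n)) = lderiv (A i) ?q * ?q ^ Suc n + ?q * lderiv (A i) (?q ^ Suc n)"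
    by (simp only: power_Suc[of ?q "Suc n"] lderiv_mult parity_quadratic_form)
  also have "\<dots> = ?r * ?q ^ Suc n + real (Suc n) *\<^sub>R (?q * ?r * ?q ^ n)"
    unfolding Suc.IH by (simp add: lderiv_quadratic_form assms mult.assoc)
  also have "\<dots> = ?r * ?q ^ Suc n + real (Suc n) *\<^sub>R (?r * ?q ^ Suc n)"
    unfolding odd_row_commutes[symmetric] by (simp add: mult.assoc)
  also have "\<dots> = (1 + real (Suc n)) *\<^sub>R (?r * ?q ^ Suc n)"
    by (simp only: scaleR_left_distrib scaleR_one)
  finally show ?case by simp
qed

lemma coefficient_gen_mult:
  "coefficient (gen x * g) us =
    (\<Sum>k<length us. if us ! k = x then (- 1) ^ k * coefficient g (take k us @ drop (Suc k) us) else 0)"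
  by (simp add: times_grassmann.rep_eq gen.rep_eq gmult_gen)

lemma coefficient_quadratic_form_nonzero:
  assumes "coefficient (quadratic_form E F) us \<noteq> 0"
  shows "\<exists>i\<in>E. \<exists>j\<in>E. mset us = {#A i, Astar j#}"
proof -
  obtain i j where ij: "i \<in> E" "j \<in> E" "coefficient (gen (A i) * gen (Astar j)) us \<noteq> 0"
    using assms unfolding quadratic_form_def coefficient_sum coefficient_scaleR
    by (metis (no_types, lifting) mult_zero_right sum.neutral)
  from gmult_nonzero_split[OF ij(3)[unfolded times_grassmann.rep_eq]] obtain vs ws
    where "mset us = mset vs + mset ws" "vs = [A i]" "ws = [Astar j]"
    by (auto simp: gen.rep_eq split: if_splits)
  then have "mset us = {#A i, Astar j#}" by simp
  with ij(1,2) show ?thesis by blast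
qed

lemma coefficient_power_quadratic_form_nonzero:
  assumes "coefficient (quadratic_form E F ^ n) us \<noteq> 0"
  shows "\<exists>is js. set is \<subseteq> E \<and> set js \<subseteq> E \<and> length is = n \<and> length js = n \<and>
    mset us = mset (map A is) + mset (map Astar js)"
  using assms
proof (induction n arbitrary: us)
  case 0
  then show ?case by (auto simp: one_grassmann.rep_eq split: if_splits)
next
  case (Suc n)
  obtain vs ws where split: "mset us = mset vs + mset ws"
    "coefficient (quadratic_form E F) vs \<noteq> 0" "coefficient (quadratic_form E F ^ n) ws \<noteq> 0"
    using gmult_nonzero_split Suc.prems unfolding power_Suc times_grassmann.rep_eq by blast
  obtain i j where ij: "i \<in> E" "j \<in> E" "mset vs = {#A i, Astar j#}"
    using coefficient_quadratic_form_nonzero[OF split(2)] by blast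
  obtain "is" js where "set is \<subseteq> E" "set js \<subseteq> E" "length is = n" "length js = n"
    "mset ws = mset (map A is) + mset (map Astar js)"
    using Suc.IH[OF split(3)] by blast
  with ij split(1) show ?case
    by (intro exI[of _ "i # is"] exI[of _ "j # js"]) simp
qed

text \<open>
  A monomial of the \<open>n\<close>-th power contains \<open>n\<close> unstarred generators, and they must be distinct.
\<close>

lemma quadratic_form_nilpotent:
  assumes "finite E" "card E < n"
  shows "quadratic_form E F ^ n = 0"
proof -
  have "coefficient (quadratic_form E F ^ n) us = 0" for us
  proof (rule ccontr)
    assume nz: "coefficient (quadratic_form E F ^ n) us \<noteq> 0"
    then obtain "is" js where *: "set is \<subseteq> E" "length is = n"
      "mset us = mset (map A is) + mset (map Astar js)"
      using coefficient_power_quadratic_form_nonzero by blast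
    have "distinct us" using nz coefficient_repeated by blast
    then have "distinct (map A is @ map Astar js)"
      using *(3) by (metis mset_append mset_eq_imp_distinct_iff)
    then have "distinct is" by (simp add: distinct_map)
    then have "n \<le> card E"
      using *(1,2) assms(1) by (metis card_mono distinct_card)
    with assms(2) show False by simp
  qed
  then show ?thesis
    by (simp add: coefficient_inject[symmetric] zero_grassmann.rep_eq fun_eq_iff)
qed

text \<open>
  The range of summation in the definition of \<open>gexp\<close> depends on the form.  A fixed range allows the
  series to be differentiated termwise.
\<close>

lemma gexp_quadratic_form:
  assumes "finite E" "card E \<le> N"
  shows "gexp (quadratic_form E F) = (\<Sum>n\<le>N. (1 / fact n) *\<^sub>R quadratic_form E F ^ n)"
proof -
  have "quadratic_form E F ^ n = 0" if "\<not> n \<le> N" for n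
    using quadratic_form_nilpotent[OF assms(1), of n F] assms(2) that by simp
  then show ?thesis
    unfolding gexp_def by (intro sum.mono_neutral_left) auto
qed

text \<open>
  The differential equation of the Gaussian.  It is the recursion from which its coefficients are
  computed.
\<close>

lemma lderiv_gexp:
  assumes "finite E" "i \<in> E"
  shows "lderiv (A i) (gexp (quadratic_form E F)) = odd_row E F i * gexp (quadratic_form E F)"
proof -
  let ?q = "quadratic_form E F" and ?N = "card E"
  \<comment> \<open>Differentiation lowers the degree, so one more (vanishing) power is included.\<close>
  have "lderiv (A i) (gexp ?q) = (\<Sum>n\<le>Suc ?N. (1 / fact n) *\<^sub>R lderiv (A i) (?q ^ n))"
    by (simp add: gexp_quadratic_form[OF assms(1), of "Suc ?N"] lderiv_sum lderiv_scaleR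
        lderiv_add)
  also have "\<dots> = (\<Sum>n\<le>?N. (1 / fact (Suc n)) *\<^sub>R lderiv (A i) (?q ^ Suc n))"
    unfolding sum.atMost_Suc_shift by (simp add: lderiv_one)
  also have "\<dots> = (\<Sum>n\<le>?N. (1 / fact n) *\<^sub>R (odd_row E F i * ?q ^ n))"
  proof (rule sum.cong)
    fix n
    have "1 / fact (Suc n) * real (Suc n) = 1 / fact n"
      by (simp add: field_simps del: of_nat_Suc)
    then show "(1 / fact (Suc n)) *\<^sub>R lderiv (A i) (?q ^ Suc n) =
        (1 / fact n) *\<^sub>R (odd_row E F i * ?q ^ n)"
      by (simp only: lderiv_power_quadratic_form[OF assms] scaleR_scaleR)
  qed simp
  also have "\<dots> = odd_row E F i * gexp ?q"
    by (simp add: gexp_quadratic_form[OF assms(1), of ?N] sum_distrib_left)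
  finally show ?thesis .
qed

lemma coefficient_gexp_nonzero:
  assumes "finite E" "coefficient (gexp (quadratic_form E F)) us \<noteq> 0"
  shows "\<exists>is js. set is \<subseteq> E \<and> set js \<subseteq> E \<and> length is = length js \<and>
    mset us = mset (map A is) + mset (map Astar js)"
proof -
  obtain n where "coefficient (quadratic_form E F ^ n) us \<noteq> 0"
    using assms(2)
    unfolding gexp_quadratic_form[OF assms(1) order_refl] coefficient_sum coefficient_scaleR
    by (metis (no_types, lifting) mult_zero_right sum.neutral)
  then show ?thesis using coefficient_power_quadratic_form_nonzero by metis
qed

lemma pair_word_Nil: "pair_word [] [] = []"
  by (simp add: pair_word_def)

lemma pair_word_Cons: "pair_word (i # is) (j # js) = A i # Astar j # pair_word is js"
  by (simp add: pair_word_def)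

lemma pair_word_append:
  "length is = length js \<Longrightarrow> pair_word (is @ is') (js @ js') = pair_word is js @ pair_word is' js'"
  by (simp add: pair_word_def)

text \<open>
  Cancelling the first unstarred and a later starred generator of \<open>a\<^sub>1 b\<^sub>1\<^sup>* a\<^sub>2 b\<^sub>2\<^sup>* \<cdots>\<close> leaves a word that
  begins with pairs \<open>b\<^sub>1\<^sup>* a\<^sub>2, b\<^sub>2\<^sup>* a\<^sub>3, \<dots>\<close> of this shape.
\<close>

definition stars_first :: "'e list \<Rightarrow> 'e list \<Rightarrow> 'e grassmann_var list" where
  "stars_first js is = concat (map2 (\<lambda>j i. [Astar j, A i]) js is)"

lemma coefficient_stars_first:
  "length is = length js \<Longrightarrow>
    coefficient g (us @ stars_first js is @ vs) =
      (- 1) ^ length is * coefficient g (us @ pair_word is js @ vs)"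
proof (induction "is" js arbitrary: us rule: list_induct2)
  case (Cons i "is" j js)
  have "coefficient g (us @ stars_first (j # js) (i # is) @ vs) =
      coefficient g (us @ Astar j # A i # stars_first js is @ vs)"
    by (simp add: stars_first_def)
  also have "\<dots> = - coefficient g ((us @ [A i, Astar j]) @ stars_first js is @ vs)"
    unfolding alternating_swap[of g us "Astar j"] by simp
  also have "\<dots> = - ((- 1) ^ length is * coefficient g ((us @ [A i, Astar j]) @ pair_word is js @ vs))"
    by (simp only: Cons.IH)
  finally show ?case by (simp add: pair_word_Cons)
qed (simp add: stars_first_def pair_word_def)

lemma pair_word_shift:
  assumes "length is = length js"
  shows "Astar j # pair_word is js = stars_first (butlast (j # js)) is @ [Astar (last (j # js))]"
  using assms
proof (induction "is" js arbitrary: j rule: list_induct2)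
  case (Cons i "is" j' js)
  show ?case using Cons.IH[of j'] by (auto simp: pair_word_Cons stars_first_def)
qed (simp add: stars_first_def pair_word_def)

text \<open>
  A product \<open>a\<^sub>i a\<^sub>j\<^sup>*\<close> commutes with the even monomial of a \<open>pair_word\<close>.
\<close>

lemma coefficient_pair_word_swap:
  assumes "length is = length js"
  shows "coefficient g (us @ pair_word is js @ [A i, Astar j] @ vs) =
    coefficient g (us @ [A i, Astar j] @ pair_word is js @ vs)"
proof -
  let ?w = "pair_word is js"
  have len: "even (length ?w)" using assms
    by (induction "is" js rule: list_induct2) (simp_all add: pair_word_def)
  have "coefficient g (us @ ?w @ A i # Astar j # vs) = coefficient g ((us @ [A i]) @ ?w @ Astar j # vs)"
    using coefficient_move_front[of g us ?w "A i" "Astar j # vs"] len by simp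
  also have "\<dots> = coefficient g ((us @ [A i]) @ Astar j # ?w @ vs)"
    using coefficient_move_front[of g "us @ [A i]" ?w "Astar j" vs] len by simp
  finally show ?thesis by simp
qed

text \<open>
  As a function of the list of pairs, \<open>pair_word\<close> is compatible with permutations
  (\<open>coefficient_word_of_pairs_cong\<close>): the order in which the pairs are integrated does not matter.
\<close>

definition word_of_pairs :: "('e \<times> 'e) list \<Rightarrow> 'e grassmann_var list" where
  "word_of_pairs ps = concat (map (\<lambda>(i, j). [A i, Astar j]) ps)"

lemma pair_word_eq: "pair_word is js = word_of_pairs (zip is js)"
  by (simp add: pair_word_def word_of_pairs_def)

lemma coefficient_word_of_pairs_cong:
  assumes "mset ps = mset qs"
  shows "coefficient g (us @ word_of_pairs ps) = coefficient g (us @ word_of_pairs qs)"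
  using assms
proof (induction ps arbitrary: us qs)
  case Nil
  then show ?case by simp
next
  case (Cons pr ps)
  obtain i j where pr: "pr = (i, j)" by fastforce
  have "pr \<in> set qs" using Cons.prems by (metis list.set_intros(1) mset_eq_setD)
  then obtain qs1 qs2 where qs: "qs = qs1 @ pr # qs2" by (meson split_list)
  have "mset ps = mset (qs1 @ qs2)" using Cons.prems qs by simp
  have "coefficient g (us @ word_of_pairs (pr # ps)) =
      coefficient g ((us @ [A i, Astar j]) @ word_of_pairs ps)"
    by (simp add: word_of_pairs_def pr)
  also have "\<dots> = coefficient g ((us @ [A i, Astar j]) @ word_of_pairs (qs1 @ qs2))"
    by (rule Cons.IH) fact
  also have "\<dots> = coefficient g (us @ word_of_pairs qs)"
    using coefficient_pair_word_swap[of "map fst qs1" "map snd qs1" g us i j "word_of_pairs qs2"]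
    by (simp add: pair_word_eq zip_map_fst_snd) (simp add: word_of_pairs_def qs pr)
  finally show ?case .
qed

lemma minor_Nil: "minor f [] [] = 1"
  by (simp add: minor_def Determinant.det_def permutes_empty)

lemma minor_Laplace:
  assumes "length vs' = Suc (length us)"
  shows "minor f (u # us) vs' =
    (\<Sum>k<length vs'. (- 1) ^ k * (f u (vs' ! k) * minor f us (take k vs' @ drop (Suc k) vs')))"
proof -
  let ?n = "length us"
  let ?M = "Matrix.mat (Suc ?n) (Suc ?n) (\<lambda>(i, j). f ((u # us) ! i) (vs' ! j))"
  have "minor f (u # us) vs' = Determinant.det ?M"
    by (simp add: minor_def assms)
  also have "\<dots> = (\<Sum>k<Suc ?n. ?M $$ (0, k) * Determinant.cofactor ?M 0 k)"
    by (rule laplace_expansion_row[of _ "Suc ?n"]) auto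
  also have "\<dots> = (\<Sum>k<Suc ?n.
      (- 1) ^ k * (f u (vs' ! k) * minor f us (take k vs' @ drop (Suc k) vs')))"
  proof (rule sum.cong)
    fix k assume k: "k \<in> {..<Suc ?n}"
    have "mat_delete ?M 0 k = Matrix.mat ?n (length (take k vs' @ drop (Suc k) vs'))
        (\<lambda>(i, j). f (us ! i) ((take k vs' @ drop (Suc k) vs') ! j))"
      using k assms by (intro eq_matI) (auto simp: mat_delete_def nth_append min_def)
    then show "?M $$ (0, k) * Determinant.cofactor ?M 0 k =
        (- 1) ^ k * (f u (vs' ! k) * minor f us (take k vs' @ drop (Suc k) vs'))"
      using k by (simp add: Determinant.cofactor_def minor_def)
  qed simp
  finally show ?thesis by (simp add: assms)
qed

text \<open>
  The \<open>k\<close>-th starred generator stands at the position \<open>2k\<close>.  The \<open>k\<close> pairs before it have to be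
  reordered, and the resulting sign is that of the \<open>k\<close>-th term of a Laplace expansion.
\<close>

lemma coefficient_remove_star:
  assumes "length is = length js" "k < Suc (length js)"
  shows "coefficient g (take (2 * k) (Astar j # pair_word is js) @
      drop (Suc (2 * k)) (Astar j # pair_word is js)) =
    (- 1) ^ k * coefficient g (pair_word is (take k (j # js) @ drop (Suc k) (j # js)))"
proof -
  have len: "length (pair_word as bs) = 2 * length as" if "length as = length bs" for as bs :: "'a list"
    using that by (induction as bs rule: list_induct2) (simp_all add: pair_word_def)
  have "Astar j # pair_word is js =
      (Astar j # pair_word (take k is) (take k js)) @ pair_word (drop k is) (drop k js)"
    using pair_word_append[of "take k is" "take k js" "drop k is" "drop k js"] assms by simp
  also have "\<dots> = stars_first (butlast (j # take k js)) (take k is) @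
      Astar (last (j # take k js)) # pair_word (drop k is) (drop k js)"
    using pair_word_shift[of "take k is" "take k js" j] assms by simp
  finally have eq: "Astar j # pair_word is js = stars_first (butlast (j # take k js)) (take k is) @
      Astar (last (j # take k js)) # pair_word (drop k is) (drop k js)" .
  have bl: "butlast (j # take k js) = take k (j # js)"
    using assms by (metis butlast_take diff_Suc_1 length_Cons Suc_leI take_Suc_Cons)
  have "length (stars_first as bs) = 2 * length as" if "length as = length bs" for as bs :: "'a list"
    using that by (induction as bs rule: list_induct2) (simp_all add: stars_first_def)
  then have l: "length (stars_first (take k (j # js)) (take k is)) = 2 * k"
    using assms by simp
  have "coefficient g (take (2 * k) (Astar j # pair_word is js) @
      drop (Suc (2 * k)) (Astar j # pair_word is js)) =
      coefficient g ([] @ stars_first (take k (j # js)) (take k is) @ pair_word (drop k is) (drop k js))"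
    unfolding eq bl by (simp add: l)
  also have "\<dots> = (- 1) ^ k *
      coefficient g ([] @ pair_word (take k is) (take k (j # js)) @ pair_word (drop k is) (drop k js))"
    using assms by (subst coefficient_stars_first) simp_all
  also have "\<dots> = (- 1) ^ k *
      coefficient g (pair_word (take k is @ drop k is) (take k (j # js) @ drop k js))"
    using assms by (subst pair_word_append) simp_all
  finally show ?thesis by simp
qed

lemma nth_star_pair_word:
  assumes "length is = length js" "k < length (Astar j # pair_word is js)"
  shows "(Astar j # pair_word is js) ! k =
    (if even k then Astar ((j # js) ! (k div 2)) else A (is ! (k div 2)))"
  using assms
proof (induction "is" js arbitrary: j k rule: list_induct2)
  case Nil
  then show ?case by (simp add: pair_word_def)
next
  case (Cons i "is" j' js)
  show ?case
  proof (cases "k < 2")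
    case True
    then consider "k = 0" | "k = 1" by linarith
    then show ?thesis by cases (simp_all add: pair_word_Cons)
  next
    case False
    then obtain k' where k: "k = Suc (Suc k')" by (metis add_2_eq_Suc le_Suc_ex not_less)
    have k': "k' < length (Astar j' # pair_word is js)"
      using Cons.prems by (simp add: k pair_word_Cons)
    show ?thesis
      using Cons.IH[OF k'] by (simp add: k pair_word_Cons)
  qed
qed

text \<open>
  Starred generators stand at even positions of the word, so extracting one of them produces no sign
  beyond that of \<open>coefficient_remove_star\<close>.
\<close>

lemma coefficient_odd_row_mult:
  assumes "finite E" "set (j # js) \<subseteq> E" "length is = length js"
  shows "coefficient (odd_row E F i * g) (Astar j # pair_word is js) =
    (\<Sum>k<length (j # js). (- 1) ^ k * (F i ((j # js) ! k) *
      coefficient g (pair_word is (take k (j # js) @ drop (Suc k) (j # js)))))"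
proof -
  let ?w = "Astar j # pair_word is js" and ?js = "j # js"
  let ?c = "\<lambda>k. coefficient g (take k ?w @ drop (Suc k) ?w)"
  have len: "length ?w = Suc (2 * length js)"
    using assms(3) by (induction "is" js rule: list_induct2) (simp_all add: pair_word_def)
  have "coefficient (odd_row E F i * g) ?w = (\<Sum>j'\<in>E. F i j' *
      (\<Sum>k<length ?w. if ?w ! k = Astar j' then (- 1) ^ k * ?c k else 0))"
    unfolding odd_row_def sum_distrib_right coefficient_sum mult_scaleR_left coefficient_scaleR
      coefficient_gen_mult ..
  also have "\<dots> = (\<Sum>k<length ?w. \<Sum>j'\<in>E.
      if ?w ! k = Astar j' then F i j' * ((- 1) ^ k * ?c k) else 0)"
    unfolding sum_distrib_left by (subst sum.swap) (intro sum.cong, auto)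
  also have "\<dots> = (\<Sum>k<length ?w. if even k then F i (?js ! (k div 2)) * ?c k else 0)"
  proof (rule sum.cong)
    fix k assume "k \<in> {..<length ?w}"
    then have k: "k < length ?w" by simp
    note nth = nth_star_pair_word[OF assms(3) k]
    show "(\<Sum>j'\<in>E. if ?w ! k = Astar j' then F i j' * ((- 1) ^ k * ?c k) else 0) =
        (if even k then F i (?js ! (k div 2)) * ?c k else 0)"
    proof (cases "even k")
      case True
      have "k div 2 < length ?js" using k len by simp
      then have "?js ! (k div 2) \<in> E" using assms(2) nth_mem by blast
      moreover have "(\<Sum>j'\<in>E. if ?w ! k = Astar j' then F i j' * ((- 1) ^ k * ?c k) else 0) =
          (\<Sum>j'\<in>E. if ?js ! (k div 2) = j' then F i j' * ?c k else 0)"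
        using True by (intro sum.cong) (simp_all only: nth if_True grassmann_var.inject
            neg_one_even_power mult_1_left)
      ultimately show ?thesis using True assms(1) by simp
    next
      case False
      then show ?thesis by (simp only: nth if_False grassmann_var.distinct sum.neutral_const)
    qed
  qed simp
  also have "\<dots> = (\<Sum>k\<in>(\<lambda>k. 2 * k) ` {..<length ?js}. F i (?js ! (k div 2)) * ?c k)"
  proof -
    have "{k \<in> {..<length ?w}. even k} = (\<lambda>k. 2 * k) ` {..<length ?js}"
      unfolding len using assms(3) by (auto simp: image_iff elim!: evenE)
    then show ?thesis
      by (subst sum.inter_filter[symmetric]) simp_all
  qed
  also have "\<dots> = (\<Sum>k<length ?js. F i (?js ! k) * ?c (2 * k))"
    by (subst sum.reindex) (auto simp: inj_on_def)
  also have "\<dots> = (\<Sum>k<length ?js. (- 1) ^ k * (F i (?js ! k) *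
      coefficient g (pair_word is (take k ?js @ drop (Suc k) ?js))))"
  proof (rule sum.cong)
    fix k assume "k \<in> {..<length ?js}"
    then have "k < Suc (length js)" by simp
    from coefficient_remove_star[OF assms(3) this, of g j]
    show "F i (?js ! k) * ?c (2 * k) = (- 1) ^ k * (F i (?js ! k) *
        coefficient g (pair_word is (take k ?js @ drop (Suc k) ?js)))" by simp
  qed simp
  finally show ?thesis .
qed

text \<open>
  By \<open>lderiv_gexp\<close> both sides satisfy the Laplace expansion along the first row.
\<close>

lemma coefficient_gexp_pair_word:
  assumes "finite E" "set is \<subseteq> E" "set js \<subseteq> E" "length is = length js"
  shows "coefficient (gexp (quadratic_form E F)) (pair_word is js) = minor F is js"
  using assms
proof (induction "is" arbitrary: js)
  case Nil
  have "coefficient (gexp (quadratic_form E F)) [] =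
      (\<Sum>n\<le>card E. (1 / fact n) * coefficient (quadratic_form E F ^ n) [])"
    by (simp add: gexp_quadratic_form[OF assms(1) order_refl] coefficient_sum coefficient_scaleR)
  also have "\<dots> = (\<Sum>n\<le>card E. if n = 0 then 1 else 0)"
  proof (rule sum.cong)
    fix n
    have "coefficient (quadratic_form E F ^ n) [] = 0" if "n \<noteq> 0"
      using coefficient_power_quadratic_form_nonzero[of E F n "[]"] that by auto
    then show "(1 / fact n) * coefficient (quadratic_form E F ^ n) [] = (if n = 0 then 1 else 0)"
      by (simp add: one_grassmann.rep_eq)
  qed simp
  finally show ?case using Nil by (simp add: pair_word_Nil minor_Nil)
next
  case (Cons i "is")
  then obtain j js' where js: "js = j # js'" by (cases js) auto
  have len: "length is = length js'" using Cons.prems js by simp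
  let ?g = "gexp (quadratic_form E F)"
  have "coefficient ?g (pair_word (i # is) js) =
      coefficient (lderiv (A i) ?g) (Astar j # pair_word is js')"
    by (simp add: js pair_word_Cons lderiv.rep_eq)
  also have "\<dots> = (\<Sum>k<length js. (- 1) ^ k * (F i (js ! k) *
      coefficient ?g (pair_word is (take k js @ drop (Suc k) js))))"
    unfolding js using Cons.prems js len
    by (subst lderiv_gexp) (auto simp: coefficient_odd_row_mult simp del: sum.lessThan_Suc)
  also have "\<dots> = (\<Sum>k<length js. (- 1) ^ k * (F i (js ! k) *
      minor F is (take k js @ drop (Suc k) js)))"
  proof (rule sum.cong)
    fix k assume k: "k \<in> {..<length js}"
    have "set (take k js @ drop (Suc k) js) \<subseteq> E"
      using Cons.prems set_take_subset[of k js] set_drop_subset[of "Suc k" js] by auto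
    moreover have "length is = length (take k js @ drop (Suc k) js)"
      using k len js by auto
    ultimately show "(- 1) ^ k * (F i (js ! k) *
        coefficient ?g (pair_word is (take k js @ drop (Suc k) js))) =
      (- 1) ^ k * (F i (js ! k) * minor F is (take k js @ drop (Suc k) js))"
      using Cons.IH Cons.prems by simp
  qed simp
  also have "\<dots> = minor F (i # is) js"
    using len js by (subst minor_Laplace) simp_all
  finally show ?case .
qed

lemma minor_transpose:
  assumes "length us = length vs"
  shows "minor f us vs = minor (\<lambda>v u. f u v) vs us"
proof -
  have "minor f us vs = Determinant.det (transpose_mat
      (Matrix.mat (length us) (length vs) (\<lambda>(i, j). f (us ! i) (vs ! j))))"
    unfolding minor_def using assms by (subst det_transpose) auto
  also have "transpose_mat (Matrix.mat (length us) (length vs) (\<lambda>(i, j). f (us ! i) (vs ! j))) =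
      Matrix.mat (length vs) (length us) (\<lambda>(i, j). f (us ! j) (vs ! i))"
    by (intro eq_matI) auto
  finally show ?thesis by (simp add: minor_def)
qed

lemma coefficient_berezin_list:
  "coefficient (berezin_list xs h) us = coefficient h (us @ rev xs)"
  unfolding berezin_list_def
  by (induction xs arbitrary: h us) (simp_all add: berezin.rep_eq)

text \<open>
  The integral strips generators from the right, so the word is extended by the integrated pairs, the
  one integrated first standing last.
\<close>

lemma coefficient_\<Phi>:
  "coefficient (\<Phi> es E F) us =
    coefficient (gexp (quadratic_form E F)) (us @ pair_word (rev es) (rev es))"
proof -
  have "rev (concat (map (\<lambda>e. [Astar e, A e]) es)) = pair_word (rev es) (rev es)"
    by (induction es) (simp_all add: pair_word_def)
  then show ?thesis by (simp add: \<Phi>_def coefficient_berezin_list)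
qed

lemma coefficient_\<Phi>_pair_word:
  assumes "finite E" "set es \<subseteq> E" "set cs \<subseteq> E" "set ds \<subseteq> E" "length cs = length ds"
  shows "coefficient (\<Phi> es E F) (pair_word cs ds) = minor F (es @ cs) (es @ ds)"
proof -
  let ?g = "gexp (quadratic_form E F)"
  have "coefficient (\<Phi> es E F) (pair_word cs ds) =
      coefficient ?g ([] @ word_of_pairs (zip cs ds @ zip (rev es) (rev es)))"
    by (simp add: coefficient_\<Phi> pair_word_eq word_of_pairs_def)
  also have "\<dots> = coefficient ?g ([] @ word_of_pairs (zip es es @ zip cs ds))"
    by (rule coefficient_word_of_pairs_cong) (simp add: zip_rev)
  also have "\<dots> = coefficient ?g (pair_word (es @ cs) (es @ ds))"
    by (simp add: pair_word_eq)
  also have "\<dots> = minor F (es @ cs) (es @ ds)"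
    using assms by (intro coefficient_gexp_pair_word) auto
  finally show ?thesis .
qed

text \<open>
  The integrated generators already occur in the extended word, and no generator occurs twice in a
  monomial.  The extension is balanced, as are all monomials of \<open>exp f\<close>.
\<close>

lemma coefficient_\<Phi>_nonzero:
  assumes "finite E" "coefficient (\<Phi> es E F) us \<noteq> 0"
  shows "set us \<subseteq> A ` (E - set es) \<union> Astar ` (E - set es)"
    and "length (filter (\<lambda>u. u \<in> range A) us) = length (filter (\<lambda>u. u \<in> range Astar) us)"
proof -
  let ?w = "us @ pair_word (rev es) (rev es)"
  have nz: "coefficient (gexp (quadratic_form E F)) ?w \<noteq> 0"
    using assms(2) by (simp add: coefficient_\<Phi>)
  then obtain "is" js where *: "set is \<subseteq> E" "set js \<subseteq> E" "length is = length js"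
    "mset ?w = mset (map A is) + mset (map Astar js)"
    using coefficient_gexp_nonzero[OF assms(1)] by blast
  have set_pw: "set (pair_word xs xs) = A ` set xs \<union> Astar ` set xs" for xs :: "'a list"
    by (induction xs) (auto simp: pair_word_def)
  have "distinct ?w" using nz coefficient_repeated by blast
  then have "set us \<inter> (A ` set es \<union> Astar ` set es) = {}"
    by (simp add: set_pw)
  moreover have "set ?w = A ` set is \<union> Astar ` set js"
    using arg_cong[OF *(4), of set_mset] by simp
  then have "set us \<subseteq> A ` set is \<union> Astar ` set js" unfolding set_append by blast
  then have "set us \<subseteq> A ` E \<union> Astar ` E" using *(1,2) by blast
  ultimately show "set us \<subseteq> A ` (E - set es) \<union> Astar ` (E - set es)" by blast
  have cnt: "length (filter P ?w) = length (filter P (map A is)) + length (filter P (map Astar js))"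
    for P
  proof -
    have "size (filter_mset P (mset ?w)) =
        size (filter_mset P (mset (map A is))) + size (filter_mset P (mset (map Astar js)))"
      unfolding *(4) by simp
    then show ?thesis by (simp only: mset_filter[symmetric] size_mset)
  qed
  have bal: "length (filter (\<lambda>u. u \<in> range A) (pair_word xs xs)) =
      length (filter (\<lambda>u. u \<in> range Astar) (pair_word xs xs))" for xs :: "'a list"
    by (induction xs) (auto simp: pair_word_def)
  have "filter (\<lambda>u. u \<in> range A) (map A is) = map A is"
    "filter (\<lambda>u. u \<in> range A) (map Astar js) = []"
    "filter (\<lambda>u. u \<in> range Astar) (map A is) = []"
    "filter (\<lambda>u. u \<in> range Astar) (map Astar js) = map Astar js"
    by (auto simp: filter_empty_conv filter_id_conv)
  with cnt[of "\<lambda>u. u \<in> range A"] cnt[of "\<lambda>u. u \<in> range Astar"] *(3) bal[of "rev es"]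
  show "length (filter (\<lambda>u. u \<in> range A) us) = length (filter (\<lambda>u. u \<in> range Astar) us)"
    by simp
qed


section \<open>Exactness from nonvanishing minors\<close>

lemma sum_set_nth:
  assumes "distinct vs"
  shows "(\<Sum>v\<in>set vs. h v) = (\<Sum>k<length vs. h (vs ! k))"
  using assms by (intro sum.reindex_bij_betw[symmetric] bij_betw_nth) simp_all

lemma minor_nonzero_length: "minor f us vs \<noteq> 0 \<Longrightarrow> length us = length vs"
  by (auto simp: minor_def Determinant.det_def split: if_splits)

text \<open>
  The entries of the inverse matrix, obtained from the adjugate.
\<close>

lemma minor_nonzero_inverse:
  assumes "minor f us vs \<noteq> 0"
  obtains g where
    "\<And>i j. i < length us \<Longrightarrow> j < length us \<Longrightarrow>
      (\<Sum>k<length vs. f (us ! i) (vs ! k) * g k j) = (if i = j then 1 else 0)"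
    "\<And>i j. i < length vs \<Longrightarrow> j < length vs \<Longrightarrow>
      (\<Sum>k<length us. g i k * f (us ! k) (vs ! j)) = (if i = j then 1 else 0)"
proof -
  let ?n = "length us"
  have n: "length vs = ?n" using minor_nonzero_length[OF assms] by simp
  let ?M = "Matrix.mat ?n ?n (\<lambda>(i, j). f (us ! i) (vs ! j))"
  have M: "?M \<in> carrier_mat ?n ?n" by simp
  have det: "Determinant.det ?M \<noteq> 0" using assms by (simp add: minor_def n)
  let ?d = "Determinant.det ?M"
  define g where "g = (\<lambda>i j. adj_mat ?M $$ (i, j) / ?d)"
  have adj: "adj_mat ?M \<in> carrier_mat ?n ?n" using adj_mat(1)[OF M] .
  show thesis
  proof (rule that[of g])
    fix i j assume "i < length us" "j < length us"
    then have "(\<Sum>k<?n. f (us ! i) (vs ! k) * adj_mat ?M $$ (k, j)) = (?M * adj_mat ?M) $$ (i, j)"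
      using adj by (auto simp: Matrix.scalar_prod_def lessThan_atLeast0 intro!: sum.cong)
    also have "\<dots> = (if i = j then ?d else 0)"
      unfolding adj_mat(2)[OF M] using \<open>i < length us\<close> \<open>j < length us\<close> by simp
    finally show "(\<Sum>k<length vs. f (us ! i) (vs ! k) * g k j) = (if i = j then 1 else 0)"
      using det by (simp add: n g_def sum_divide_distrib[symmetric])
  next
    fix i j assume "i < length vs" "j < length vs"
    then have "(\<Sum>k<?n. adj_mat ?M $$ (i, k) * f (us ! k) (vs ! j)) = (adj_mat ?M * ?M) $$ (i, j)"
      using adj by (auto simp: n Matrix.scalar_prod_def lessThan_atLeast0 intro!: sum.cong)
    also have "\<dots> = (if i = j then ?d else 0)"
      unfolding adj_mat(3)[OF M] using \<open>i < length vs\<close> \<open>j < length vs\<close> n by simp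
    finally have "(\<Sum>k<?n. adj_mat ?M $$ (i, k) * f (us ! k) (vs ! j)) = (if i = j then ?d else 0)" .
    moreover have "(\<Sum>k<?n. g i k * f (us ! k) (vs ! j)) =
        (\<Sum>k<?n. adj_mat ?M $$ (i, k) * f (us ! k) (vs ! j)) / ?d"
      unfolding sum_divide_distrib g_def by simp
    ultimately show "(\<Sum>k<length us. g i k * f (us ! k) (vs ! j)) = (if i = j then 1 else 0)"
      using det by simp
  qed
qed

lemma minor_nonzero_injective:
  assumes "minor f us vs \<noteq> 0" "distinct vs"
    and "\<And>u. u \<in> set us \<Longrightarrow> (\<Sum>v\<in>set vs. f u v * x v) = 0" "v \<in> set vs"
  shows "x v = 0"
proof -
  obtain g where g: "\<And>i j. i < length vs \<Longrightarrow> j < length vs \<Longrightarrow>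
      (\<Sum>k<length us. g i k * f (us ! k) (vs ! j)) = (if i = j then 1 else 0)"
    using minor_nonzero_inverse[OF assms(1)] by metis
  obtain i where i: "i < length vs" "v = vs ! i" using assms(4) by (metis in_set_conv_nth)
  have "x v = (\<Sum>j<length vs. (if i = j then 1 else 0) * x (vs ! j))"
  proof -
    have "(\<Sum>j<length vs. (if i = j then 1 else 0) * x (vs ! j)) =
        (\<Sum>j<length vs. if i = j then x (vs ! j) else 0)"
      by (rule sum.cong) auto
    then show ?thesis using i by simp
  qed
  also have "\<dots> = (\<Sum>j<length vs. (\<Sum>k<length us. g i k * f (us ! k) (vs ! j)) * x (vs ! j))"
    using g i by (intro sum.cong) auto
  also have "\<dots> = (\<Sum>k<length us. g i k * (\<Sum>j<length vs. f (us ! k) (vs ! j) * x (vs ! j)))"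
    unfolding sum_distrib_left sum_distrib_right by (subst sum.swap) (simp add: mult.assoc)
  also have "\<dots> = (\<Sum>k<length us. g i k * (\<Sum>v\<in>set vs. f (us ! k) v * x v))"
    by (simp add: sum_set_nth[OF assms(2)])
  also have "\<dots> = 0"
    using assms(3) by (intro sum.neutral) simp
  finally show ?thesis .
qed

lemma minor_nonzero_solvable:
  assumes "minor f us vs \<noteq> 0" "distinct vs"
  obtains x where "\<And>v. v \<notin> set vs \<Longrightarrow> x v = 0"
    "\<And>u. u \<in> set us \<Longrightarrow> (\<Sum>v\<in>set vs. f u v * x v) = y u"
proof -
  obtain g where g: "\<And>i j. i < length us \<Longrightarrow> j < length us \<Longrightarrow>
      (\<Sum>k<length vs. f (us ! i) (vs ! k) * g k j) = (if i = j then 1 else 0)"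
    using minor_nonzero_inverse[OF assms(1)] by metis
  define z where "z = (\<lambda>k. \<Sum>j<length us. g k j * y (us ! j))"
  \<comment> \<open>\<open>z\<close> solves the system in terms of positions in \<open>vs\<close>.\<close>
  define x where "x = (\<lambda>v. if v \<in> set vs then z (THE k. k < length vs \<and> vs ! k = v) else 0)"
  have x: "x (vs ! k) = z k" if "k < length vs" for k
  proof -
    have "(THE k'. k' < length vs \<and> vs ! k' = vs ! k) = k"
      using that assms(2) by (auto simp: nth_eq_iff_index_eq)
    then show ?thesis using that by (simp add: x_def)
  qed
  show thesis
  proof (rule that[of x])
    fix u assume "u \<in> set us"
    then obtain i where i: "i < length us" "u = us ! i" by (metis in_set_conv_nth)
    have "(\<Sum>v\<in>set vs. f u v * x v) =
        (\<Sum>k<length vs. \<Sum>j<length us. f u (vs ! k) * g k j * y (us ! j))"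
      by (simp add: sum_set_nth[OF assms(2)] x z_def sum_distrib_left mult.assoc)
    also have "\<dots> = (\<Sum>j<length us. (\<Sum>k<length vs. f (us ! i) (vs ! k) * g k j) * y (us ! j))"
      by (subst sum.swap) (simp add: sum_distrib_right i)
    also have "\<dots> = (\<Sum>j<length us. if i = j then y (us ! j) else 0)"
      using g i by (intro sum.cong) auto
    finally show "(\<Sum>v\<in>set vs. f u v * x v) = y u" using i by simp
  qed (simp add: x_def)
qed

lemma lin_map_in_coord_space: "lin_map I J f x \<in> coord_space I"
  by (simp add: lin_map_def coord_space_def)

lemma sum_supported:
  assumes "finite J" "V \<subseteq> J" "\<And>v. v \<notin> V \<Longrightarrow> x v = 0"
  shows "(\<Sum>j\<in>J. f j * x j) = (\<Sum>j\<in>V. f j * (x j :: real))"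
  using assms by (intro sum.mono_neutral_right) auto

text \<open>
  Given a cycle \<open>y\<close>, the first minor provides a chain whose image agrees with \<open>y\<close> on the coordinates
  \<open>us\<close>.  The difference is a cycle supported on the complementary coordinates \<open>ws\<close>, where the second
  map is injective because of the second minor.
\<close>

lemma exact_at_if_minors_nonzero:
  assumes fin: "finite I" "finite J"
    and comp: "\<And>l i. l \<in> L \<Longrightarrow> i \<in> I \<Longrightarrow> (\<Sum>j\<in>J. g l j * f j i) = 0"
    and f: "minor f us vs \<noteq> 0" "distinct vs" "set vs \<subseteq> I" "set us \<subseteq> J"
    and g: "minor g ts ws \<noteq> 0" "distinct ws" "set ws = J - set us" "set ts \<subseteq> L"
  shows "exact_at I J L f g"
proof -
  have zero: "lin_map L J g (lin_map J I f x) = (\<lambda>_. 0)" for x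
  proof
    fix l
    have "(\<Sum>j\<in>J. g l j * (\<Sum>i\<in>I. f j i * x i)) = (\<Sum>i\<in>I. (\<Sum>j\<in>J. g l j * f j i) * x i)"
      unfolding sum_distrib_left sum_distrib_right by (subst sum.swap) (simp add: mult.assoc)
    then show "lin_map L J g (lin_map J I f x) l = 0"
      using comp by (simp add: lin_map_def)
  qed
  have "y \<in> lin_map J I f ` coord_space I"
    if y: "y \<in> coord_space J" "lin_map L J g y = (\<lambda>_. 0)" for y
  proof -
    obtain x where x: "\<And>v. v \<notin> set vs \<Longrightarrow> x v = 0"
      "\<And>u. u \<in> set us \<Longrightarrow> (\<Sum>v\<in>set vs. f u v * x v) = y u"
      using minor_nonzero_solvable[OF f(1,2), of y] by metis
    define r where "r = (\<lambda>j. y j - lin_map J I f x j)"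
    have r0: "r j = 0" if "j \<notin> set ws" for j
    proof (cases "j \<in> J")
      case True
      then have "j \<in> set us" using that g(3) by blast
      then show ?thesis
        using x True sum_supported[OF fin(1) f(3), of x "f j"] by (simp add: r_def lin_map_def)
    next
      case False
      then show ?thesis using y(1) by (simp add: r_def lin_map_def coord_space_def)
    qed
    have "(\<Sum>v\<in>set ws. g l v * r v) = 0" if "l \<in> set ts" for l
    proof -
      have l: "l \<in> L" using that g(4) by blast
      have "(\<Sum>v\<in>set ws. g l v * r v) = (\<Sum>j\<in>J. g l j * r j)"
        using sum_supported[OF fin(2), of "set ws" r "g l"] r0 g(3) by simp
      also have "\<dots> = lin_map L J g y l - lin_map L J g (lin_map J I f x) l"
        using l by (simp add: r_def lin_map_def right_diff_distrib sum_subtractf)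
      finally show ?thesis by (simp add: y(2) zero)
    qed
    then have "r v = 0" for v
      using minor_nonzero_injective[OF g(1,2), of r v] r0 by blast
    then have "y = lin_map J I f x" by (simp add: r_def fun_eq_iff)
    moreover have "x \<in> coord_space I" using x(1) f(3) unfolding coord_space_def by blast
    ultimately show ?thesis by blast
  qed
  then show ?thesis
    unfolding exact_at_def using zero lin_map_in_coord_space by blast
qed

lemma lin_map_inj_if_minor_nonzero:
  assumes "minor f us vs \<noteq> 0" "distinct vs" "set vs = J" "set us \<subseteq> I"
  shows "inj_on (lin_map I J f) (coord_space J)"
proof (rule inj_onI)
  fix x y assume xy: "x \<in> coord_space J" "y \<in> coord_space J" "lin_map I J f x = lin_map I J f y"
  have "(\<Sum>v\<in>set vs. f u v * (x v - y v)) = 0" if "u \<in> set us" for u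
    using fun_cong[OF xy(3), of u] that assms(3,4)
    by (simp add: lin_map_def right_diff_distrib sum_subtractf subset_iff)
  then have "x v - y v = 0" if "v \<in> set vs" for v
    using minor_nonzero_injective[OF assms(1,2), of "\<lambda>v. x v - y v"] that by blast
  then have "x v = y v" for v
    using xy(1,2) assms(3) by (cases "v \<in> set vs") (auto simp: coord_space_def)
  then show "x = y" by blast
qed

lemma lin_map_surj_if_minor_nonzero:
  assumes "minor f us vs \<noteq> 0" "distinct vs" "set vs \<subseteq> J" "set us = I" "finite J"
  shows "lin_map I J f ` coord_space J = coord_space I"
proof -
  have "y \<in> lin_map I J f ` coord_space J" if "y \<in> coord_space I" for y
  proof -
    obtain x where x: "\<And>v. v \<notin> set vs \<Longrightarrow> x v = 0"
      "\<And>u. u \<in> set us \<Longrightarrow> (\<Sum>v\<in>set vs. f u v * x v) = y u"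
      using minor_nonzero_solvable[OF assms(1,2), of y] by metis
    have "lin_map I J f x = y"
      using that x(2) sum_supported[OF assms(5,3), of x] x(1) assms(4)
      by (auto simp: lin_map_def coord_space_def fun_eq_iff)
    moreover have "x \<in> coord_space J" using x(1) assms(3) unfolding coord_space_def by blast
    ultimately show ?thesis by blast
  qed
  then show ?thesis using lin_map_in_coord_space by blast
qed

lemma set_e3_basis: "set e3_basis = UNIV"
proof -
  have "s \<in> set e3_basis" for s
  proof (cases s)
    case (Translation k)
    then show ?thesis using exhaust_3[of k] by (auto simp: e3_basis_def)
  next
    case (Rotation k)
    then show ?thesis using exhaust_3[of k] by (auto simp: e3_basis_def)
  qed
  then show ?thesis by blast
qed

lemma distinct_e3_basis: "distinct e3_basis"
  by (simp add: e3_basis_def)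

instance e3 :: finite
  by standard (metis List.finite_set set_e3_basis)

text \<open>
  At each space the two adjacent minors use complementary sets of coordinates: the six coordinates
  and \<open>xs\<close>, the rigid construction \<open>rs\<close> and the remaining edges.  The maps \<open>f\<^sub>4\<close> and \<open>f\<^sub>5\<close> are transposes, so
  only sums over entries of \<open>f\<^sub>1\<close>, \<open>f\<^sub>2\<close> and the angle matrix are assumed to vanish; the last one is an
  entry of \<open>- f\<^sub>4 f\<^sub>3\<close>.
\<close>

lemma acyclic_if_minors_nonzero:
  assumes fin: "finite (inner_edges K)"
    and abc: "distinct [vA, vB, vC]" "{vA, vB, vC} \<subseteq> inner_vertices K"
    and rs: "distinct rs" "set rs = R" "R \<subseteq> inner_edges K"
    and xs: "distinct xs" "set xs = config_indices K - set (six_coordinates vA vB vC)"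
    and es: "distinct es" "set es = inner_edges K - R"
    and cd: "distinct cs" "distinct ds" "set cs \<inter> inner_edges K = {}" "set ds \<inter> inner_edges K = {}"
    and f2f1: "\<And>e s. e \<in> inner_edges K \<union> set cs \<union> set ds \<Longrightarrow>
      (\<Sum>c\<in>config_indices K. f2 p e c * f1 p c s) = 0"
    and f3f2: "\<And>i c. i \<in> inner_edges K \<union> set ds \<Longrightarrow> c \<in> config_indices K \<Longrightarrow>
      (\<Sum>j\<in>inner_edges K \<union> set cs. angle_matrix K pos p i j * f2 p j c) = 0"
    and f3f2': "\<And>j c. j \<in> inner_edges K \<union> set cs \<Longrightarrow> c \<in> config_indices K \<Longrightarrow>
      (\<Sum>i\<in>inner_edges K \<union> set ds. angle_matrix K pos p i j * f2 p i c) = 0"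
    and minors: "minor_f1 p vA vB vC \<noteq> 0" "minor_f2 p rs xs \<noteq> 0" "minor_f3 K pos p es cs ds \<noteq> 0"
      "minor_f4 p rs xs \<noteq> 0" "minor_f5 p vA vB vC \<noteq> 0"
  shows "acyclic_complex K pos p (set cs) (set ds)"
proof -
  let ?X = "config_indices K" and ?L = "inner_edges K \<union> set cs" and ?\<Omega> = "inner_edges K \<union> set ds"
  let ?six = "six_coordinates vA vB vC"
  have six: "set ?six \<subseteq> ?X" "distinct ?six"
    using abc by (auto simp: six_coordinates_def config_indices_def)
  have "?X = set xs \<union> set ?six" using xs(2) six by blast
  then have X: "finite ?X" by (metis List.finite_set finite_UnI)
  note m = minors[unfolded minor_f1_def minor_f2_def minor_f3_def minor_f4_def minor_f5_def]
  have edge_sets: "distinct (es @ cs)" "distinct (es @ ds)" "set (es @ cs) \<subseteq> ?L" "set (es @ ds) \<subseteq> ?\<Omega>"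
    "set (es @ cs) = ?L - set rs" "set rs = ?\<Omega> - set (es @ ds)" "set rs \<subseteq> ?L" "set rs \<subseteq> ?\<Omega>"
    using es rs cd by auto
  have L: "finite ?L" "finite ?\<Omega>" using fin by simp_all
  show ?thesis
    unfolding acyclic_complex_def Let_def
  proof (intro conjI)
    show "inj_on (lin_map ?X UNIV (f1 p)) (coord_space UNIV)"
      by (rule lin_map_inj_if_minor_nonzero[OF m(1) distinct_e3_basis set_e3_basis six(1)])
    show "exact_at UNIV ?X ?L (f1 p) (f2 p)"
      using xs rs six(1) X f2f1 edge_sets set_e3_basis
      by (intro exact_at_if_minors_nonzero[OF _ _ _ m(1) distinct_e3_basis _ _ m(2)]) auto
    show "exact_at ?X ?L ?\<Omega> (f2 p) (angle_matrix K pos p)"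
      using xs X L f3f2 edge_sets
      by (intro exact_at_if_minors_nonzero[OF _ _ _ m(2) _ _ _ m(3)]) auto
    show "exact_at ?L ?\<Omega> ?X (angle_matrix K pos p) (f4 p)"
    proof (rule exact_at_if_minors_nonzero[OF L _ m(3) _ _ _ m(4)])
      fix c j assume cj: "c \<in> ?X" "j \<in> ?L"
      have "(\<Sum>i\<in>?\<Omega>. f4 p c i * angle_matrix K pos p i j) =
          - (\<Sum>i\<in>?\<Omega>. angle_matrix K pos p i j * f2 p i c)"
        by (simp add: f4_def sum_negf mult.commute)
      then show "(\<Sum>i\<in>?\<Omega>. f4 p c i * angle_matrix K pos p i j) = 0"
        using f3f2'[OF cj(2,1)] by simp
    qed (use xs rs edge_sets in auto)
    show "exact_at ?\<Omega> ?X UNIV (f4 p) (f5 p)"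
    proof (rule exact_at_if_minors_nonzero[OF L(2) X _ m(4) _ _ _ m(5)])
      fix s e assume e: "e \<in> ?\<Omega>"
      have "(\<Sum>c\<in>?X. f5 p s c * f4 p c e) = - (\<Sum>c\<in>?X. f2 p e c * f1 p c s)"
        by (simp add: f4_def f5_def sum_negf mult.commute)
      then show "(\<Sum>c\<in>?X. f5 p s c * f4 p c e) = 0" using f2f1[of e s] e by auto
    qed (use xs rs six edge_sets in auto)
    show "lin_map UNIV ?X (f5 p) ` coord_space ?X = coord_space UNIV"
      by (rule lin_map_surj_if_minor_nonzero[OF m(5) six(2,1) set_e3_basis X])
  qed
qed


section \<open>Dihedral angles as functions of edge lengths\<close>

text \<open>
  Here \<open>q\<close> assigns to edges the squares of their lengths.  By the law of cosines \<open>gram_inner q a b c\<close>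
  is the scalar product of the edge vectors from \<open>a\<close> to \<open>b\<close> and to \<open>c\<close>.
\<close>

definition gram_inner :: "('a set \<Rightarrow> real) \<Rightarrow> 'a \<Rightarrow> 'a \<Rightarrow> 'a \<Rightarrow> real" where
  "gram_inner q a b c = (q {a, b} + q {a, c} - q {b, c}) / 2"

definition dihedral_numerator :: "('a set \<Rightarrow> real) \<Rightarrow> 'a \<Rightarrow> 'a \<Rightarrow> 'a \<Rightarrow> 'a \<Rightarrow> real" where
  "dihedral_numerator q a b c d =
     q {a, b} * gram_inner q a c d - gram_inner q a b c * gram_inner q a b d"

text \<open>
  The Gram determinant of the edges of a triangle at \<open>a\<close>: four times its squared area.
\<close>

definition gram_area :: "('a set \<Rightarrow> real) \<Rightarrow> 'a \<Rightarrow> 'a \<Rightarrow> 'a \<Rightarrow> real" where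
  "gram_area q a b c = q {a, b} * q {a, c} - (gram_inner q a b c)\<^sup>2"

text \<open>
  The Gram determinant of the three edges at \<open>a\<close>: the square of \<open>6V\<close>.
\<close>

definition gram_volume :: "('a set \<Rightarrow> real) \<Rightarrow> 'a \<Rightarrow> 'a \<Rightarrow> 'a \<Rightarrow> 'a \<Rightarrow> real" where
  "gram_volume q a b c d =
     q {a, b} * q {a, c} * q {a, d} +
     2 * gram_inner q a b c * gram_inner q a b d * gram_inner q a c d -
     q {a, b} * (gram_inner q a c d)\<^sup>2 - q {a, c} * (gram_inner q a b d)\<^sup>2 -
     q {a, d} * (gram_inner q a b c)\<^sup>2"

definition area_variation ::
    "('a set \<Rightarrow> real) \<Rightarrow> ('a set \<Rightarrow> real) \<Rightarrow> 'a \<Rightarrow> 'a \<Rightarrow> 'a \<Rightarrow> real" where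
  "area_variation q m a b c =
     m {a, b} * q {a, c} + q {a, b} * m {a, c} - 2 * gram_inner q a b c * gram_inner m a b c"

definition numerator_variation ::
    "('a set \<Rightarrow> real) \<Rightarrow> ('a set \<Rightarrow> real) \<Rightarrow> 'a \<Rightarrow> 'a \<Rightarrow> 'a \<Rightarrow> 'a \<Rightarrow> real" where
  "numerator_variation q m a b c d =
     m {a, b} * gram_inner q a c d + q {a, b} * gram_inner m a c d -
     gram_inner m a b c * gram_inner q a b d - gram_inner q a b c * gram_inner m a b d"

text \<open>
  The derivative of the dihedral angle at \<open>ab\<close> when the squared lengths \<open>q\<close> change at the rates \<open>m\<close>
  (\<open>dihedral_angle_has_derivative\<close>).  It is linear in \<open>m\<close>.
\<close>

definition dihedral_variation ::
    "('a set \<Rightarrow> real) \<Rightarrow> ('a set \<Rightarrow> real) \<Rightarrow> 'a \<Rightarrow> 'a \<Rightarrow> 'a \<Rightarrow> 'a \<Rightarrow> real" where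
  "dihedral_variation q m a b c d =
     (dihedral_numerator q a b c d / 2 *
        (area_variation q m a b c / gram_area q a b c +
         area_variation q m a b d / gram_area q a b d) -
      numerator_variation q m a b c d) / (sqrt (q {a, b}) * sqrt (gram_volume q a b c d))"

definition nondegenerate :: "('a set \<Rightarrow> real) \<Rightarrow> 'a \<Rightarrow> 'a \<Rightarrow> 'a \<Rightarrow> 'a \<Rightarrow> bool" where
  "nondegenerate q a b c d \<longleftrightarrow> q {a, b} > 0 \<and> gram_area q a b c > 0 \<and> gram_area q a b d > 0 \<and>
     gram_volume q a b c d > 0"

text \<open>
  The left-hand side is, up to the two areas, the squared sine of the dihedral angle; this brings the
  volume into the denominator of its derivative.
\<close>

lemma gram_identity:
  "gram_area q a b c * gram_area q a b d - (dihedral_numerator q a b c d)\<^sup>2 =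
     q {a, b} * gram_volume q a b c d"
  unfolding gram_area_def dihedral_numerator_def gram_volume_def
  by (simp add: power2_eq_square algebra_simps)

lemma dihedral_angle_eq:
  "dihedral_angle l a b c d = arccos (dihedral_numerator (\<lambda>e. (l e)\<^sup>2) a b c d /
     (sqrt (gram_area (\<lambda>e. (l e)\<^sup>2) a b c) * sqrt (gram_area (\<lambda>e. (l e)\<^sup>2) a b d)))"
  unfolding dihedral_angle_def dihedral_numerator_def gram_area_def gram_inner_def Let_def ..

lemma has_derivative_arccos_quotient:
  fixes N P T :: "real \<Rightarrow> real"
  assumes "(N has_real_derivative N') (at s)" "(P has_real_derivative P') (at s)"
    "(T has_real_derivative T') (at s)"
    and pos: "P s > 0" "T s > 0" "P s * T s - (N s)\<^sup>2 > 0"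
  shows "((\<lambda>s. arccos (N s / (sqrt (P s) * sqrt (T s)))) has_real_derivative
    (N s / 2 * (P' / P s + T' / T s) - N') / sqrt (P s * T s - (N s)\<^sup>2)) (at s)"
proof -
  define x y where "x = sqrt (P s)" and "y = sqrt (T s)"
  have xy: "x > 0" "y > 0" "P s = x * x" "T s = y * y"
    using pos by (simp_all add: x_def y_def)
  define D where "D = sqrt (P s * T s - (N s)\<^sup>2)"
  have D: "D > 0" using pos by (simp add: D_def)
  have lt: "\<bar>N s / (x * y)\<bar> < 1"
  proof -
    have "(N s)\<^sup>2 < (x * y)\<^sup>2" using pos(3) by (simp add: xy(3,4) power2_eq_square algebra_simps)
    then have "\<bar>N s\<bar> < x * y"
      using xy(1,2) by (intro power2_less_imp_less[of "\<bar>N s\<bar>"]) simp_all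
    then show ?thesis using xy(1,2) by (simp add: abs_divide abs_mult divide_less_eq)
  qed
  have sq: "sqrt (1 - (N s / (x * y))\<^sup>2) = D / (x * y)"
  proof -
    have "1 - (N s / (x * y))\<^sup>2 = (P s * T s - (N s)\<^sup>2) / (x * y)\<^sup>2"
      using xy by (simp add: power2_eq_square field_simps)
    then show ?thesis using xy(1,2) by (simp add: real_sqrt_divide D_def)
  qed
  have dx: "((\<lambda>s. sqrt (P s)) has_real_derivative P' / (2 * x)) (at s)"
    using assms(2) pos(1) unfolding x_def by (auto intro!: derivative_eq_intros simp: field_simps)
  have dy: "((\<lambda>s. sqrt (T s)) has_real_derivative T' / (2 * y)) (at s)"
    using assms(3) pos(2) unfolding y_def by (auto intro!: derivative_eq_intros simp: field_simps)
  define h where "h = (\<lambda>s. N s / (sqrt (P s) * sqrt (T s)))"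
  have hs: "h s = N s / (x * y)" by (simp add: h_def x_def y_def)
  have dh: "(h has_real_derivative
      (N' * (x * y) - N s * (P' / (2 * x) * y + T' / (2 * y) * x)) / ((x * y) * (x * y))) (at s)"
    using DERIV_divide[OF assms(1) DERIV_mult[OF dx dy]] xy(1,2)
    unfolding x_def[symmetric] y_def[symmetric] h_def by simp
  have "-1 < h s" "h s < 1" using lt unfolding hs by linarith+
  from DERIV_chain2[OF DERIV_arccos[OF this] dh]
  have "((\<lambda>s. arccos (N s / (sqrt (P s) * sqrt (T s)))) has_real_derivative
      inverse (- sqrt (1 - (N s / (x * y))\<^sup>2)) *
      ((N' * (x * y) - N s * (P' / (2 * x) * y + T' / (2 * y) * x)) / ((x * y) * (x * y)))) (at s)"
    unfolding hs unfolding h_def .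
  moreover have "inverse (- sqrt (1 - (N s / (x * y))\<^sup>2)) *
      ((N' * (x * y) - N s * (P' / (2 * x) * y + T' / (2 * y) * x)) / ((x * y) * (x * y))) =
      (N s / 2 * (P' / P s + T' / T s) - N') / D"
    unfolding sq xy(3,4) using xy(1,2) D by (simp add: field_simps)
  ultimately show ?thesis unfolding D_def by simp
qed

lemma dihedral_angle_has_derivative:
  assumes deriv: "\<And>e. ((\<lambda>s. (l s e)\<^sup>2) has_real_derivative m e) (at s)"
    and nd: "nondegenerate (\<lambda>e. (l s e)\<^sup>2) a b c d"
  shows "((\<lambda>s. dihedral_angle (l s) a b c d) has_real_derivative
    dihedral_variation (\<lambda>e. (l s e)\<^sup>2) m a b c d) (at s)"
proof -
  define q where "q = (\<lambda>s e. (l s e)\<^sup>2)"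
  have q: "((\<lambda>s. q s e) has_real_derivative m e) (at s)" for e
    using deriv by (simp add: q_def)
  have ip: "((\<lambda>s. gram_inner (q s) a b c) has_real_derivative gram_inner m a b c) (at s)" for a b c
    unfolding gram_inner_def by (rule DERIV_cdivide DERIV_add DERIV_diff q)+
  have N: "((\<lambda>s. dihedral_numerator (q s) a b c d) has_real_derivative
      numerator_variation (q s) m a b c d) (at s)"
    unfolding dihedral_numerator_def numerator_variation_def
    by (rule derivative_eq_intros q ip refl)+ (simp add: algebra_simps)
  have P: "((\<lambda>s. gram_area (q s) a b c) has_real_derivative area_variation (q s) m a b c) (at s)"
    for a b c
    unfolding gram_area_def area_variation_def
    by (rule derivative_eq_intros q ip refl)+ (simp add: algebra_simps)
  have pos: "gram_area (q s) a b c > 0" "gram_area (q s) a b d > 0"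
    "gram_area (q s) a b c * gram_area (q s) a b d - (dihedral_numerator (q s) a b c d)\<^sup>2 > 0"
    using nd unfolding gram_identity nondegenerate_def by (simp_all add: q_def)
  show ?thesis
    using has_derivative_arccos_quotient[OF N P P pos]
    unfolding gram_identity real_sqrt_mult dihedral_variation_def dihedral_angle_eq
    by (simp only: q_def)
qed

lemma gram_inner_sum: "gram_inner (\<lambda>e. \<Sum>j\<in>J. r j * m j e) a b c = (\<Sum>j\<in>J. r j * gram_inner (m j) a b c)"
  unfolding gram_inner_def sum.distrib[symmetric] sum_subtractf[symmetric] sum_divide_distrib
  by (intro sum.cong refl) (simp add: algebra_simps)

lemma dihedral_variation_sum:
  "dihedral_variation q (\<lambda>e. \<Sum>j\<in>J. r j * m j e) a b c d =
    (\<Sum>j\<in>J. r j * dihedral_variation q (m j) a b c d)"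
proof -
  have area: "area_variation q (\<lambda>e. \<Sum>j\<in>J. r j * m j e) a b c =
      (\<Sum>j\<in>J. r j * area_variation q (m j) a b c)" for a b c
    unfolding area_variation_def gram_inner_sum sum_distrib_left sum_distrib_right
      sum.distrib[symmetric] sum_subtractf[symmetric]
    by (intro sum.cong) (simp_all add: algebra_simps)
  have num: "numerator_variation q (\<lambda>e. \<Sum>j\<in>J. r j * m j e) a b c d =
      (\<Sum>j\<in>J. r j * numerator_variation q (m j) a b c d)"
    unfolding numerator_variation_def gram_inner_sum sum_distrib_left sum_distrib_right
      sum.distrib[symmetric] sum_subtractf[symmetric]
    by (intro sum.cong) (simp_all add: algebra_simps)
  show ?thesis
    unfolding dihedral_variation_def area num sum_distrib_left sum_divide_distrib
      sum.distrib[symmetric] sum_subtractf[symmetric]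
    by (intro sum.cong refl)
      (simp add: algebra_simps add_divide_distrib diff_divide_distrib)
qed

lemma dihedral_variation_cong:
  assumes "\<And>e. e \<in> {{a, b}, {a, c}, {a, d}, {b, c}, {b, d}, {c, d}} \<Longrightarrow> m e = m' e"
  shows "dihedral_variation q m a b c d = dihedral_variation q m' a b c d"
  unfolding dihedral_variation_def area_variation_def numerator_variation_def gram_inner_def
  by (simp add: assms)

lemma dihedral_variation_zero: "dihedral_variation q (\<lambda>e. 0) a b c d = 0"
  unfolding dihedral_variation_def area_variation_def numerator_variation_def gram_inner_def
  by simp

lemma gram_volume_permute:
  "gram_volume q a c b d = gram_volume q a b c d"
  "gram_volume q c d a b = gram_volume q a b c d"
proof -
  have sets: "{c, a} = {a, c}" "{c, b} = {b, c}" "{d, a} = {a, d}" "{d, b} = {b, d}" "{b, a} = {a, b}"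
    by auto
  show "gram_volume q a c b d = gram_volume q a b c d"
    "gram_volume q c d a b = gram_volume q a b c d"
    unfolding gram_volume_def gram_inner_def sets by (simp_all add: power2_eq_square field_simps)
qed

lemma gram_area_permute: "gram_area q a c b = gram_area q a b c"
  unfolding gram_area_def gram_inner_def
  by (simp add: insert_commute mult.commute add.commute)

text \<open>
  The rates of change of the squared lengths when the length of \<open>j\<close> alone grows at unit rate.
\<close>

definition length_direction :: "('a set \<Rightarrow> real) \<Rightarrow> 'a set \<Rightarrow> 'a set \<Rightarrow> real" where
  "length_direction l j e = (if e = j then 2 * l j else 0)"

text \<open>
  Both sides are \<open>l {a, b} * l {c, d} / (6|V|)\<close>.
\<close>

lemma dihedral_variation_opposite:
  assumes "distinct [a, b, c, d]" "l {a, b} > 0" "l {c, d} > 0"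
  shows "dihedral_variation (\<lambda>e. (l e)\<^sup>2) (length_direction l {c, d}) a b c d =
    dihedral_variation (\<lambda>e. (l e)\<^sup>2) (length_direction l {a, b}) c d a b"
proof -
  let ?q = "\<lambda>e. (l e)\<^sup>2"
  have sets: "{c, a} = {a, c}" "{c, b} = {b, c}" "{d, a} = {a, d}" "{d, b} = {b, d}"
    by auto
  have neq: "{a, c} \<noteq> {c, d}" "{a, d} \<noteq> {c, d}" "{b, c} \<noteq> {c, d}" "{b, d} \<noteq> {c, d}" "{a, b} \<noteq> {c, d}"
    "{a, c} \<noteq> {a, b}" "{a, d} \<noteq> {a, b}" "{b, c} \<noteq> {a, b}" "{b, d} \<noteq> {a, b}" "{c, d} \<noteq> {a, b}"
    using assms(1) by (auto simp: doubleton_eq_iff)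
  define V where "V = sqrt (gram_volume ?q a b c d)"
  define m1 m2 where "m1 = length_direction l {c, d}" and "m2 = length_direction l {a, b}"
  have m1: "m1 {c, d} = 2 * l {c, d}" "m1 {a, b} = 0" "m1 {a, c} = 0" "m1 {a, d} = 0" "m1 {b, c} = 0"
    "m1 {b, d} = 0"
    by (simp_all add: m1_def length_direction_def neq)
  have m2: "m2 {a, b} = 2 * l {a, b}" "m2 {c, d} = 0" "m2 {a, c} = 0" "m2 {a, d} = 0" "m2 {b, c} = 0"
    "m2 {b, d} = 0"
    by (simp_all add: m2_def length_direction_def neq)
  have i1: "gram_inner m1 a b c = 0" "gram_inner m1 a b d = 0" "gram_inner m1 a c d = - l {c, d}"
    unfolding gram_inner_def m1 by simp_all
  have i2: "gram_inner m2 c d a = 0" "gram_inner m2 c d b = 0" "gram_inner m2 c a b = - l {a, b}"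
    unfolding gram_inner_def m2 sets by simp_all
  have v1: "area_variation ?q m1 a b c = 0" "area_variation ?q m1 a b d = 0"
    "numerator_variation ?q m1 a b c d = - ((l {a, b})\<^sup>2 * l {c, d})"
    unfolding area_variation_def numerator_variation_def i1 m1 by simp_all
  have v2: "area_variation ?q m2 c d a = 0" "area_variation ?q m2 c d b = 0"
    "numerator_variation ?q m2 c d a b = - ((l {c, d})\<^sup>2 * l {a, b})"
    unfolding area_variation_def numerator_variation_def i2 m2 sets by simp_all
  have "dihedral_variation ?q m1 a b c d = l {a, b} * l {c, d} / V"
    using assms(2) unfolding dihedral_variation_def V_def[symmetric] v1
    by (simp add: power2_eq_square)
  moreover have "dihedral_variation ?q m2 c d a b = l {a, b} * l {c, d} / V"
    using assms(3) unfolding dihedral_variation_def gram_volume_permute(2)[where a = a and b = b and c = c and d = d]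
      V_def[symmetric] v2
    by (simp add: power2_eq_square)
  ultimately show ?thesis by (simp add: m1_def m2_def)
qed

lemma dihedral_variation_adjacent:
  assumes "distinct [a, b, c, d]" "l {a, b} > 0" "l {a, c} > 0"
    and area: "gram_area (\<lambda>e. (l e)\<^sup>2) a b c > 0"
  shows "dihedral_variation (\<lambda>e. (l e)\<^sup>2) (length_direction l {a, c}) a b c d =
    dihedral_variation (\<lambda>e. (l e)\<^sup>2) (length_direction l {a, b}) a c b d"
proof -
  let ?q = "\<lambda>e. (l e)\<^sup>2"
  have sets: "{c, b} = {b, c}" by auto
  have neq: "{a, b} \<noteq> {a, c}" "{a, d} \<noteq> {a, c}" "{b, c} \<noteq> {a, c}" "{b, d} \<noteq> {a, c}" "{c, d} \<noteq> {a, c}"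
    "{a, c} \<noteq> {a, b}" "{a, d} \<noteq> {a, b}" "{b, c} \<noteq> {a, b}" "{b, d} \<noteq> {a, b}" "{c, d} \<noteq> {a, b}"
    using assms(1) by (auto simp: doubleton_eq_iff)
  define V where "V = sqrt (gram_volume ?q a b c d)"
  define P where "P = gram_area ?q a b c"
  have P: "P \<noteq> 0" using area by (simp add: P_def)
  define m1 m2 where "m1 = length_direction l {a, c}" and "m2 = length_direction l {a, b}"
  have m1: "m1 {a, c} = 2 * l {a, c}" "m1 {a, b} = 0" "m1 {a, d} = 0" "m1 {b, c} = 0"
    "m1 {b, d} = 0" "m1 {c, d} = 0"
    by (simp_all add: m1_def length_direction_def neq)
  have m2: "m2 {a, b} = 2 * l {a, b}" "m2 {a, c} = 0" "m2 {a, d} = 0" "m2 {b, c} = 0"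
    "m2 {b, d} = 0" "m2 {c, d} = 0"
    by (simp_all add: m2_def length_direction_def neq)
  define uu vv uv uw vw where "uu = (l {a, b})\<^sup>2" and "vv = (l {a, c})\<^sup>2" and "uv = gram_inner ?q a b c"
    and "uw = gram_inner ?q a b d" and "vw = gram_inner ?q a c d"
  note gram = this[symmetric]
  have uv: "gram_inner ?q a c b = uv" by (simp only: uv_def gram_inner_def sets add.commute)
  have i1: "gram_inner m1 a b c = l {a, c}" "gram_inner m1 a c d = l {a, c}" "gram_inner m1 a b d = 0"
    unfolding gram_inner_def m1 by simp_all
  have i2: "gram_inner m2 a c b = l {a, b}" "gram_inner m2 a b d = l {a, b}" "gram_inner m2 a c d = 0"
    unfolding gram_inner_def m2 sets by simp_all
  define X where "X = (uu * vw - uv * uw) * (uu - uv) - (uu - uw) * P"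
  define Y where "Y = (vv * uw - uv * vw) * (vv - uv) - (vv - vw) * P"
  have v1: "area_variation ?q m1 a b c = 2 * (l {a, c} * (uu - uv))" "area_variation ?q m1 a b d = 0"
    "numerator_variation ?q m1 a b c d = l {a, c} * (uu - uw)"
    unfolding area_variation_def numerator_variation_def i1 m1 gram by (simp_all add: algebra_simps)
  have v2: "area_variation ?q m2 a c b = 2 * (l {a, b} * (vv - uv))" "area_variation ?q m2 a c d = 0"
    "numerator_variation ?q m2 a c b d = l {a, b} * (vv - vw)"
    unfolding area_variation_def numerator_variation_def i2 m2 uv gram by (simp_all add: algebra_simps)
  have "dihedral_variation ?q m1 a b c d =
      l {a, c} * ((uu * vw - uv * uw) * (uu - uv) / P - (uu - uw)) / (l {a, b} * V)"
    using assms(2) unfolding dihedral_variation_def V_def[symmetric] P_def[symmetric]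
      dihedral_numerator_def v1 by (simp add: gram right_diff_distrib) (simp add: uu_def)
  also have "\<dots> = l {a, c} * X / (P * (l {a, b} * V))"
    using P by (simp add: X_def diff_divide_distrib right_diff_distrib)
  finally have 1: "dihedral_variation ?q m1 a b c d = l {a, c} * X / (P * (l {a, b} * V))" .
  have "gram_inner ?q a d b = gram_inner ?q a b d" by (simp add: gram_inner_def insert_commute)
  then have "dihedral_variation ?q m2 a c b d =
      l {a, b} * ((vv * uw - uv * vw) * (vv - uv) / P - (vv - vw)) / (l {a, c} * V)"
    using assms(3) unfolding dihedral_variation_def gram_volume_permute(1)[where a = a and b = b and c = c and d = d]
      gram_area_permute[where a = a and b = b and c = c]
      V_def[symmetric] P_def[symmetric] dihedral_numerator_def v2 uv
    by (simp add: gram right_diff_distrib) (simp add: vv_def)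
  also have "\<dots> = l {a, b} * Y / (P * (l {a, c} * V))"
    using P by (simp add: Y_def diff_divide_distrib right_diff_distrib)
  finally have 2: "dihedral_variation ?q m2 a c b d = l {a, b} * Y / (P * (l {a, c} * V))" .
  \<comment> \<open>This polynomial identity is the symmetry, once the common denominator is removed.\<close>
  have "vv * X = uu * Y"
    unfolding X_def Y_def P_def gram_area_def gram by (simp add: power2_eq_square algebra_simps)
  then have "(l {a, c} * l {a, c}) * X = (l {a, b} * l {a, b}) * Y"
    by (simp add: uu_def vv_def power2_eq_square)
  then have eq: "(l {a, c} * l {a, c} * X) / ((l {a, c} * l {a, b}) * (P * V)) =
      (l {a, b} * l {a, b} * Y) / ((l {a, c} * l {a, b}) * (P * V))"
    by (simp only:)
  have "l {a, c} * X / (P * (l {a, b} * V)) =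
      (l {a, c} * l {a, c} * X) / ((l {a, c} * l {a, b}) * (P * V))"
    using assms(3) by (simp add: mult.assoc mult.left_commute)
  also note eq
  also have "(l {a, b} * l {a, b} * Y) / ((l {a, c} * l {a, b}) * (P * V)) =
      l {a, b} * Y / (P * (l {a, c} * V))"
    using assms(2) by (simp add: mult.assoc mult.left_commute)
  finally show ?thesis unfolding 1[symmetric] 2[symmetric] m1_def m2_def .
qed


section \<open>Dihedral angles under motions of the vertices\<close>

lemma cross3_basis_expansion:
  fixes u v x :: "real^3"
  defines "n \<equiv> cross3 u v"
  shows "(n \<bullet> n) *\<^sub>R x = (cross3 x v \<bullet> n) *\<^sub>R u + (cross3 u x \<bullet> n) *\<^sub>R v + (x \<bullet> n) *\<^sub>R n"
  unfolding n_def Finite_Cartesian_Product.vec_eq_iff forall_3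
  by (simp add: cross3_def inner_vec_def sum_3 algebra_simps)

lemma cross3_cross3_left:
  fixes u v x :: "real^3"
  shows "cross3 (cross3 u x) v = (u \<bullet> v) *\<^sub>R x - (v \<bullet> x) *\<^sub>R u"
  unfolding Finite_Cartesian_Product.vec_eq_iff forall_3
  by (simp add: cross3_def inner_vec_def sum_3 algebra_simps)

lemma cross3_Lagrange:
  fixes u v :: "real^3"
  shows "cross3 u v \<bullet> cross3 u v = (u \<bullet> u) * (v \<bullet> v) - (u \<bullet> v)\<^sup>2"
  by (simp add: cross3_def inner_vec_def sum_3 algebra_simps power2_eq_square)

lemma triple_product_square:
  fixes u v w :: "real^3"
  shows "(cross3 u v \<bullet> w)\<^sup>2 = (u \<bullet> u) * (v \<bullet> v) * (w \<bullet> w) + 2 * (u \<bullet> v) * (u \<bullet> w) * (v \<bullet> w) -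
    (u \<bullet> u) * (v \<bullet> w)\<^sup>2 - (v \<bullet> v) * (u \<bullet> w)\<^sup>2 - (w \<bullet> w) * (u \<bullet> v)\<^sup>2"
  by (simp add: cross3_def inner_vec_def sum_3 algebra_simps power2_eq_square)

text \<open>
  The angular velocity about the axis \<open>u\<close> of the half-plane through \<open>v\<close>, when \<open>u\<close> and \<open>v\<close> move at the
  velocities \<open>u'\<close> and \<open>v'\<close>.  The direction of the axis itself turns with the angular velocity
  \<open>(u \<times> u') / |u|\<^sup>2\<close>, and the velocity of \<open>v\<close> under this rotation is subtracted first.
\<close>

definition axis_rotation :: "real^3 \<Rightarrow> real^3 \<Rightarrow> real^3 \<Rightarrow> real^3 \<Rightarrow> real" where
  "axis_rotation u u' v v' = norm u * (cross3 u v \<bullet>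
     (v' - (1 / (u \<bullet> u)) *\<^sub>R cross3 (cross3 u u') v)) / (cross3 u v \<bullet> cross3 u v)"

text \<open>
  A rigid rotation turns all half-planes at the same rate: the component of \<open>r\<close> along the axis.
\<close>

lemma axis_rotation_rigid:
  assumes "cross3 u v \<noteq> 0"
  shows "axis_rotation u (cross3 r u) v (cross3 r v) = norm u * (r \<bullet> u) / (u \<bullet> u)"
proof -
  have u: "u \<bullet> u \<noteq> 0" using assms by auto
  have "cross3 u (cross3 r u) = (u \<bullet> u) *\<^sub>R r - (r \<bullet> u) *\<^sub>R u"
    unfolding Finite_Cartesian_Product.vec_eq_iff forall_3 by (simp add: cross3_def inner_vec_def sum_3 algebra_simps)
  then have "cross3 (cross3 u (cross3 r u)) v = (u \<bullet> u) *\<^sub>R cross3 r v - (r \<bullet> u) *\<^sub>R cross3 u v"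
    by (simp add: cross_mult_left Cross3.left_diff_distrib)
  then have "cross3 r v - (1 / (u \<bullet> u)) *\<^sub>R cross3 (cross3 u (cross3 r u)) v =
      ((r \<bullet> u) / (u \<bullet> u)) *\<^sub>R cross3 u v"
    using u by (simp add: scaleR_diff_right)
  then show ?thesis
    using assms unfolding axis_rotation_def by (simp add: inner_commute)
qed

text \<open>
  The velocity of \<open>v\<close> consists of the rotation of the axis, a shear along the axis, a dilation and a
  rotation about the axis.  Only the last one changes the half-plane through \<open>v\<close>.
\<close>

lemma motion_relative_to_axis:
  fixes u u' v v' :: "real^3"
  assumes n: "cross3 u v \<noteq> 0"
  defines "r \<equiv> (1 / (u \<bullet> u)) *\<^sub>R cross3 u u'"
  obtains \<alpha> \<beta> where
    "v' = cross3 r v + \<alpha> *\<^sub>R u + \<beta> *\<^sub>R v + (axis_rotation u u' v v' / norm u) *\<^sub>R cross3 u v"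
proof -
  \<comment> \<open>the velocity of \<open>v\<close> in a frame that turns with the axis\<close>
  define x where "x = v' - cross3 r v"
  let ?n = "cross3 u v"
  have u: "u \<noteq> 0" using n by auto
  have nn: "?n \<bullet> ?n \<noteq> 0" using n by simp
  have "x = (1 / (?n \<bullet> ?n)) *\<^sub>R ((?n \<bullet> ?n) *\<^sub>R x)" using nn by simp
  also have "\<dots> = ((cross3 x v \<bullet> ?n) / (?n \<bullet> ?n)) *\<^sub>R u + ((cross3 u x \<bullet> ?n) / (?n \<bullet> ?n)) *\<^sub>R v +
      ((x \<bullet> ?n) / (?n \<bullet> ?n)) *\<^sub>R ?n"
    unfolding cross3_basis_expansion[of u v x] by (simp add: scaleR_add_right)
  also have "(x \<bullet> ?n) / (?n \<bullet> ?n) = axis_rotation u u' v v' / norm u"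
    using u by (simp add: axis_rotation_def x_def r_def inner_commute cross_mult_left)
  finally show thesis
    by (intro that[of "(cross3 x v \<bullet> ?n) / (?n \<bullet> ?n)" "(cross3 u x \<bullet> ?n) / (?n \<bullet> ?n)"])
      (simp add: x_def algebra_simps)
qed

text \<open>
  The formula for \<open>dihedral_variation\<close> evaluated on the decomposed motions of \<open>v\<close> and \<open>w\<close>.  The
  dilations \<open>\<kappa>\<close>, \<open>\<beta>\<close>, \<open>\<beta>'\<close> cancel by homogeneity, and the shears \<open>\<alpha>\<close>, \<open>\<alpha>'\<close> drop out of every bracket.
\<close>

lemma dihedral_variation_arith:
  fixes uu uv uw vv vw ww d \<kappa> \<alpha> \<beta> \<gamma> \<alpha>' \<beta>' \<gamma>' :: real
  defines "N \<equiv> uu * vw - uv * uw" and "P \<equiv> uu * vv - uv\<^sup>2" and "T \<equiv> uu * ww - uw\<^sup>2"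
  defines "duu \<equiv> 2 * (\<kappa> * uu)" and "dvv \<equiv> 2 * (\<alpha> * uv + \<beta> * vv)" and "dww \<equiv> 2 * (\<alpha>' * uw + \<beta>' * ww)"
    and "duv \<equiv> \<kappa> * uv + \<alpha> * uu + \<beta> * uv" and "duw \<equiv> \<kappa> * uw + \<alpha>' * uu + \<beta>' * uw"
    and "dvw \<equiv> \<alpha> * uw + \<beta> * vw + \<gamma> * d + \<alpha>' * uv + \<beta>' * vw - \<gamma>' * d"
  assumes "uu > 0" "P \<noteq> 0" "T \<noteq> 0" "d \<noteq> 0"
  shows "(N / 2 * ((duu * vv + uu * dvv - 2 * uv * duv) / P + (duu * ww + uu * dww - 2 * uw * duw) / T) -
      (duu * vw + uu * dvw - duv * uw - uv * duw)) / (sqrt uu * sqrt (d\<^sup>2)) =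
    sgn d * (sqrt uu * \<gamma>' - sqrt uu * \<gamma>)"
proof -
  have P': "duu * vv + uu * dvv - 2 * uv * duv = 2 * (\<kappa> + \<beta>) * P"
    unfolding duu_def dvv_def duv_def P_def by (simp add: algebra_simps power2_eq_square)
  have T': "duu * ww + uu * dww - 2 * uw * duw = 2 * (\<kappa> + \<beta>') * T"
    unfolding duu_def dww_def duw_def T_def by (simp add: algebra_simps power2_eq_square)
  have N': "duu * vw + uu * dvw - duv * uw - uv * duw =
      (2 * \<kappa> + \<beta> + \<beta>') * N + uu * d * (\<gamma> - \<gamma>')"
    unfolding duu_def dvw_def duv_def duw_def N_def by (simp add: algebra_simps)
  have "N / 2 * (2 * (\<kappa> + \<beta>) * P / P + 2 * (\<kappa> + \<beta>') * T / T) -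
      ((2 * \<kappa> + \<beta> + \<beta>') * N + uu * d * (\<gamma> - \<gamma>')) = uu * (d * (\<gamma>' - \<gamma>))"
    if "P \<noteq> 0" "T \<noteq> 0" for N P T :: real
  proof -
    have "2 * (\<kappa> + \<beta>) * P / P = 2 * (\<kappa> + \<beta>)" "2 * (\<kappa> + \<beta>') * T / T = 2 * (\<kappa> + \<beta>')"
      using that by simp_all
    then show ?thesis by (simp only:) (simp add: field_simps)
  qed
  from this[OF assms(11,12)]
  have E1: "N / 2 * (2 * (\<kappa> + \<beta>) * P / P + 2 * (\<kappa> + \<beta>') * T / T) -
      ((2 * \<kappa> + \<beta> + \<beta>') * N + uu * d * (\<gamma> - \<gamma>')) = uu * (d * (\<gamma>' - \<gamma>))" .
  have E2: "uu * (d * (\<gamma>' - \<gamma>)) / (sqrt uu * sqrt (d\<^sup>2)) = (uu / sqrt uu) * (d / \<bar>d\<bar>) * (\<gamma>' - \<gamma>)"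
    by simp
  have E3: "uu / sqrt uu = sqrt uu" using \<open>uu > 0\<close> by (simp add: real_div_sqrt)
  have E4: "d / \<bar>d\<bar> = sgn d" using \<open>d \<noteq> 0\<close> by (simp add: sgn_real_def)
  show ?thesis
    unfolding P' T' N' E1 E2 E3 E4 by (simp add: algebra_simps)
qed

lemma edge_length_square: "(edge_length p {x, y})\<^sup>2 = (p x - p y) \<bullet> (p x - p y)"
  by (simp add: edge_length_pair dist_norm power2_norm_eq_inner)

context
  fixes p \<xi> :: "'a \<Rightarrow> real^3" and a b c d :: 'a and u v w u' v' w' :: "real^3"
  assumes uvw: "u = p b - p a" "v = p c - p a" "w = p d - p a"
    and uvw': "u' = \<xi> b - \<xi> a" "v' = \<xi> c - \<xi> a" "w' = \<xi> d - \<xi> a"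
    and independent: "cross3 u v \<bullet> w \<noteq> 0"
begin

lemma triple_product_swap: "cross3 u w \<bullet> v = - (cross3 u v \<bullet> w)"
  by (simp add: cross3_def inner_vec_def sum_3 algebra_simps)

lemma cross3_nonzero: "cross3 u v \<noteq> 0" "cross3 u w \<noteq> 0" "u \<noteq> 0"
  using independent triple_product_swap by auto

lemma gram_entries:
  defines "q \<equiv> \<lambda>e. (edge_length p e)\<^sup>2"
  shows "q {a, b} = u \<bullet> u" "q {a, c} = v \<bullet> v" "q {a, d} = w \<bullet> w"
    "gram_inner q a b c = u \<bullet> v" "gram_inner q a b d = u \<bullet> w" "gram_inner q a c d = v \<bullet> w"
  unfolding q_def gram_inner_def edge_length_square uvw
  by (simp_all add: inner_diff_left inner_diff_right inner_commute field_simps)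

lemma gram_determinants:
  defines "q \<equiv> \<lambda>e. (edge_length p e)\<^sup>2"
  shows "gram_area q a b c = cross3 u v \<bullet> cross3 u v" "gram_area q a b d = cross3 u w \<bullet> cross3 u w"
    "gram_volume q a b c d = (cross3 u v \<bullet> w)\<^sup>2"
  unfolding q_def gram_area_def gram_volume_def gram_entries cross3_Lagrange triple_product_square
  by simp_all

lemma nondegenerate_lengths: "nondegenerate (\<lambda>e. (edge_length p e)\<^sup>2) a b c d"
  unfolding nondegenerate_def gram_determinants gram_entries
  using cross3_nonzero independent by simp

text \<open>
  When the vertices move, a dihedral angle changes at the difference of the angular velocities of its
  two faces.  The sign accounts for the two ways of ordering the faces around the edge.
\<close>

lemma dihedral_variation_motion:
  assumes m: "\<And>x y. {x, y} \<subseteq> {a, b, c, d} \<Longrightarrow> x \<noteq> y \<Longrightarrow> m {x, y} = 2 * ((p x - p y) \<bullet> (\<xi> x - \<xi> y))"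
    and "distinct [a, b, c, d]"
  shows "dihedral_variation (\<lambda>e. (edge_length p e)\<^sup>2) m a b c d =
    sgn (cross3 u v \<bullet> w) * (axis_rotation u u' w w' - axis_rotation u u' v v')"
proof -
  let ?q = "\<lambda>e. (edge_length p e)\<^sup>2"
  define r where "r = (1 / (u \<bullet> u)) *\<^sub>R cross3 u u'"
  define \<kappa> where "\<kappa> = (u \<bullet> u') / (u \<bullet> u)"
  define \<gamma> \<gamma>' where "\<gamma> = axis_rotation u u' v v' / norm u" and "\<gamma>' = axis_rotation u u' w w' / norm u"
  obtain \<alpha> \<beta> where v': "v' = cross3 r v + \<alpha> *\<^sub>R u + \<beta> *\<^sub>R v + \<gamma> *\<^sub>R cross3 u v"
    using motion_relative_to_axis[OF cross3_nonzero(1), of v' u'] unfolding r_def \<gamma>_def by metis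
  obtain \<alpha>' \<beta>' where w': "w' = cross3 r w + \<alpha>' *\<^sub>R u + \<beta>' *\<^sub>R w + \<gamma>' *\<^sub>R cross3 u w"
    using motion_relative_to_axis[OF cross3_nonzero(2), of w' u'] unfolding r_def \<gamma>'_def by metis
  have u': "u' = cross3 r u + \<kappa> *\<^sub>R u"
    using cross3_nonzero(3) cross3_cross3_left[of u u' u]
    by (simp add: r_def \<kappa>_def cross_mult_left scaleR_diff_right inner_commute)
  have m': "m {a, b} = 2 * (u \<bullet> u')" "m {a, c} = 2 * (v \<bullet> v')" "m {a, d} = 2 * (w \<bullet> w')"
    "gram_inner m a b c = u' \<bullet> v + u \<bullet> v'" "gram_inner m a b d = u' \<bullet> w + u \<bullet> w'"
    "gram_inner m a c d = v' \<bullet> w + v \<bullet> w'"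
    using assms(2) unfolding gram_inner_def uvw uvw'
    by (simp_all add: m inner_diff_left inner_diff_right inner_commute field_simps)
  have skew: "x \<bullet> cross3 r x = 0" "cross3 r x \<bullet> y + x \<bullet> cross3 r y = 0" for x y
    by (simp_all add: cross3_def inner_vec_def sum_3 algebra_simps)
  have skew': "cross3 r x \<bullet> y = - (x \<bullet> cross3 r y)" for x y
    using skew(2)[of x y] by linarith
  define \<delta> where "\<delta> = cross3 u v \<bullet> w"
  have perp: "u \<bullet> cross3 u v = 0" "v \<bullet> cross3 u v = 0" "u \<bullet> cross3 u w = 0" "w \<bullet> cross3 u w = 0"
    "cross3 u v \<bullet> w = \<delta>" "v \<bullet> cross3 u w = - \<delta>"
    using triple_product_swap by (simp_all add: \<delta>_def dot_cross_self inner_commute)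
  have rates: "u \<bullet> u' = \<kappa> * (u \<bullet> u)"
    "v \<bullet> v' = \<alpha> * (u \<bullet> v) + \<beta> * (v \<bullet> v)" "w \<bullet> w' = \<alpha>' * (u \<bullet> w) + \<beta>' * (w \<bullet> w)"
    "u' \<bullet> v + u \<bullet> v' = \<kappa> * (u \<bullet> v) + \<alpha> * (u \<bullet> u) + \<beta> * (u \<bullet> v)"
    "u' \<bullet> w + u \<bullet> w' = \<kappa> * (u \<bullet> w) + \<alpha>' * (u \<bullet> u) + \<beta>' * (u \<bullet> w)"
    "v' \<bullet> w + v \<bullet> w' =
      \<alpha> * (u \<bullet> w) + \<beta> * (v \<bullet> w) + \<gamma> * \<delta> + \<alpha>' * (u \<bullet> v) + \<beta>' * (v \<bullet> w) - \<gamma>' * \<delta>"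
    unfolding u' v' w'
    by (simp_all add: inner_add_left inner_add_right skew(1) skew' perp inner_commute[of v u]
        inner_commute[of w u])
  have pos: "u \<bullet> u > 0" "(u \<bullet> u) * (v \<bullet> v) - (u \<bullet> v)\<^sup>2 \<noteq> 0" "(u \<bullet> u) * (w \<bullet> w) - (u \<bullet> w)\<^sup>2 \<noteq> 0"
    using cross3_nonzero unfolding cross3_Lagrange[symmetric] by simp_all
  have "dihedral_variation ?q m a b c d =
      sgn \<delta> * (sqrt (u \<bullet> u) * \<gamma>' - sqrt (u \<bullet> u) * \<gamma>)"
    unfolding dihedral_variation_def dihedral_numerator_def area_variation_def numerator_variation_def
      gram_area_def gram_determinants(3) gram_entries m' rates \<delta>_def[symmetric]
    by (rule dihedral_variation_arith[OF pos]) (simp add: \<delta>_def independent)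
  then show ?thesis
    using cross3_nonzero(3) unfolding \<gamma>_def \<gamma>'_def \<delta>_def norm_eq_sqrt_inner[symmetric] by simp
qed

end

lemma length_rate_pair:
  assumes "p a \<noteq> p b"
  shows "length_rate p \<xi> {a, b} = ((p a - p b) \<bullet> (\<xi> a - \<xi> b)) / edge_length p {a, b}"
proof -
  define x y where "x = p a - p b" and "y = \<xi> a - \<xi> b"
  have "x \<noteq> 0" using assms by (simp add: x_def)
  then have x: "x \<bullet> x > 0" by simp
  have "edge_length (\<lambda>v. p v + s *\<^sub>R \<xi> v) {a, b} = sqrt (x \<bullet> x + 2 * (x \<bullet> y) * s + (y \<bullet> y) * s\<^sup>2)" for s
  proof -
    have "(p a + s *\<^sub>R \<xi> a) - (p b + s *\<^sub>R \<xi> b) = x + s *\<^sub>R y"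
      by (simp add: x_def y_def algebra_simps)
    then show ?thesis
      by (simp add: edge_length_pair dist_norm norm_eq_sqrt_inner inner_add_left inner_add_right
          inner_commute power2_eq_square algebra_simps)
  qed
  moreover have "((\<lambda>s. sqrt (x \<bullet> x + 2 * (x \<bullet> y) * s + (y \<bullet> y) * s\<^sup>2)) has_real_derivative
      (x \<bullet> y) / sqrt (x \<bullet> x)) (at 0)"
  proof -
    define f where "f = (\<lambda>s. x \<bullet> x + 2 * (x \<bullet> y) * s + (y \<bullet> y) * s\<^sup>2)"
    have f: "(f has_real_derivative 2 * (x \<bullet> y)) (at 0)"
      unfolding f_def by (auto intro!: derivative_eq_intros)
    have "f 0 > 0" using x by (simp add: f_def)
    from DERIV_chain2[OF DERIV_real_sqrt[OF this] f] show ?thesis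
      by (simp add: f_def field_simps)
  qed
  ultimately have "length_rate p \<xi> {a, b} = (x \<bullet> y) / sqrt (x \<bullet> x)"
    unfolding length_rate_def by (simp add: DERIV_imp_deriv)
  then show ?thesis
    by (simp add: x_def y_def edge_length_pair dist_norm norm_eq_sqrt_inner)
qed


section \<open>Triangles on a single tetrahedron\<close>

lemma simplicial_complexD:
  assumes "simplicial_complex K"
  shows "finite K"
    and "C \<in> K \<Longrightarrow> \<exists>n. n simplex C"
    and "C \<in> K \<Longrightarrow> F face_of C \<Longrightarrow> F \<in> K"
    and "C \<in> K \<Longrightarrow> C' \<in> K \<Longrightarrow> (C \<inter> C') face_of C"
    and "C \<in> K \<Longrightarrow> compact C"
    and "C \<in> K \<Longrightarrow> \<exists>c. \<not> affine_dependent c \<and> C = convex hull c"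
proof -
  note K = assms[unfolded simplicial_complex_def]
  show "finite K" using K by (rule conjunct1)
  show simplex: "C \<in> K \<Longrightarrow> \<exists>n. n simplex C"
    using conjunct1[OF conjunct2[OF K]] by blast
  show "C \<in> K \<Longrightarrow> F face_of C \<Longrightarrow> F \<in> K"
    by (rule conjunct1[OF conjunct2[OF conjunct2[OF K]], rule_format, OF conjI])
  show "C \<in> K \<Longrightarrow> C' \<in> K \<Longrightarrow> (C \<inter> C') face_of C"
    by (rule conjunct2[OF conjunct2[OF conjunct2[OF K]], rule_format, OF conjI])
  show "C \<in> K \<Longrightarrow> compact C"
    using simplex simplex_imp_polytope polytope_imp_compact by blast
  show "C \<in> K \<Longrightarrow> \<exists>c. \<not> affine_dependent c \<and> C = convex hull c"
    using simplex unfolding simplex_def by blast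
qed

lemma affine_independent_hull_unique:
  fixes s s' :: "'a::euclidean_space set"
  assumes "\<not> affine_dependent s" "\<not> affine_dependent s'" "convex hull s = convex hull s'"
  shows "s = s'"
  using extreme_point_of_convex_hull_affine_independent[OF assms(1)]
    extreme_point_of_convex_hull_affine_independent[OF assms(2)] unfolding assms(3) by blast

lemma simplices_face:
  assumes "simplicial_complex K" "s \<in> simplices K d" "s' \<subseteq> s" "card s' = Suc d'"
  shows "s' \<in> simplices K d'"
proof -
  have s: "\<not> affine_dependent s" "convex hull s \<in> K"
    using assms(2) by (auto simp: simplices_def)
  then have "\<not> affine_dependent s'" using affine_dependent_subset assms(3) by blast
  moreover have "convex hull s' face_of convex hull s"
    using face_of_convex_hull_affine_independent[OF s(1)] assms(3) by blast
  then have "convex hull s' \<in> K" using simplicial_complexD(3)[OF assms(1)] s(2) by blast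
  ultimately show ?thesis using assms(4) by (simp add: simplices_def)
qed

lemma finite_simplices:
  assumes "simplicial_complex K"
  shows "finite (simplices K d)"
proof (rule finite_imageD)
  show "finite ((hull) convex ` simplices K d)"
    using simplicial_complexD(1)[OF assms]
    by (rule rev_finite_subset) (auto simp: simplices_def)
  show "inj_on ((hull) convex) (simplices K d)"
    by (rule inj_onI, rule affine_independent_hull_unique) (simp_all add: simplices_def)
qed

lemma simplex_vertices:
  assumes "simplicial_complex K" "s \<in> simplices K d"
  shows "s \<subseteq> vertices K"
  using simplices_face[OF assms, of "{v}" 0 for v] by (auto simp: simplices_def vertices_def)

lemma finite_vertices:
  assumes "simplicial_complex K"
  shows "finite (vertices K)"
proof (rule finite_imageD)
  show "finite ((\<lambda>v. {v}) ` vertices K)"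
    using simplicial_complexD(1)[OF assms] by (rule rev_finite_subset) (auto simp: vertices_def)
qed (simp add: inj_on_def)

lemma closed_polyhedron:
  assumes "simplicial_complex K"
  shows "closed (\<Union>K)"
  using simplicial_complexD(1,5)[OF assms] by (intro closed_Union) (auto simp: compact_imp_closed)

lemma closed_boundary:
  assumes "simplicial_complex K"
  shows "closed (boundary K)"
proof -
  let ?P = "\<lambda>U. openin (top_of_set (\<Union>K)) U \<and> (\<exists>W. open (W :: (real^3) set) \<and> U homeomorphic W)"
  have "openin (top_of_set (\<Union>K)) (\<Union>{U. ?P U})"
    by (rule openin_Union) auto
  moreover have "boundary K = \<Union>K - \<Union>{U. ?P U}"
    unfolding boundary_def manifold3_boundary_def by blast
  ultimately have "closedin (top_of_set (\<Union>K)) (boundary K)"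
    using closedin_diff[OF closedin_topspace, of "top_of_set (\<Union>K)"] by simp
  then show ?thesis using closed_polyhedron[OF assms] closedin_closed_trans by blast
qed

text \<open>
  Invariance of domain, applied to the inverse of the chart as a map into the affine hull.
\<close>

lemma open_subset_of_simplex_in_rel_interior:
  fixes V :: "'a::euclidean_space set" and W :: "(real^3) set"
  assumes t: "\<not> affine_dependent t" "card t = 4"
    and V: "V \<subseteq> convex hull t" "V homeomorphic W" "open W"
  shows "V \<subseteq> rel_interior (convex hull t)"
proof -
  obtain f g where fg: "homeomorphism V W f g"
    using V(2) homeomorphic_def by blast
  have "aff_dim t = int (card t) - 1" using aff_dim_affine_independent[OF t(1)] by linarith
  then have dim: "aff_dim (affine hull t) \<le> aff_dim (UNIV :: (real^3) set)"
    using t(2) by simp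
  have "openin (top_of_set (affine hull t)) (g ` W)"
  proof (rule invariance_of_domain_affine_sets[OF _ _ _ dim])
    show "openin (top_of_set UNIV) W" using V(3) by simp
    show "continuous_on W g" using fg by (simp add: homeomorphism_def)
    show "g \<in> W \<rightarrow> affine hull t"
      unfolding image_subset_iff_funcset[symmetric] homeomorphism_image2[OF fg]
      using V(1) convex_hull_subset_affine_hull by (rule order_trans)
    show "inj_on g W" using fg unfolding homeomorphism_def by (metis inj_on_inverseI)
  qed simp_all
  then have "openin (top_of_set (affine hull (convex hull t))) V"
    using fg by (simp add: homeomorphism_def affine_hull_convex_hull)
  then show ?thesis using V(1) by (intro rel_interior_maximal)
qed

text \<open>
  A simplex through a point of the relative interior of a triangle has the triangle as a face; each
  further vertex of it spans a tetrahedron with the triangle, which can only be \<open>t\<close>.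
\<close>

lemma star_of_free_triangle:
  assumes K: "simplicial_complex K" and s: "s \<in> simplices K 2"
    and free: "{t \<in> tetrahedra K. s \<subseteq> t} = {t}"
    and x: "x \<in> rel_interior (convex hull s)" and C: "C \<in> K" "x \<in> C"
  shows "C \<subseteq> convex hull t"
proof -
  have sK: "\<not> affine_dependent s" "convex hull s \<in> K" "card s = 3"
    using s by (auto simp: simplices_def)
  have t: "t \<in> tetrahedra K" "s \<subseteq> t" using free by auto
  obtain c where c: "\<not> affine_dependent c" "C = convex hull c"
    using simplicial_complexD(6)[OF K C(1)] by blast
  have "(convex hull s \<inter> C) face_of convex hull s"
    using simplicial_complexD(4)[OF K sK(2) C(1)] .
  moreover have "x \<in> convex hull s \<inter> C" using x C(2) rel_interior_subset by blast
  ultimately have "convex hull s \<inter> C = convex hull s"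
    using face_of_disjoint_rel_interior[of "convex hull s \<inter> C" "convex hull s"] x by blast
  then have "convex hull s face_of C"
    using simplicial_complexD(4)[OF K C(1) sK(2)] by (simp add: Int_commute)
  then obtain c' where c': "c' \<subseteq> c" "convex hull s = convex hull c'"
    using face_of_convex_hull_affine_independent[OF c(1)] c(2) by blast
  then have "s = c'"
    using affine_independent_hull_unique sK(1) affine_dependent_subset c(1) by blast
  then have sc: "s \<subseteq> c" using c' by simp
  have "insert z s = t" if "z \<in> c - s" for z
  proof -
    have cK: "c \<in> simplices K (card c - 1)"
    proof -
      have "card c \<noteq> 0" using sc sK(3) aff_independent_finite[OF c(1)] by auto
      then show ?thesis using c C(1) by (simp add: simplices_def)
    qed
    have "finite s" by (rule card_ge_0_finite) (simp add: sK(3))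
    then have card: "card (insert z s) = Suc 3" using that sK(3) by simp
    have "insert z s \<subseteq> c" using that sc by blast
    from simplices_face[OF K cK this card]
    have "insert z s \<in> {t \<in> tetrahedra K. s \<subseteq> t}" by (simp add: subset_insertI)
    then show ?thesis unfolding free by simp
  qed
  then have "c \<subseteq> t" using t(2) by blast
  then show ?thesis unfolding c(2) by (rule hull_mono)
qed

text \<open>
  Near an interior point of the triangle the polyhedron is a piece of the single tetrahedron, and a
  Euclidean chart would make it an open subset of the affine hull, although the point lies on a proper
  face.  The boundary is closed, so it contains the whole triangle.
\<close>

lemma free_triangle_in_boundary:
  assumes K: "simplicial_complex K" and s: "s \<in> simplices K 2"
    and free: "{t \<in> tetrahedra K. s \<subseteq> t} = {t}"
  shows "convex hull s \<subseteq> boundary K"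
proof -
  have t: "t \<in> tetrahedra K" "s \<subseteq> t" using free by auto
  have tK: "\<not> affine_dependent t" "card t = 4" "convex hull t \<in> K"
    using t(1) by (auto simp: simplices_def)
  have sK: "\<not> affine_dependent s" "card s = 3" "convex hull s \<in> K"
    using s by (auto simp: simplices_def)
  have "x \<in> boundary K" if x: "x \<in> rel_interior (convex hull s)" for x
  proof (rule ccontr)
    have xs: "x \<in> convex hull s" using x rel_interior_subset by blast
    assume "x \<notin> boundary K"
    then obtain U and W :: "(real^3) set" where U: "openin (top_of_set (\<Union>K)) U" "x \<in> U"
      and W: "open W" "U homeomorphic W"
      using xs sK(3) unfolding boundary_def manifold3_boundary_def by blast
    \<comment> \<open>an open neighbourhood of \<open>x\<close> that meets only simplices through \<open>x\<close>\<close>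
    define Q where "Q = - \<Union>{C \<in> K. x \<notin> C}"
    have "open Q"
      unfolding Q_def using simplicial_complexD(1,5)[OF K]
      by (intro open_Compl closed_Union) (auto simp: compact_imp_closed)
    have QK: "Q \<inter> \<Union>K \<subseteq> convex hull t"
      using star_of_free_triangle[OF K s free x] unfolding Q_def by blast
    define V where "V = U \<inter> Q"
    have V: "V \<subseteq> convex hull t" "x \<in> V"
      using QK openin_imp_subset[OF U(1)] U(2) by (auto simp: V_def Q_def)
    obtain f g where fg: "homeomorphism U W f g" using W(2) homeomorphic_def by blast
    have "openin (top_of_set U) V"
      using \<open>open Q\<close> by (auto simp: V_def openin_open)
    then have "openin (top_of_set W) (f ` V)"
      by (rule homeomorphism_imp_open_map[OF fg])
    then have fV: "open (f ` V)" using W(1) openin_open_trans by blast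
    have "V \<subseteq> U" by (simp add: V_def)
    moreover from this have "f ` V \<subseteq> W" using homeomorphism_image1[OF fg] by blast
    ultimately have "homeomorphism V (f ` V) f g" by (rule homeomorphism_of_subsets[OF fg]) simp
    then have "V homeomorphic f ` V" unfolding homeomorphic_def by blast
    from open_subset_of_simplex_in_rel_interior[OF tK(1,2) V(1) this fV] V(2)
    have xt: "x \<in> rel_interior (convex hull t)" by blast
    have "convex hull s face_of convex hull t"
      using face_of_convex_hull_affine_independent[OF tK(1)] t(2) by blast
    moreover have "convex hull s \<noteq> convex hull t"
      using affine_independent_hull_unique[OF sK(1) tK(1)] sK(2) tK(2) by auto
    ultimately have "convex hull s \<inter> rel_interior (convex hull t) = {}"
      by (rule face_of_disjoint_rel_interior)
    then show False using xt xs by blast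
  qed
  then have "closure (rel_interior (convex hull s)) \<subseteq> boundary K"
    using closed_boundary[OF K] by (intro closure_minimal) auto
  then show ?thesis
    using convex_closure_rel_interior[of "convex hull s"] closure_subset by fastforce
qed


section \<open>Symmetry of the matrix of angle derivatives\<close>

definition orient_sign :: "('a \<Rightarrow> 'a \<Rightarrow> 'a \<Rightarrow> 'a \<Rightarrow> bool) \<Rightarrow> 'a \<Rightarrow> 'a \<Rightarrow> 'a \<Rightarrow> 'a \<Rightarrow> real" where
  "orient_sign pos a b c d = (if pos a b c d then 1 else - 1)"

text \<open>
  Six times the oriented volume of the image of the ordered simplex \<open>abcd\<close>.
\<close>

definition vertex_triple :: "('a \<Rightarrow> real^3) \<Rightarrow> 'a \<Rightarrow> 'a \<Rightarrow> 'a \<Rightarrow> 'a \<Rightarrow> real" where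
  "vertex_triple p a b c d = cross3 (p b - p a) (p c - p a) \<bullet> (p d - p a)"

lemma vertex_triple_swap:
  "vertex_triple p b a c d = - vertex_triple p a b c d"
  "vertex_triple p a c b d = - vertex_triple p a b c d"
  "vertex_triple p a b d c = - vertex_triple p a b c d"
  unfolding vertex_triple_def by (simp_all add: cross3_def inner_vec_def sum_3 algebra_simps)

lemma distinct_if_card_4: "card {a, b, c, d} = 4 \<Longrightarrow> distinct [a, b, c, d]"
  by (rule card_distinct) simp

text \<open>
  Adjacent transpositions generate all permutations.  They are used to bring the right element to the
  front and then to permute the remaining three.
\<close>

lemma symmetric_quadruple_function:
  assumes swap: "\<And>a b c d. {a, b, c, d} = t \<Longrightarrow> f b a c d = f a b c d"
    "\<And>a b c d. {a, b, c, d} = t \<Longrightarrow> f a c b d = f a b c d"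
    "\<And>a b c d. {a, b, c, d} = t \<Longrightarrow> f a b d c = f a b c d"
    and t: "card t = 4" "{a, b, c, d} = t" "{a', b', c', d'} = t"
  shows "f a' b' c' d' = f a b c d"
proof -
  have front: "\<exists>y z w. {x, y, z, w} = t \<and> f x y z w = f a b c d"
    if "x \<in> t" "{a, b, c, d} = t" for x a b c d
  proof -
    have sets: "{b, a, c, d} = t" "{c, a, b, d} = t" "{d, a, b, c} = t" "{a, c, b, d} = t"
      "{a, b, d, c} = t" "{a, d, b, c} = t"
      using that(2) by auto
    have "x = a \<or> x = b \<or> x = c \<or> x = d" using that by auto
    then show ?thesis
    proof (elim disjE)
      assume "x = c"
      then show ?thesis using sets that(2) swap(1)[of a c b d] swap(2)[of a b c d] by metis
    next
      assume "x = d"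
      then show ?thesis
        using sets that(2) swap(1)[of a d b c] swap(2)[of a b d c] swap(3)[of a b c d] by metis
    qed (use sets that(2) swap(1)[of a b c d] in metis)+
  qed
  obtain y z w where 1: "{a', y, z, w} = t" "f a' y z w = f a b c d"
    using front[OF _ t(2), of a'] t(3) by auto
  have dist: "distinct [a', y, z, w]" "distinct [a', b', c', d']"
    using distinct_if_card_4 t(1,3) 1(1) by metis+
  have rest: "{y, z, w} = {b', c', d'}"
  proof -
    have "insert a' {y, z, w} - {a'} = insert a' {b', c', d'} - {a'}" using 1(1) t(3) by simp
    then show ?thesis using dist by auto
  qed
  have sets: "{a', z, y, w} = t" "{a', y, w, z} = t" "{a', z, w, y} = t" "{a', w, y, z} = t"
    "{a', w, z, y} = t"
    using 1(1) by auto
  note swaps = swap(2)[OF 1(1)] swap(3)[OF 1(1)] swap(2)[OF sets(2)] swap(3)[OF sets(1)]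
    swap(2)[OF sets(3)] swap(3)[OF sets(4)]
  have "(b' = y \<and> c' = z \<and> d' = w) \<or> (b' = y \<and> c' = w \<and> d' = z) \<or> (b' = z \<and> c' = y \<and> d' = w) \<or>
    (b' = z \<and> c' = w \<and> d' = y) \<or> (b' = w \<and> c' = y \<and> d' = z) \<or> (b' = w \<and> c' = z \<and> d' = y)"
  proof -
    have "b' \<in> {y, z, w}" "c' \<in> {y, z, w}" "d' \<in> {y, z, w}" unfolding rest by simp_all
    then show ?thesis using dist by (elim insertE emptyE) simp_all
  qed
  then have "f a' b' c' d' = f a' y z w"
    using swaps by (elim disjE conjE) simp_all
  then show ?thesis using 1(2) by simp
qed

context
  fixes K :: "'a::euclidean_space set set"
    and pos :: "'a \<Rightarrow> 'a \<Rightarrow> 'a \<Rightarrow> 'a \<Rightarrow> bool"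
    and p :: "'a \<Rightarrow> real^3"
  assumes K: "simplicial_complex K" and orient: "orientation K pos" and gp: "general_position K p"
begin

lemma orient_sign_swap:
  assumes "{a, b, c, d} \<in> tetrahedra K"
  shows "orient_sign pos b a c d = - orient_sign pos a b c d"
    "orient_sign pos a c b d = - orient_sign pos a b c d"
    "orient_sign pos a b d c = - orient_sign pos a b c d"
proof -
  have "\<forall>a b c d. {a, b, c, d} \<in> tetrahedra K \<longrightarrow>
      pos b a c d = (\<not> pos a b c d) \<and> pos a c b d = (\<not> pos a b c d) \<and>
      pos a b d c = (\<not> pos a b c d)"
    using orient unfolding orientation_def by (rule conjunct1)
  from this[rule_format, OF assms]
  show "orient_sign pos b a c d = - orient_sign pos a b c d"
    "orient_sign pos a c b d = - orient_sign pos a b c d"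
    "orient_sign pos a b d c = - orient_sign pos a b c d"
    unfolding orient_sign_def by auto
qed

lemma orient_sign_opposite:
  assumes "{a, b, c, d} \<in> tetrahedra K" "{a', b, c, d} \<in> tetrahedra K" "a \<noteq> a'"
  shows "orient_sign pos a' b c d = - orient_sign pos a b c d"
proof -
  have "\<forall>a a' b c d. {a, b, c, d} \<in> tetrahedra K \<and> {a', b, c, d} \<in> tetrahedra K \<and> a \<noteq> a' \<longrightarrow>
      pos a' b c d = (\<not> pos a b c d)"
    using orient unfolding orientation_def by (rule conjunct2)
  from this[rule_format, OF conjI[OF assms(1) conjI[OF assms(2,3)]]]
  have "pos a' b c d = (\<not> pos a b c d)" .
  then show ?thesis by (simp add: orient_sign_def)
qed

lemma tetrahedron_distinct:
  assumes "{a, b, c, d} \<in> tetrahedra K"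
  shows "distinct [a, b, c, d]"
  using assms by (intro distinct_if_card_4) (simp add: simplices_def)

text \<open>
  The product of the orientation sign and the determinant does not change under transpositions, so any
  ordering of the vertices computes the oriented volume.
\<close>

lemma sgn_oriented_volume:
  assumes t: "{a, b, c, d} \<in> tetrahedra K"
  shows "sgn (oriented_volume pos p {a, b, c, d}) = orient_sign pos a b c d * sgn (vertex_triple p a b c d)"
proof -
  let ?t = "{a, b, c, d}" and ?f = "\<lambda>a b c d. orient_sign pos a b c d * vertex_triple p a b c d"
  have card: "card ?t = 4" using t by (simp add: simplices_def)
  have f: "?f a' b' c' d' = ?f a b c d" if "{a', b', c', d'} = ?t" for a' b' c' d'
  proof (rule symmetric_quadruple_function[of ?t ?f, OF _ _ _ card refl that])
    fix a' b' c' d' assume "{a', b', c', d'} = ?t"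
    then have "{a', b', c', d'} \<in> tetrahedra K" using t by (simp only:)
    note swaps = orient_sign_swap[OF this] vertex_triple_swap[where p = p and a = a' and b = b' and c = c' and d = d']
    show "?f b' a' c' d' = ?f a' b' c' d'" "?f a' c' b' d' = ?f a' b' c' d'"
      "?f a' b' d' c' = ?f a' b' c' d'"
      using swaps by (simp_all only: minus_mult_minus)
  qed
  have vol: "oriented_volume pos p ?t = ?f a b c d / 6"
    unfolding oriented_volume_def
  proof (rule the_equality)
    show "\<exists>a' b' c' d'. ?t = {a', b', c', d'} \<and> pos a' b' c' d' \<and>
        ?f a b c d / 6 = (cross3 (p b' - p a') (p c' - p a') \<bullet> (p d' - p a')) / 6"
    proof (cases "pos a b c d")
      case True
      then show ?thesis
        by (intro exI[of _ a] exI[of _ b] exI[of _ c] exI[of _ d])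
          (simp add: orient_sign_def vertex_triple_def)
    next
      case False
      have "pos b a c d" using orient_sign_swap(1)[OF t] False
        by (simp add: orient_sign_def split: if_splits)
      then show ?thesis using False vertex_triple_swap(1)[of p a b c d]
        by (intro exI[of _ b] exI[of _ a] exI[of _ c] exI[of _ d])
          (auto simp: orient_sign_def vertex_triple_def)
    qed
  next
    fix V
    assume "\<exists>a' b' c' d'. ?t = {a', b', c', d'} \<and> pos a' b' c' d' \<and>
        V = (cross3 (p b' - p a') (p c' - p a') \<bullet> (p d' - p a')) / 6"
    then obtain a' b' c' d' where "?t = {a', b', c', d'}" "pos a' b' c' d'" "V = vertex_triple p a' b' c' d' / 6"
      unfolding vertex_triple_def by blast
    then show "V = ?f a b c d / 6"
      using f[of a' b' c' d'] by (simp add: orient_sign_def)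
  qed
  have "sgn (orient_sign pos a b c d) = orient_sign pos a b c d"
    by (simp add: orient_sign_def)
  then show ?thesis unfolding vol by (simp add: sgn_mult sgn_divide)
qed

text \<open>
  If the determinant vanished, the cross product of two edge vectors would be orthogonal to all three,
  which span the space because the position is general.
\<close>

lemma vertex_triple_nonzero:
  assumes t: "{a, b, c, d} \<in> tetrahedra K"
  shows "vertex_triple p a b c d \<noteq> 0"
proof
  assume zero: "vertex_triple p a b c d = 0"
  have dist: "distinct [a, b, c, d]" by (rule tetrahedron_distinct[OF t])
  have V: "{a, b, c, d} \<subseteq> vertices K" by (rule simplex_vertices[OF K t])
  have inj: "inj_on p {a, b, c, d}"
    using gp V unfolding general_position_def by (meson inj_on_subset)
  have "card (p ` {a, b, c, d}) = 4" using card_image[OF inj] t by (simp add: simplices_def)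
  then have "\<not> affine_dependent (p ` {a, b, c, d})"
    using gp V unfolding general_position_def by (metis image_mono order_refl)
  moreover have notin: "p a \<notin> {p b, p c, p d}"
    using inj dist by (auto simp: inj_on_def)
  ultimately have "independent ((\<lambda>x. - p a + x) ` {p b, p c, p d})"
    using affine_dependent_iff_dependent[OF notin] by simp
  then have ind: "independent {p b - p a, p c - p a, p d - p a}" by simp
  have "card {p b - p a, p c - p a, p d - p a} = 3"
    using inj dist by (auto simp: inj_on_def card_insert_if)
  then have span: "UNIV \<subseteq> span {p b - p a, p c - p a, p d - p a}"
    using ind by (intro card_ge_dim_independent) simp_all
  let ?n = "cross3 (p b - p a) (p c - p a)"
  have "real_inner_class.orthogonal ?n x" if "x \<in> {p b - p a, p c - p a, p d - p a}" for x
    using that zero unfolding vertex_triple_def real_inner_class.orthogonal_def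
    by (elim insertE) (simp_all add: dot_cross_self inner_commute)
  then have "real_inner_class.orthogonal ?n ?n"
    using span by (intro orthogonal_to_span[of ?n "{p b - p a, p c - p a, p d - p a}"]) auto
  then have "collinear {0, p b - p a, p c - p a}"
    by (simp add: real_inner_class.orthogonal_def cross_eq_0)
  then consider "p b - p a = 0" | "p c - p a = 0" | k where "p c - p a = k *\<^sub>R (p b - p a)"
    unfolding collinear_lemma by blast
  then show False
  proof cases
    case 3
    have "p c - p a \<in> span ({p b - p a, p c - p a, p d - p a} - {p c - p a})"
    proof -
      have "p b - p a \<noteq> p c - p a" using inj dist by (auto simp: inj_on_def)
      then show ?thesis unfolding 3 by (intro span_scale span_base) (use 3 in auto)
    qed
    then show False using ind unfolding dependent_def by blast
  qed (use notin in auto)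
qed

text \<open>
  The dihedral angle depends on the pairs \<open>{a, b}\<close> and \<open>{c, d}\<close> only.
\<close>

lemma signed_dihedral_eq:
  assumes t: "{a, b, c, d} \<in> tetrahedra K"
  shows "signed_dihedral pos p {a, b, c, d} {a, b} l =
    sgn (oriented_volume pos p {a, b, c, d}) * dihedral_angle l a b c d"
proof -
  have dist: "distinct [a, b, c, d]" by (rule tetrahedron_distinct[OF t])
  have "(THE \<phi>. \<exists>a' b' c' d'. {a, b} = {a', b'} \<and> {a, b, c, d} = {a', b', c', d'} \<and>
      \<phi> = dihedral_angle l a' b' c' d') = dihedral_angle l a b c d"
  proof (rule the_equality)
    fix \<phi>
    assume "\<exists>a' b' c' d'. {a, b} = {a', b'} \<and> {a, b, c, d} = {a', b', c', d'} \<and>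
      \<phi> = dihedral_angle l a' b' c' d'"
    then obtain a' b' c' d' where *: "{a, b} = {a', b'}" "{a, b, c, d} = {a', b', c', d'}"
      "\<phi> = dihedral_angle l a' b' c' d'" by blast
    have "distinct [a', b', c', d']"
      using tetrahedron_distinct[of a' b' c' d'] t unfolding *(2) by blast
    moreover have "{a, b, c, d} - {a, b} = {a', b', c', d'} - {a', b'}"
      unfolding * ..
    ultimately have "{c, d} = {c', d'}" using dist by auto
    then have cd: "(c' = c \<and> d' = d) \<or> (c' = d \<and> d' = c)" by (auto simp: doubleton_eq_iff)
    have ab: "(a' = a \<and> b' = b) \<or> (a' = b \<and> b' = a)" using *(1) by (auto simp: doubleton_eq_iff)
    from ab cd show "\<phi> = dihedral_angle l a b c d"
      unfolding *(3) by (elim disjE conjE) (simp_all only: dihedral_angle_swap(1)[of l b a]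
          dihedral_angle_swap(2)[of l _ _ d c])
  qed blast
  then show ?thesis by (simp add: signed_dihedral_def)
qed

lemma nondegenerate_tetrahedron:
  assumes "{a, b, c, d} \<in> tetrahedra K"
  shows "nondegenerate (\<lambda>e. (edge_length p e)\<^sup>2) a b c d"
  using vertex_triple_nonzero[OF assms] unfolding vertex_triple_def by (intro nondegenerate_lengths) simp_all

text \<open>
  The contribution of the tetrahedron \<open>t\<close> to the entry \<open>(i, j)\<close> of the angle matrix, up to sign.  It is
  defined without reference to an ordering of the vertices, so that it can be evaluated in any.
\<close>

definition tetrahedron_rate :: "'a set \<Rightarrow> 'a set \<Rightarrow> 'a set \<Rightarrow> real" where
  "tetrahedron_rate t i j =
     deriv (\<lambda>s. signed_dihedral pos p t i ((edge_length p)(j := s))) (edge_length p j)"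

lemma length_update_has_derivative:
  "((\<lambda>s. ((l(j := s)) e)\<^sup>2) has_real_derivative length_direction l j e) (at (l j))"
  unfolding length_direction_def by (auto intro!: derivative_eq_intros)

lemma signed_dihedral_has_derivative:
  assumes t: "{a, b, c, d} \<in> tetrahedra K"
  shows "((\<lambda>s. signed_dihedral pos p {a, b, c, d} {a, b} ((edge_length p)(j := s))) has_real_derivative
    sgn (oriented_volume pos p {a, b, c, d}) *
    dihedral_variation (\<lambda>e. (edge_length p e)\<^sup>2) (length_direction (edge_length p) j) a b c d)
    (at (edge_length p j))"
proof -
  let ?l = "edge_length p"
  have "((\<lambda>s. dihedral_angle (?l(j := s)) a b c d) has_real_derivative
      dihedral_variation (\<lambda>e. ((?l(j := ?l j)) e)\<^sup>2) (length_direction ?l j) a b c d) (at (?l j))"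
    by (rule dihedral_angle_has_derivative[OF length_update_has_derivative])
      (use nondegenerate_tetrahedron[OF t] in \<open>simp only: fun_upd_triv\<close>)
  then show ?thesis
    unfolding signed_dihedral_eq[OF t] fun_upd_triv by (rule DERIV_cmult)
qed

lemma tetrahedron_rate_eq:
  assumes "{a, b, c, d} \<in> tetrahedra K"
  shows "tetrahedron_rate {a, b, c, d} {a, b} j = sgn (oriented_volume pos p {a, b, c, d}) *
    dihedral_variation (\<lambda>e. (edge_length p e)\<^sup>2) (length_direction (edge_length p) j) a b c d"
  unfolding tetrahedron_rate_def using signed_dihedral_has_derivative[OF assms] by (rule DERIV_imp_deriv)

lemma edge_in_tetrahedron:
  assumes "i \<in> edges K" "t \<in> tetrahedra K" "i \<subseteq> t"
  obtains a b c d where "i = {a, b}" "t = {a, b, c, d}" "{a, b, c, d} \<in> tetrahedra K"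
    "distinct [a, b, c, d]"
proof -
  have "card i = 2" using assms(1) by (simp add: simplices_def)
  then obtain a b where ab: "i = {a, b}" "a \<noteq> b" by (auto simp: card_2_iff)
  have "card t = 4" using assms(2) by (simp add: simplices_def)
  then have "card (t - i) = 2"
    using assms(3) ab by (subst card_Diff_subset) auto
  then obtain c d where cd: "t - i = {c, d}" "c \<noteq> d" by (auto simp: card_2_iff)
  have "t = {a, b, c, d}" using cd(1) ab(1) assms(3) by blast
  then show thesis using that[OF ab(1)] assms(2) tetrahedron_distinct by metis
qed

lemma angle_matrix_eq:
  assumes "i \<in> edges K"
  shows "angle_matrix K pos p i j = - (\<Sum>t | t \<in> tetrahedra K \<and> i \<subseteq> t. tetrahedron_rate t i j)"
proof -
  have "((\<lambda>s. signed_dihedral pos p t i ((edge_length p)(j := s))) has_real_derivative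
      tetrahedron_rate t i j) (at (edge_length p j))" if t: "t \<in> tetrahedra K" "i \<subseteq> t" for t
  proof -
    obtain a b c d where *: "i = {a, b}" "t = {a, b, c, d}" "{a, b, c, d} \<in> tetrahedra K"
      using edge_in_tetrahedron[OF assms t] by metis
    show ?thesis
      unfolding *(1,2) tetrahedron_rate_eq[OF *(3)] by (rule signed_dihedral_has_derivative[OF *(3)])
  qed
  then have "((\<lambda>s. angle_at K pos p i ((edge_length p)(j := s))) has_real_derivative
      0 - (\<Sum>t | t \<in> tetrahedra K \<and> i \<subseteq> t. tetrahedron_rate t i j)) (at (edge_length p j))"
    unfolding angle_at_def by (intro DERIV_diff DERIV_sum DERIV_const) simp
  then show ?thesis
    unfolding angle_matrix_def by (simp add: DERIV_imp_deriv)
qed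

lemma tetrahedron_rate_outside:
  assumes "i \<in> edges K" "t \<in> tetrahedra K" "i \<subseteq> t" "\<not> j \<subseteq> t"
  shows "tetrahedron_rate t i j = 0"
proof -
  obtain a b c d where *: "i = {a, b}" "t = {a, b, c, d}" "{a, b, c, d} \<in> tetrahedra K"
    using edge_in_tetrahedron[OF assms(1-3)] by metis
  have "dihedral_variation (\<lambda>e. (edge_length p e)\<^sup>2) (length_direction (edge_length p) j) a b c d =
      dihedral_variation (\<lambda>e. (edge_length p e)\<^sup>2) (\<lambda>e. 0) a b c d"
    using assms(4) unfolding *(2)
    by (intro dihedral_variation_cong) (auto simp: length_direction_def)
  then show ?thesis
    unfolding *(1,2) tetrahedron_rate_eq[OF *(3)] by (simp add: dihedral_variation_zero)
qed

lemma edge_length_positive: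
  assumes "{a, b, c, d} \<in> tetrahedra K"
  shows "edge_length p {a, b} > 0"
proof -
  have "(edge_length p {a, b})\<^sup>2 > 0"
    using nondegenerate_tetrahedron[OF assms] by (simp add: nondegenerate_def)
  then show ?thesis by (simp add: edge_length_pair)
qed

text \<open>
  Two distinct edges of a tetrahedron are opposite or have a common vertex.
\<close>

lemma tetrahedron_rate_symmetric:
  assumes "i \<in> edges K" "j \<in> edges K" "t \<in> tetrahedra K" "i \<subseteq> t" "j \<subseteq> t"
  shows "tetrahedron_rate t i j = tetrahedron_rate t j i"
proof (cases "i = j")
  case False
  let ?l = "edge_length p"
  obtain a b c d where *: "i = {a, b}" "t = {a, b, c, d}" "{a, b, c, d} \<in> tetrahedra K"
    "distinct [a, b, c, d]"
    using edge_in_tetrahedron[OF assms(1,3,4)] by metis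
  have perm: "{c, d, a, b} = {a, b, c, d}" by auto
  have opposite: "tetrahedron_rate {a, b, c, d} {a, b} {c, d} =
      tetrahedron_rate {a, b, c, d} {c, d} {a, b}"
    using dihedral_variation_opposite[OF *(4), of ?l] *(3) edge_length_positive[of a b c d]
      edge_length_positive[of c d a b] tetrahedron_rate_eq[of a b c d "{c, d}"]
      tetrahedron_rate_eq[of c d a b "{a, b}"]
    unfolding perm by simp
  have adjacent: "tetrahedron_rate {x, y, z, w} {x, y} {x, z} =
      tetrahedron_rate {x, y, z, w} {x, z} {x, y}"
    if "{x, y, z, w} \<in> tetrahedra K" for x y z w
  proof -
    have perm: "{x, z, y, w} = {x, y, z, w}" by auto
    show ?thesis
      using dihedral_variation_adjacent[OF tetrahedron_distinct[OF that], of ?l] that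
        edge_length_positive[of x y z w] edge_length_positive[of x z y w]
        tetrahedron_rate_eq[of x y z w "{x, z}"] tetrahedron_rate_eq[of x z y w "{x, y}"]
        nondegenerate_tetrahedron[OF that]
      unfolding perm nondegenerate_def by simp
  qed
  have "card j = 2" using assms(2) by (simp add: simplices_def)
  then obtain x y where j: "j = {x, y}" "x \<noteq> y" by (auto simp: card_2_iff)
  have sets: "{b, a, c, d} = {a, b, c, d}" "{a, b, d, c} = {a, b, c, d}" "{b, a, d, c} = {a, b, c, d}"
    "{b, a} = {a, b}"
    by auto
  have "j \<in> {{a, c}, {a, d}, {b, c}, {b, d}, {c, d}}"
    using assms(5) False j unfolding *(1,2) by auto
  then show ?thesis
    unfolding *(1,2)
    using opposite adjacent[of a b c d] adjacent[of a b d c] adjacent[of b a c d] adjacent[of b a d c]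
      *(3) unfolding sets by (elim insertE emptyE) simp_all
qed simp

lemma angle_matrix_symmetric:
  assumes "i \<in> edges K" "j \<in> edges K"
  shows "angle_matrix K pos p i j = angle_matrix K pos p j i"
proof -
  have restrict: "(\<Sum>t | t \<in> tetrahedra K \<and> i \<subseteq> t. tetrahedron_rate t i j) =
      (\<Sum>t | t \<in> tetrahedra K \<and> i \<subseteq> t \<and> j \<subseteq> t. tetrahedron_rate t i j)"
    if "i \<in> edges K" for i j
    using finite_simplices[OF K] tetrahedron_rate_outside[OF that]
    by (intro sum.mono_neutral_right) auto
  have "(\<Sum>t | t \<in> tetrahedra K \<and> i \<subseteq> t \<and> j \<subseteq> t. tetrahedron_rate t i j) =
      (\<Sum>t | t \<in> tetrahedra K \<and> j \<subseteq> t \<and> i \<subseteq> t. tetrahedron_rate t j i)"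
    using tetrahedron_rate_symmetric[OF assms] by (intro sum.cong) auto
  then show ?thesis
    unfolding angle_matrix_eq[OF assms(1)] angle_matrix_eq[OF assms(2)]
      restrict[OF assms(1)] restrict[OF assms(2)] by (rule arg_cong)
qed


section \<open>Vanishing compositions in the complex\<close>

lemma edge_position_distinct:
  assumes "{a, b} \<in> edges K"
  shows "p a \<noteq> p b"
proof -
  have "a \<noteq> b" using assms by (auto simp: simplices_def)
  moreover have "{a, b} \<subseteq> vertices K" by (rule simplex_vertices[OF K assms])
  ultimately show ?thesis using gp unfolding general_position_def inj_on_def by auto
qed

lemma length_rate_eq:
  assumes "{a, b} \<in> edges K"
  shows "2 * edge_length p {a, b} * length_rate p \<xi> {a, b} = 2 * ((p a - p b) \<bullet> (\<xi> a - \<xi> b))"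
  using edge_position_distinct[OF assms] by (simp add: length_rate_pair edge_length_pair)

definition axis_rate :: "('a \<Rightarrow> real^3) \<Rightarrow> 'a \<Rightarrow> 'a \<Rightarrow> 'a \<Rightarrow> real" where
  "axis_rate \<xi> a b x = axis_rotation (p b - p a) (\<xi> b - \<xi> a) (p x - p a) (\<xi> x - \<xi> a)"

text \<open>
  The signs of the oriented volume and of \<open>dihedral_variation_motion\<close> combine to the sign of the
  ordering \<open>abcd\<close>, which no longer depends on the positions of the vertices.
\<close>

lemma tetrahedron_angle_rate:
  assumes t: "{a, b, c, d} \<in> tetrahedra K"
  shows "(\<Sum>j\<in>edges K. tetrahedron_rate {a, b, c, d} {a, b} j * length_rate p \<xi> j) =
    orient_sign pos a b c d * (axis_rate \<xi> a b d - axis_rate \<xi> a b c)"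
proof -
  let ?q = "\<lambda>e. (edge_length p e)\<^sup>2" and ?l = "edge_length p"
  let ?sg = "sgn (oriented_volume pos p {a, b, c, d})"
  define m where "m = (\<lambda>e. \<Sum>j\<in>edges K. length_rate p \<xi> j * length_direction ?l j e)"
  have dist: "distinct [a, b, c, d]" by (rule tetrahedron_distinct[OF t])
  have m: "m {x, y} = 2 * ((p x - p y) \<bullet> (\<xi> x - \<xi> y))" if "{x, y} \<subseteq> {a, b, c, d}" "x \<noteq> y" for x y
  proof -
    have e: "{x, y} \<in> edges K"
      by (rule simplices_face[OF K t that(1)]) (simp add: that(2))
    have "m {x, y} = (\<Sum>j\<in>edges K. if {x, y} = j then length_rate p \<xi> j * (2 * ?l j) else 0)"
      unfolding m_def length_direction_def by (intro sum.cong) auto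
    also have "\<dots> = 2 * ?l {x, y} * length_rate p \<xi> {x, y}"
      using e finite_simplices[OF K] by simp
    finally show ?thesis using length_rate_eq[OF e] by simp
  qed
  have nz: "cross3 (p b - p a) (p c - p a) \<bullet> (p d - p a) \<noteq> 0"
    using vertex_triple_nonzero[OF t] unfolding vertex_triple_def .
  have "(\<Sum>j\<in>edges K. tetrahedron_rate {a, b, c, d} {a, b} j * length_rate p \<xi> j) =
      ?sg * (\<Sum>j\<in>edges K. length_rate p \<xi> j * dihedral_variation ?q (length_direction ?l j) a b c d)"
    unfolding tetrahedron_rate_eq[OF t] sum_distrib_left by (intro sum.cong) simp_all
  also have "\<dots> = ?sg * dihedral_variation ?q m a b c d"
    unfolding m_def dihedral_variation_sum ..
  also have "dihedral_variation ?q m a b c d =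
      sgn (vertex_triple p a b c d) * (axis_rate \<xi> a b d - axis_rate \<xi> a b c)"
    unfolding vertex_triple_def axis_rate_def
    by (rule dihedral_variation_motion[where p = p and \<xi> = \<xi> and a = a and b = b and c = c and d = d,
          OF refl refl refl refl refl refl nz m dist])
  finally show ?thesis
    using nz unfolding sgn_oriented_volume[OF t] vertex_triple_def[symmetric]
    by (simp add: sgn_real_def)
qed

text \<open>
  The sign with which the triangle \<open>abx\<close> contributes to the change of the angle of \<open>t\<close> at \<open>ab\<close>.
  The argument before \<open>x\<close> is the fourth vertex of \<open>t\<close>.
\<close>

definition corner_sign :: "'a \<Rightarrow> 'a \<Rightarrow> 'a set \<Rightarrow> 'a \<Rightarrow> real" where
  "corner_sign a b t x = orient_sign pos a b (the_elem (t - {a, b, x})) x"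

lemma corner_sign_eq:
  assumes "{a, b, c, d} \<in> tetrahedra K"
  shows "corner_sign a b {a, b, c, d} d = orient_sign pos a b c d"
    "corner_sign a b {a, b, c, d} c = - orient_sign pos a b c d"
proof -
  have dist: "distinct [a, b, c, d]" by (rule tetrahedron_distinct[OF assms])
  then have "{a, b, c, d} - {a, b, d} = {c}" "{a, b, c, d} - {a, b, c} = {d}" by auto
  then show "corner_sign a b {a, b, c, d} d = orient_sign pos a b c d"
    "corner_sign a b {a, b, c, d} c = - orient_sign pos a b c d"
    unfolding corner_sign_def by (simp_all add: orient_sign_swap(3)[OF assms])
qed

lemma tetrahedra_at_triangle:
  assumes "card {a, b, x} = 3" "t \<in> tetrahedra K" "{a, b, x} \<subseteq> t"
  obtains y where "t = {a, b, y, x}" "{a, b, y, x} \<in> tetrahedra K"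
proof -
  have "card t = 4" using assms(2) by (simp add: simplices_def)
  then have "card (t - {a, b, x}) = 1"
    using assms(1,3) by (subst card_Diff_subset) (auto intro: card_ge_0_finite)
  then obtain y where "t - {a, b, x} = {y}" by (auto simp: card_1_singleton_iff)
  then have "t = {a, b, y, x}" using assms(3) by blast
  then show thesis using that assms(2) by blast
qed

lemma corner_sign_opposite:
  assumes abx: "card {a, b, x} = 3" and "t \<in> tetrahedra K" "{a, b, x} \<subseteq> t"
    and "t' \<in> tetrahedra K" "{a, b, x} \<subseteq> t'" and "t \<noteq> t'"
  shows "corner_sign a b t' x = - corner_sign a b t x"
proof -
  obtain y where y: "t = {a, b, y, x}" "{a, b, y, x} \<in> tetrahedra K"
    using tetrahedra_at_triangle[OF assms(1-3)] by blast
  obtain y' where y': "t' = {a, b, y', x}" "{a, b, y', x} \<in> tetrahedra K"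
    using tetrahedra_at_triangle[OF assms(1,4,5)] by blast
  have neq: "y \<noteq> y'" using y(1) y'(1) assms(6) by blast
  have to_front: "orient_sign pos a b z x = orient_sign pos z a b x" "{z, a, b, x} \<in> tetrahedra K"
    if "{a, b, z, x} \<in> tetrahedra K" for z
  proof -
    have "{a, z, b, x} = {a, b, z, x}" by auto
    then have azbx: "{a, z, b, x} \<in> tetrahedra K" using that by (rule ssubst)
    have "{z, a, b, x} = {a, b, z, x}" by auto
    then have zabx: "{z, a, b, x} \<in> tetrahedra K" using that by (rule ssubst)
    from orient_sign_swap(2)[OF azbx] orient_sign_swap(1)[OF azbx]
    show "orient_sign pos a b z x = orient_sign pos z a b x" by simp
    show "{z, a, b, x} \<in> tetrahedra K" by (rule zabx)
  qed
  \<comment> \<open>The opposite orientations are given for tuples beginning with the vertex off the face.\<close>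
  have "orient_sign pos y' a b x = - orient_sign pos y a b x"
    by (rule orient_sign_opposite[OF to_front(2)[OF y(2)] to_front(2)[OF y'(2)] neq])
  then show ?thesis
    unfolding y(1) y'(1) corner_sign_eq(1)[OF y(2)] corner_sign_eq(1)[OF y'(2)]
      to_front(1)[OF y(2)] to_front(1)[OF y'(2)] .
qed

text \<open>
  There are at most two tetrahedra at a triangle, because three of them could not have pairwise
  opposite signs.  If there are two, their signs cancel.
\<close>

lemma corner_signs_cancel:
  assumes abx: "card {a, b, x} = 3"
    and not_free: "card {t \<in> tetrahedra K. {a, b, x} \<subseteq> t} \<noteq> 1"
  shows "(\<Sum>t | t \<in> tetrahedra K \<and> {a, b, x} \<subseteq> t. corner_sign a b t x) = 0"
proof -
  define T where "T = {t \<in> tetrahedra K. {a, b, x} \<subseteq> t}"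
  have opposite: "corner_sign a b s' x = - corner_sign a b s x" if "s \<in> T" "s' \<in> T" "s \<noteq> s'" for s s'
    using that corner_sign_opposite[OF abx, of s s'] unfolding T_def by blast
  have nonzero: "corner_sign a b s x \<noteq> 0" for s by (simp add: corner_sign_def orient_sign_def)
  have "(\<Sum>t\<in>T. corner_sign a b t x) = 0"
  proof (cases "T = {}")
    case False
    then obtain t where t: "t \<in> T" by blast
    have "card T \<noteq> 1" using not_free unfolding T_def .
    then have "T \<noteq> {t}" by auto
    then obtain t' where t': "t' \<in> T" "t' \<noteq> t" using t by blast
    have "s = t \<or> s = t'" if "s \<in> T" for s
    proof (rule ccontr)
      assume "\<not> (s = t \<or> s = t')"
      then have "t \<noteq> t'" "t \<noteq> s" "t' \<noteq> s" using t'(2) by auto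
      then show False
        using opposite[OF t t'(1)] opposite[OF t that] opposite[OF t'(1) that] nonzero[of s] by simp
    qed
    then have "T = {t, t'}" using t t' by blast
    then have "(\<Sum>s\<in>T. corner_sign a b s x) = corner_sign a b t x + corner_sign a b t' x"
      using t'(2) by (simp only:) simp
    also have "\<dots> = 0" using opposite[OF t t'(1)] t'(2) by simp
    finally show ?thesis .
  qed simp
  then show ?thesis by (simp add: T_def)
qed

text \<open>
  The sum over tetrahedra is regrouped as a sum over the triangles \<open>abx\<close>.  Triangles on two tetrahedra
  cancel; for the others the rate is the constant \<open>\<tau>\<close>, which may be subtracted throughout because the
  two corners of each tetrahedron have opposite signs.
\<close>

lemma angle_rate_zero:
  assumes i: "{a, b} \<in> edges K"
    and free: "\<And>x. card {a, b, x} = 3 \<Longrightarrow> card {t \<in> tetrahedra K. {a, b, x} \<subseteq> t} = 1 \<Longrightarrow>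
      axis_rate \<xi> a b x = \<tau>"
  shows "(\<Sum>j\<in>edges K. angle_matrix K pos p {a, b} j * length_rate p \<xi> j) = 0"
proof -
  let ?T = "{t \<in> tetrahedra K. {a, b} \<subseteq> t}" and ?X = "vertices K - {a, b}"
  let ?w = "\<lambda>t x. corner_sign a b t x * (axis_rate \<xi> a b x - \<tau>)"
  have finT: "finite ?T" using finite_simplices[OF K] by simp
  have finX: "finite ?X" using finite_vertices[OF K] by simp
  have ab: "a \<noteq> b" using i by (auto simp: simplices_def)
  have rate: "(\<Sum>j\<in>edges K. tetrahedron_rate t {a, b} j * length_rate p \<xi> j) =
      (\<Sum>x | x \<in> ?X \<and> x \<in> t. ?w t x)" if tT: "t \<in> ?T" for t
  proof -
    obtain c d where cd: "t = {a, b, c, d}" "{a, b, c, d} \<in> tetrahedra K" "distinct [a, b, c, d]"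
    proof -
      have "card t = 4" using tT by (simp add: simplices_def)
      then have "card (t - {a, b}) = 2"
        using tT ab by (subst card_Diff_subset) auto
      then obtain c d where "t - {a, b} = {c, d}" by (auto simp: card_2_iff)
      then have t: "t = {a, b, c, d}" using tT by blast
      have "{a, b, c, d} \<in> tetrahedra K" using tT unfolding t by simp
      from t this tetrahedron_distinct[OF this] show thesis by (rule that)
    qed
    have "{x \<in> ?X. x \<in> t} = {c, d}"
      using simplex_vertices[OF K cd(2)] cd(3) unfolding cd(1) by auto
    then have "(\<Sum>x | x \<in> ?X \<and> x \<in> t. ?w t x) = ?w t c + ?w t d"
      using cd(3) by simp
    also have "\<dots> = orient_sign pos a b c d * (axis_rate \<xi> a b d - axis_rate \<xi> a b c)"
      unfolding cd(1) corner_sign_eq[OF cd(2)] by (simp add: algebra_simps)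
    finally show ?thesis unfolding cd(1) tetrahedron_angle_rate[OF cd(2)] by simp
  qed
  have cancel: "(\<Sum>t | t \<in> ?T \<and> x \<in> t. ?w t x) = 0" if x: "x \<in> ?X" for x
  proof -
    have abx: "card {a, b, x} = 3" using x ab by auto
    have T: "{t. t \<in> ?T \<and> x \<in> t} = {t \<in> tetrahedra K. {a, b, x} \<subseteq> t}" by auto
    show ?thesis
    proof (cases "card {t \<in> tetrahedra K. {a, b, x} \<subseteq> t} = 1")
      case True
      then show ?thesis using free[OF abx] by simp
    next
      case False
      show ?thesis
        unfolding T sum_distrib_right[symmetric] using corner_signs_cancel[OF abx False] by simp
    qed
  qed
  have "(\<Sum>j\<in>edges K. angle_matrix K pos p {a, b} j * length_rate p \<xi> j) =
      - (\<Sum>j\<in>edges K. \<Sum>t\<in>?T. tetrahedron_rate t {a, b} j * length_rate p \<xi> j)"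
    unfolding angle_matrix_eq[OF i] by (simp add: sum_distrib_right sum_negf)
  also have "\<dots> = - (\<Sum>t\<in>?T. \<Sum>j\<in>edges K. tetrahedron_rate t {a, b} j * length_rate p \<xi> j)"
    by (subst sum.swap) simp
  also have "\<dots> = - (\<Sum>t\<in>?T. \<Sum>x | x \<in> ?X \<and> x \<in> t. ?w t x)"
    using rate by simp
  also have "\<dots> = - (\<Sum>x\<in>?X. \<Sum>t | t \<in> ?T \<and> x \<in> t. ?w t x)"
    by (subst sum.swap_restrict[OF finT finX]) simp
  also have "\<dots> = 0" using cancel by simp
  finally show ?thesis .
qed

lemma boundary_edge_component:
  assumes "e \<in> edges K" "e \<notin> inner_edges K"
  obtains \<kappa> where "\<kappa> \<in> boundary_components K" "convex hull e \<subseteq> \<kappa>"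
proof -
  have sub: "convex hull e \<subseteq> boundary K" using assms by (simp add: inner_edges_def)
  have "e \<noteq> {}" using assms(1) by (auto simp: simplices_def)
  then have "boundary K \<noteq> {}" using sub hull_subset by fastforce
  then show thesis
    using exists_component_superset[OF sub] convex_connected convex_convex_hull that
    unfolding boundary_components_def by metis
qed

lemma rigid_edge_length_rate:
  assumes "{a, b} \<in> edges K" "{a, b} \<subseteq> S" "moves_as_whole p S \<xi>"
  shows "length_rate p \<xi> {a, b} = 0"
proof -
  obtain r0 r where "\<forall>v\<in>S. \<xi> v = r0 + cross3 r (p v)"
    using assms(3) unfolding moves_as_whole_def by blast
  then have "\<xi> a - \<xi> b = cross3 r (p a - p b)"
    using assms(2) by (simp add: Cross3.right_diff_distrib)
  then show ?thesis
    using edge_position_distinct[OF assms(1)] by (simp add: length_rate_pair dot_cross_self)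
qed

text \<open>
  Free triangles at an inner edge do not exist, since they would put the edge into the boundary.
  Those at a boundary edge lie in its boundary component and take part in one rigid motion.
\<close>

lemma angle_length_rate_zero:
  assumes i: "i \<in> edges K"
    and rigid: "\<And>\<kappa>. \<kappa> \<in> boundary_components K \<Longrightarrow> moves_as_whole p (\<kappa> \<inter> vertices K) \<xi>"
  shows "(\<Sum>j\<in>edges K. angle_matrix K pos p i j * length_rate p \<xi> j) = 0"
proof -
  have "card i = 2" using i by (simp add: simplices_def)
  then obtain a b where ab: "i = {a, b}" "a \<noteq> b" by (auto simp: card_2_iff)
  have free: "convex hull {a, b, x} \<subseteq> boundary K"
    if x: "card {a, b, x} = 3" "card {t \<in> tetrahedra K. {a, b, x} \<subseteq> t} = 1" for x
  proof -
    obtain t where t: "{t \<in> tetrahedra K. {a, b, x} \<subseteq> t} = {t}"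
      by (rule card_1_singletonE[OF x(2)])
    have "t \<in> {t \<in> tetrahedra K. {a, b, x} \<subseteq> t}" unfolding t by simp
    then have t3: "t \<in> tetrahedra K" "{a, b, x} \<subseteq> t" by simp_all
    have "{a, b, x} \<in> simplices K 2"
      by (rule simplices_face[OF K t3]) (simp add: x(1))
    then show ?thesis using t by (rule free_triangle_in_boundary[OF K])
  qed
  show ?thesis
  proof (cases "i \<in> inner_edges K")
    case True
    show ?thesis
      unfolding ab(1)
    proof (rule angle_rate_zero[OF i[unfolded ab(1)]])
      fix x assume "card {a, b, x} = 3" "card {t \<in> tetrahedra K. {a, b, x} \<subseteq> t} = 1"
      then have "convex hull {a, b, x} \<subseteq> boundary K" by (rule free)
      moreover have "convex hull i \<subseteq> convex hull {a, b, x}" unfolding ab(1) by (rule hull_mono) auto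
      \<comment> \<open>This contradicts \<open>i\<close> being an inner edge, so the value \<open>0\<close> is arbitrary.\<close>
      ultimately show "axis_rate \<xi> a b x = 0" using True by (auto simp: inner_edges_def)
    qed
  next
    case False
    obtain \<kappa> where \<kappa>: "\<kappa> \<in> boundary_components K" "convex hull i \<subseteq> \<kappa>"
      using boundary_edge_component[OF i False] by metis
    obtain r0 r where r: "\<And>v. v \<in> \<kappa> \<inter> vertices K \<Longrightarrow> \<xi> v = r0 + cross3 r (p v)"
      using rigid[OF \<kappa>(1)] unfolding moves_as_whole_def by metis
    let ?u = "p b - p a"
    show ?thesis
      unfolding ab(1)
    proof (rule angle_rate_zero[OF i[unfolded ab(1)]])
      fix x assume x: "card {a, b, x} = 3" "card {t \<in> tetrahedra K. {a, b, x} \<subseteq> t} = 1"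
      have "{a, b} \<subseteq> convex hull {a, b}" by (rule hull_subset)
      then have "\<kappa> \<inter> convex hull {a, b, x} \<noteq> {}"
        using \<kappa>(2) hull_subset[of "{a, b, x}" convex] unfolding ab(1) by auto
      then have "convex hull {a, b, x} \<subseteq> \<kappa>"
        using components_maximal[OF \<kappa>(1)[unfolded boundary_components_def] _ free[OF x]]
          convex_connected[OF convex_convex_hull] by blast
      then have "{a, b, x} \<subseteq> \<kappa>" using hull_subset by fast
      have "{t \<in> tetrahedra K. {a, b, x} \<subseteq> t} \<noteq> {}" using x(2) by (metis card.empty zero_neq_one)
      then obtain t where t: "t \<in> tetrahedra K" "{a, b, x} \<subseteq> t" by blast
      then obtain y where y: "{a, b, y, x} \<in> tetrahedra K"
        using tetrahedra_at_triangle[OF x(1)] by metis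
      have "{a, b, x} \<subseteq> \<kappa> \<inter> vertices K"
        using \<open>{a, b, x} \<subseteq> \<kappa>\<close> simplex_vertices[OF K t(1)] t(2) by blast
      then have \<xi>: "\<xi> a = r0 + cross3 r (p a)" "\<xi> b = r0 + cross3 r (p b)" "\<xi> x = r0 + cross3 r (p x)"
        using r by blast+
      have \<xi>': "\<xi> b - \<xi> a = cross3 r ?u" "\<xi> x - \<xi> a = cross3 r (p x - p a)"
        by (simp_all add: \<xi> Cross3.right_diff_distrib)
      have "cross3 ?u (p x - p a) \<noteq> 0"
      proof
        assume "cross3 ?u (p x - p a) = 0"
        then have "vertex_triple p a b x y = 0" by (simp add: vertex_triple_def)
        then show False using vertex_triple_swap(3)[of p a b y x] vertex_triple_nonzero[OF y] by simp
      qed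
      then show "axis_rate \<xi> a b x = norm ?u * (r \<bullet> ?u) / (?u \<bullet> ?u)"
        unfolding axis_rate_def \<xi>' by (rule axis_rotation_rigid)
    qed
  qed
qed

lemma component_vertex:
  assumes "\<kappa> \<in> boundary_components K" "\<kappa>' \<in> boundary_components K" "w \<in> \<kappa>" "w \<in> \<kappa>'"
  shows "\<kappa> = \<kappa>'"
  using assms components_nonoverlap[of \<kappa> "boundary K" \<kappa>'] unfolding boundary_components_def by auto

lemma velocity_rigid_on_components:
  assumes c: "c \<in> config_indices K" and \<kappa>: "\<kappa> \<in> boundary_components K"
  shows "moves_as_whole p (\<kappa> \<inter> vertices K) (velocity p c)"
proof (cases c)
  case (Disp v k)
  then have "v \<notin> boundary K" using c by (auto simp: config_indices_def inner_vertices_def)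
  moreover have "\<kappa> \<subseteq> boundary K" using \<kappa> unfolding boundary_components_def by (rule in_components_subset)
  ultimately have "velocity p c w = 0 + cross3 0 (p w)" if "w \<in> \<kappa>" for w
    using that by (auto simp: Disp)
  then show ?thesis unfolding moves_as_whole_def by blast
next
  case (Sway \<kappa>' s)
  then have \<kappa>': "\<kappa>' \<in> boundary_components K" using c by (auto simp: config_indices_def)
  show ?thesis
  proof (cases "\<kappa> = \<kappa>'")
    case True
    show ?thesis
    proof (cases s)
      case (Translation k)
      then have "velocity p c w = axis k 1 + cross3 0 (p w)" if "w \<in> \<kappa>" for w
        using that True by (simp add: Sway)
      then show ?thesis unfolding moves_as_whole_def by blast
    next
      case (Rotation k)
      then have "velocity p c w = 0 + cross3 (axis k 1) (p w)" if "w \<in> \<kappa>" for w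
        using that True by (simp add: Sway)
      then show ?thesis unfolding moves_as_whole_def by blast
    qed
  next
    case False
    then have "velocity p c w = 0 + cross3 0 (p w)" if "w \<in> \<kappa>" for w
      using that component_vertex[OF \<kappa> \<kappa>'] by (auto simp: Sway)
    then show ?thesis unfolding moves_as_whole_def by blast
  qed
qed

text \<open>
  This allows \<open>f3_f2_zero\<close> to sum over all edges instead of the inner edges and \<open>C\<close>.
\<close>

lemma boundary_edge_rate_zero:
  assumes e: "e \<in> edges K" "e \<notin> inner_edges K" and c: "c \<in> config_indices K"
  shows "f2 p e c = 0"
proof -
  obtain \<kappa> where \<kappa>: "\<kappa> \<in> boundary_components K" "convex hull e \<subseteq> \<kappa>"
    using boundary_edge_component[OF e] by metis
  have "card e = 2" using e by (simp add: simplices_def)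
  then obtain a b where ab: "e = {a, b}" by (auto simp: card_2_iff)
  have "{a, b} \<subseteq> \<kappa> \<inter> vertices K"
    using \<kappa>(2) hull_subset[of e convex] simplex_vertices[OF K e(1)] unfolding ab by blast
  then show ?thesis
    unfolding f2_def ab
    using rigid_edge_length_rate[OF _ _ velocity_rigid_on_components[OF c \<kappa>(1)]] e(1) ab by blast
qed

lemma f3_f2_zero:
  assumes "i \<in> edges K" "C \<subseteq> edges K" "c \<in> config_indices K"
  shows "(\<Sum>j\<in>inner_edges K \<union> C. angle_matrix K pos p i j * f2 p j c) = 0"
proof -
  have "inner_edges K \<subseteq> edges K" by (auto simp: inner_edges_def)
  then have "(\<Sum>j\<in>inner_edges K \<union> C. angle_matrix K pos p i j * f2 p j c) =
      (\<Sum>j\<in>edges K. angle_matrix K pos p i j * f2 p j c)"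
    using assms(2,3) finite_simplices[OF K] boundary_edge_rate_zero
    by (intro sum.mono_neutral_left) auto
  also have "\<dots> = 0"
    unfolding f2_def using velocity_rigid_on_components[OF assms(3)]
    by (intro angle_length_rate_zero[OF assms(1)])
  finally show ?thesis .
qed

text \<open>
  Moving all inner vertices and all boundary components by the same infinitesimal isometry moves
  every vertex by it: a vertex is either inner or in exactly one boundary component.
\<close>

lemma sum_velocities:
  assumes fin: "finite (config_indices K)" and w: "w \<in> vertices K"
  shows "(\<Sum>c\<in>config_indices K. f1 p c s *\<^sub>R velocity p c w) = isometry_field s (p w)"
proof (cases "w \<in> boundary K")
  case True
  then obtain \<kappa> where \<kappa>: "\<kappa> \<in> boundary_components K" "w \<in> \<kappa>"
    unfolding boundary_components_def by (metis UnionE Union_components)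
  have "(\<Sum>c\<in>config_indices K. f1 p c s *\<^sub>R velocity p c w) =
      (\<Sum>c\<in>{Sway \<kappa> s}. f1 p c s *\<^sub>R velocity p c w)"
  proof (intro sum.mono_neutral_right fin ballI)
    show "{Sway \<kappa> s} \<subseteq> config_indices K" using \<kappa>(1) by (auto simp: config_indices_def)
    fix c assume c: "c \<in> config_indices K - {Sway \<kappa> s}"
    show "f1 p c s *\<^sub>R velocity p c w = 0"
    proof (cases c)
      case (Disp v k)
      then have "v \<noteq> w" using c True by (auto simp: config_indices_def inner_vertices_def)
      then show ?thesis by (simp add: Disp)
    next
      case (Sway \<kappa>' s')
      then have \<kappa>': "\<kappa>' \<in> boundary_components K" using c by (auto simp: config_indices_def)
      show ?thesis
      proof (cases "s' = s")
        case True
        then have "w \<notin> \<kappa>'" using component_vertex[OF \<kappa>(1) \<kappa>' \<kappa>(2)] c Sway by auto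
        then show ?thesis by (simp add: Sway)
      qed (simp add: Sway)
    qed
  qed
  then show ?thesis using \<kappa>(2) by simp
next
  case False
  then have inner: "w \<in> inner_vertices K" using w by (simp add: inner_vertices_def)
  have "(\<Sum>c\<in>config_indices K. f1 p c s *\<^sub>R velocity p c w) =
      (\<Sum>c\<in>range (Disp w). f1 p c s *\<^sub>R velocity p c w)"
  proof (intro sum.mono_neutral_right fin ballI)
    show "range (Disp w) \<subseteq> config_indices K" using inner by (auto simp: config_indices_def)
    fix c assume c: "c \<in> config_indices K - range (Disp w)"
    show "f1 p c s *\<^sub>R velocity p c w = 0"
    proof (cases c)
      case (Disp v k)
      then have "v \<noteq> w" using c by auto
      then show ?thesis by (simp add: Disp)
    next
      case (Sway \<kappa> s')
      then have "\<kappa> \<subseteq> boundary K"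
        using c in_components_subset by (auto simp: config_indices_def boundary_components_def)
      then have "w \<notin> \<kappa>" using False by blast
      then show ?thesis by (simp add: Sway)
    qed
  qed
  also have "\<dots> = (\<Sum>k\<in>UNIV. isometry_field s (p w) $ k *\<^sub>R axis k 1)"
    by (subst sum.reindex) (auto simp: inj_on_def)
  also have "\<dots> = isometry_field s (p w)"
    using basis_expansion[of "isometry_field s (p w)"] by (simp add: scalar_mult_eq_scaleR)
  finally show ?thesis .
qed

lemma f2_f1_zero:
  assumes fin: "finite (config_indices K)" and e: "e \<in> edges K"
  shows "(\<Sum>c\<in>config_indices K. f2 p e c * f1 p c s) = 0"
proof -
  have "card e = 2" using e by (simp add: simplices_def)
  then obtain a b where ab: "e = {a, b}" by (auto simp: card_2_iff)
  have V: "a \<in> vertices K" "b \<in> vertices K" using simplex_vertices[OF K e] ab by auto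
  have "f2 p e c * f1 p c s =
      (p a - p b) \<bullet> (f1 p c s *\<^sub>R velocity p c a - f1 p c s *\<^sub>R velocity p c b) / edge_length p e" for c
    using edge_position_distinct[OF e[unfolded ab]]
    by (simp add: f2_def ab length_rate_pair scaleR_diff_right[symmetric])
  then have "(\<Sum>c\<in>config_indices K. f2 p e c * f1 p c s) =
      (p a - p b) \<bullet> ((\<Sum>c\<in>config_indices K. f1 p c s *\<^sub>R velocity p c a) -
        (\<Sum>c\<in>config_indices K. f1 p c s *\<^sub>R velocity p c b)) / edge_length p e"
    by (simp add: sum_divide_distrib inner_sum_right sum_subtractf[symmetric])
  also have "\<dots> = (p a - p b) \<bullet> (isometry_field s (p a) - isometry_field s (p b)) / edge_length p e"
    by (simp only: sum_velocities[OF fin] V)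
  also have "\<dots> = 0"
    by (cases s) (simp_all add: Cross3.right_diff_distrib[symmetric] dot_cross_self)
  finally show ?thesis .
qed

end


section \<open>The generating function\<close>

lemma minor_symmetric:
  assumes "length us = length vs"
    and "\<And>u v. u \<in> set us \<Longrightarrow> v \<in> set vs \<Longrightarrow> f u v = f v u"
  shows "minor f us vs = minor f vs us"
proof -
  have "minor f us vs = minor (\<lambda>v u. f u v) vs us"
    by (rule minor_transpose[OF assms(1)])
  also have "\<dots> = minor f vs us"
    unfolding minor_def
    by (intro arg_cong[where f = Determinant.det] eq_matI) (auto intro!: assms(2))
  finally show ?thesis .
qed

lemma boundary_edges_not_inner:
  assumes "e \<in> E_boundary K S"
  shows "e \<in> edges K" "e \<notin> inner_edges K"
  using assms in_components_subset[of _ "boundary K"]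
  unfolding E_boundary_def component_edges_def boundary_components_def inner_edges_def by auto

theorem theorem3:
  fixes K :: "'a::euclidean_space set set"
    and pos :: "'a \<Rightarrow> 'a \<Rightarrow> 'a \<Rightarrow> 'a \<Rightarrow> bool"
    and p :: "'a \<Rightarrow> real^3"
    and R :: "'a set set"
    and S :: "'a set \<Rightarrow> 'a set set"
    and vA vB vC :: 'a
    and rs es :: "'a set list"
    and xs :: "'a config list"
  assumes "simplicial_complex K" and "manifold3 (\<Union>K)" and "connected (\<Union>K)"
    and "orientation K pos"
    and "general_position K p"
    and "minimal_rigid_construction K p R"
    and "\<And>\<kappa>. \<kappa> \<in> boundary_components K \<Longrightarrow> minimal_surface_rigid_construction K p \<kappa> (S \<kappa>)"
    and "distinct [vA, vB, vC]" and "{vA, vB, vC} \<subseteq> inner_vertices K"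
    and "distinct rs" and "set rs = R"
    and "distinct xs" and "set xs = config_indices K - set (six_coordinates vA vB vC)"
    and "distinct es" and "set es = inner_edges K - R"
  shows "is_generating_function (E_boundary K S)
    (\<lambda>cs ds. invariant K pos p vA vB vC rs xs es cs ds)
    ((minor_f1 p vA vB vC * minor_f5 p vA vB vC / (minor_f2 p rs xs * minor_f4 p rs xs) *
      ((\<Prod>t\<in>tetrahedra K. - 6 * oriented_volume pos p t) /
       (\<Prod>e\<in>inner_edges K. (edge_length p e)\<^sup>2))) *\<^sub>R
     \<Phi> es ((inner_edges K - R) \<union> E_boundary K S) (angle_matrix K pos p))"
proof -
  note K = assms(1) and geom = assms(1,4,5)
  let ?B = "E_boundary K S" and ?F = "angle_matrix K pos p"
  let ?E = "(inner_edges K - R) \<union> ?B"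
  let ?k = "minor_f1 p vA vB vC * minor_f5 p vA vB vC / (minor_f2 p rs xs * minor_f4 p rs xs)"
  let ?v = "(\<Prod>t\<in>tetrahedra K. - 6 * oriented_volume pos p t) / (\<Prod>e\<in>inner_edges K. (edge_length p e)\<^sup>2)"
  have R: "R \<subseteq> inner_edges K"
    using assms(6) unfolding minimal_rigid_construction_def rigid_construction_def by blast
  have inner: "inner_edges K \<subseteq> edges K" by (auto simp: inner_edges_def)
  have B: "?B \<subseteq> edges K" "?B \<inter> inner_edges K = {}"
    using boundary_edges_not_inner by blast+
  have finE: "finite ?E"
    using inner B(1) finite_simplices[OF K, of 1] by (meson Diff_subset finite_subset order_trans Un_least)
  have es: "set es \<subseteq> ?E" "?E - set es = ?B" using assms(15) B(2) by blast+
  have "config_indices K \<subseteq> set xs \<union> set (six_coordinates vA vB vC)" using assms(13) by blast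
  then have finX: "finite (config_indices K)" by (rule finite_subset) simp
  have acyclic: "acyclic_complex K pos p (set cs) (set ds)"
    if "distinct cs" "distinct ds" "set cs \<subseteq> ?B" "set ds \<subseteq> ?B" and "minor_f1 p vA vB vC \<noteq> 0"
      "minor_f2 p rs xs \<noteq> 0" "minor_f3 K pos p es cs ds \<noteq> 0" "minor_f4 p rs xs \<noteq> 0"
      "minor_f5 p vA vB vC \<noteq> 0" for cs ds
  proof (rule acyclic_if_minors_nonzero[OF _ assms(8,9,10,11) R assms(12,13,14,15) that(1,2)
        _ _ _ _ _ that(5-9)])
    show "finite (inner_edges K)" using inner finite_simplices[OF K] finite_subset by blast
    show "set cs \<inter> inner_edges K = {}" "set ds \<inter> inner_edges K = {}" using that(3,4) B(2) by blast+
    have edges: "set cs \<subseteq> edges K" "set ds \<subseteq> edges K" using that(3,4) B(1) by blast+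
    show "(\<Sum>c\<in>config_indices K. f2 p e c * f1 p c s) = 0"
      if "e \<in> inner_edges K \<union> set cs \<union> set ds" for e s
      using that inner edges by (intro f2_f1_zero[OF geom finX]) blast
    show "(\<Sum>j\<in>inner_edges K \<union> set cs. ?F i j * f2 p j c) = 0"
      if "i \<in> inner_edges K \<union> set ds" "c \<in> config_indices K" for i c
      using that inner edges by (intro f3_f2_zero[OF geom]) blast+
    show "(\<Sum>i\<in>inner_edges K \<union> set ds. ?F i j * f2 p i c) = 0"
      if "j \<in> inner_edges K \<union> set cs" "c \<in> config_indices K" for j c
    proof -
      have j: "j \<in> edges K" using that(1) inner edges by blast
      have "(\<Sum>i\<in>inner_edges K \<union> set ds. ?F i j * f2 p i c) =
          (\<Sum>i\<in>inner_edges K \<union> set ds. ?F j i * f2 p i c)"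
        using inner edges(2) angle_matrix_symmetric[OF geom _ j] by (intro sum.cong) auto
      also have "\<dots> = 0" by (rule f3_f2_zero[OF geom j edges(2) that(2)])
      finally show ?thesis .
    qed
  qed
  show ?thesis
    unfolding is_generating_function_def
  proof (intro conjI allI impI)
    fix cs ds :: "'a set list"
    assume cd: "distinct cs \<and> distinct ds \<and> set cs \<subseteq> ?B \<and> set ds \<subseteq> ?B \<and> length cs = length ds"
    have edges: "set (es @ cs) \<subseteq> edges K" "set (es @ ds) \<subseteq> edges K"
      using cd B(1) inner assms(15) by auto
    have "coefficient (\<Phi> es ?E ?F) (pair_word cs ds) = minor ?F (es @ cs) (es @ ds)"
      using cd by (intro coefficient_\<Phi>_pair_word[OF finE es(1)]) auto
    also have "\<dots> = minor_f3 K pos p es cs ds"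
      unfolding minor_f3_def
      by (rule minor_symmetric) (use cd edges in \<open>auto intro!: angle_matrix_symmetric[OF geom]\<close>)
    finally have \<Phi>: "coefficient (\<Phi> es ?E ?F) (pair_word cs ds) = minor_f3 K pos p es cs ds" .
    have "torsion K pos p vA vB vC rs xs es cs ds = ?k * minor_f3 K pos p es cs ds"
    proof (cases "acyclic_complex K pos p (set cs) (set ds)")
      case True
      then show ?thesis by (simp add: torsion_def)
    next
      case False
      \<comment> \<open>A vanishing denominator also makes the quotient zero, so the contrapositive provides all
        five minors.\<close>
      have "?k * minor_f3 K pos p es cs ds = 0"
      proof (rule ccontr)
        assume "?k * minor_f3 K pos p es cs ds \<noteq> 0"
        then have "acyclic_complex K pos p (set cs) (set ds)" using cd by (intro acyclic) auto
        with False show False ..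
      qed
      then show ?thesis using False by (simp add: torsion_def)
    qed
    then show "coefficient ((?k * ?v) *\<^sub>R \<Phi> es ?E ?F) (pair_word cs ds) =
        invariant K pos p vA vB vC rs xs es cs ds"
      unfolding coefficient_scaleR \<Phi> invariant_def by simp
  next
    fix us assume us: "\<not> set us \<subseteq> A ` ?B \<union> Astar ` ?B"
    have "coefficient (\<Phi> es ?E ?F) us = 0"
      using coefficient_\<Phi>_nonzero(1)[OF finE, of es ?F us] us unfolding es(2) by blast
    then show "coefficient ((?k * ?v) *\<^sub>R \<Phi> es ?E ?F) us = 0"
      by (simp add: coefficient_scaleR)
  next
    fix us :: "'a set grassmann_var list"
    assume us: "length (filter (\<lambda>u. u \<in> range A) us) \<noteq> length (filter (\<lambda>u. u \<in> range Astar) us)"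
    have "coefficient (\<Phi> es ?E ?F) us = 0"
      using coefficient_\<Phi>_nonzero(2)[OF finE, of es ?F us] us by blast
    then show "coefficient ((?k * ?v) *\<^sub>R \<Phi> es ?E ?F) us = 0"
      by (simp add: coefficient_scaleR)
  qed
qed

end
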